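(* There exists an absolute constant $C$ such that for every signed graph $\Gamma=(G,\sigma)$ on $N$ vertices and all $1\leq k\leq l\leq N$, $$h_k^{\sigma}(\mu_d)<C\,l\,k^6\,\frac{\lambda_k(\Delta^{\sigma})}{\sqrt{\lambda_l(\Delta^{\sigma})}}.$$
   Context: A signed graph $\Gamma=(G,\sigma)$ consists of a finite simple undirected graph $G=(V,E)$ with $N=|V|$ vertices, positive symmetric edge weights $w_{uv}>0$ for $\{u,v\}\in E$ ($w_{uv}=0$ otherwise), and a signature $\sigma:E\to\{+1,-1\}$; write $\sigma(uv)=\sigma(\{u,v\})$. The degree is $d_u=\sum_v w_{uv}$ (assumed positive). $D=\mathrm{diag}(d_u)$, $A^{\sigma}_{uv}=\sigma(uv)w_{uv}$ for edges and $0$ otherwise, $\Delta^{\sigma}=I-D^{-1}A^{\sigma}$, with eigenvalues $0\le\lambda_1(\Delta^\sigma)\le\cdots\le\lambda_N(\Delta^\sigma)\le2$. For a positive measure $\mu$ on $V$, $\mathrm{vol}_\mu(S)=\sum_{u\in S}\mu(u)$; $\mu_d(u)=d_u$. For $V_1,V_2\subseteq V$, $|E(V_1,V_2)|=\sum_{u\in V_1}\sum_{v\in V_2}w_{uv}$, $|E^{\pm}(V_1,V_2)|=\sum_{u\in V_1}\sum_{v\in V_2,\sigma(uv)=\pm1}w_{uv}$, $|E^\pm(V_1)|=|E^\pm(V_1,V_1)|$. A sub-bipartition $(V_1,V_2)$ is a pair of disjoint subsets with $V_1\cup V_2\ne\emptyset$, and $$\beta^{\sigma}(V_1,V_2)=\frac{2|E^{+}(V_1,V_2)|+|E^-(V_1)|+|E^-(V_2)|+|E(V_1\cup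 V_2,\overline{V_1\cup V_2})|}{\mathrm{vol}_{\mu}(V_1\cup V_2)}.$$ The $k$-way signed Cheeger constant $h^{\sigma}_k(\mu)$ is the minimum of $\max_{1\le i\le k}\beta^{\sigma}(V_{2i-1},V_{2i})$ over all $k$-tuples of sub-bipartitions $(V_1,V_2),\dots,(V_{2k-1},V_{2k})$ with $V_1\cup V_2,\dots,V_{2k-1}\cup V_{2k}$ pairwise disjoint.
   Formalization: The strict inequality is asserted when λ_k > 0; when λ_k = 0 it fails (one positive edge, k=1, l=2 gives 0 < 0), so there only ≤ is stated, with the right side read as 0 when λ_k = λ_l = 0. *)

theory Defs
  imports "Jordan_Normal_Form.Char_Poly" "HOL-Library.Disjoint_Sets"
begin

text \<open>Vertices are numbered \<open>0, \<dots>, N - 1\<close>; this is no restriction up to isomorphism, and it makes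
  quantification over all finite signed graphs possible inside a formula.\<close>

locale signed_graph =
  fixes N :: nat
    and E :: "nat set set"
    and w :: "nat \<Rightarrow> nat \<Rightarrow> real"
    and \<sigma> :: "nat set \<Rightarrow> real"
  assumes edges: "e \<in> E \<Longrightarrow> \<exists>u v. u < N \<and> v < N \<and> u \<noteq> v \<and> e = {u, v}"
    and w_sym: "w u v = w v u"
    and w_pos: "{u, v} \<in> E \<Longrightarrow> w u v > 0"
    and w_zero: "{u, v} \<notin> E \<Longrightarrow> w u v = 0"
    and signature: "e \<in> E \<Longrightarrow> \<sigma> e \<in> {1, -1}"
    and degree_pos: "u < N \<Longrightarrow> (\<Sum>v<N. w u v) > 0"
begin

definition degree :: "nat \<Rightarrow> real" where
  "degree u = (\<Sum>v<N. w u v)"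

definition signed_adjacency :: "real mat" where
  "signed_adjacency = mat N N (\<lambda>(u, v). if {u, v} \<in> E then \<sigma> {u, v} * w u v else 0)"

definition signed_laplacian :: "real mat" where
  "signed_laplacian = 1\<^sub>m N - mat_diag N (\<lambda>u. inverse (degree u)) * signed_adjacency"

text \<open>The \<open>k\<close>-th smallest eigenvalue (\<open>1 \<le> k \<le> N\<close>), counted with multiplicity. The Laplacian is
  similar to the symmetric matrix \<open>I - D\<^sup>-\<^sup>1\<^sup>/\<^sup>2 A D\<^sup>-\<^sup>1\<^sup>/\<^sup>2\<close>, so its characteristic polynomial has \<open>N\<close> real roots.\<close>

definition lam :: "nat \<Rightarrow> real" where
  "lam k = sorted_list_of_multiset (proots (char_poly signed_laplacian)) ! (k - 1)"

definition vol :: "(nat \<Rightarrow> real) \<Rightarrow> nat set \<Rightarrow> real" where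
  "vol \<mu> S = (\<Sum>u\<in>S. \<mu> u)"

definition edge_weight :: "nat set \<Rightarrow> nat set \<Rightarrow> real" where
  "edge_weight A B = (\<Sum>u\<in>A. \<Sum>v\<in>B. w u v)"

definition signed_edge_weight :: "real \<Rightarrow> nat set \<Rightarrow> nat set \<Rightarrow> real" where
  "signed_edge_weight s A B = (\<Sum>u\<in>A. \<Sum>v\<in>{v \<in> B. {u, v} \<in> E \<and> \<sigma> {u, v} = s}. w u v)"

definition sub_bipartition :: "nat set \<Rightarrow> nat set \<Rightarrow> bool" where
  "sub_bipartition A B \<longleftrightarrow> A \<subseteq> {..<N} \<and> B \<subseteq> {..<N} \<and> A \<inter> B = {} \<and> A \<union> B \<noteq> {}"

definition signed_bipartiteness_ratio :: "(nat \<Rightarrow> real) \<Rightarrow> nat set \<Rightarrow> nat set \<Rightarrow> real" where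
  "signed_bipartiteness_ratio \<mu> A B =
     (2 * signed_edge_weight 1 A B + signed_edge_weight (-1) A A + signed_edge_weight (-1) B B
        + edge_weight (A \<union> B) ({..<N} - (A \<union> B)))
     / vol \<mu> (A \<union> B)"

text \<open>The minimum is over a finite set, nonempty for \<open>1 \<le> k \<le> N\<close>: only the values of the family
  at \<open>1, \<dots>, 2 k\<close> matter.\<close>

definition cheeger_const :: "nat \<Rightarrow> (nat \<Rightarrow> real) \<Rightarrow> real" where
  "cheeger_const k \<mu> =
     Min {Max ((\<lambda>i. signed_bipartiteness_ratio \<mu> (V (2 * i - 1)) (V (2 * i))) ` {1..k}) | V.
            (\<forall>i\<in>{1..k}. sub_bipartition (V (2 * i - 1)) (V (2 * i))) \<and>
            disjoint_family_on (\<lambda>i. V (2 * i - 1) \<union> V (2 * i)) {1..k}}"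

end

end

theory Submission
  imports Defs "HOL-Computational_Algebra.Fundamental_Theorem_Algebra" "HOL-Analysis.L2_Norm"
begin

text \<open>
  Map each vertex \<open>u\<close> to \<open>F u = (f\<^sub>1 u, \<dots>, f\<^sub>k u)\<close>, where the \<open>f\<^sub>i\<close> are the first \<open>k\<close> eigenfunctions. This
  map is isotropic, so the vertices whose directions \<open>\<plusminus> F u / \<bar>F u\<bar>\<close> lie in one small cell carry mass at
  most about \<open>1\<close> out of the total \<open>k\<close>. Cutting \<open>\<real>\<^sup>k\<close> along a suitably shifted grid that is invariant under
  negation loses little mass, and averaging over the shifts keeps the energy of the cut-off map under
  control. Grouping the cells gives \<open>k\<close> disjointly supported functions with Rayleigh quotient
  \<open>O(k\<^sup>6) \<lambda>\<^sub>k\<close>.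

  For a single function \<open>f\<close>, choose thresholds greedily so that between two consecutive ones the
  distance of \<open>\<bar>f\<bar>\<close> to them has square norm \<open>4 E(f) / (l \<lambda>\<^sub>l)\<close>. At most \<open>2 l\<close> thresholds are needed, since
  otherwise \<open>l\<close> of these distance functions would span a space on which the Rayleigh quotient is less
  than \<open>\<lambda>\<^sub>l\<close>. The coarea formula for a primitive of the distance to the thresholds then yields a
  sub-bipartition inside the support of \<open>f\<close> with ratio \<open>O(l) R(f) / sqrt \<lambda>\<^sub>l\<close>.
\<close>

section \<open>Diagonalization of symmetric real matrices\<close>

text \<open>An edge of sign -1 is cheap when its ends take opposite values, so embedded points can
  only be compared modulo the antipodal map. Cutting at radii \<open>|n|\<close> and recording a
  cell as an unordered pair of opposite labels achieves this without choosing signs for the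
  vertices.

  A hard cut would destroy the energy. Here the cutoff vanishes at the cuts, and a short edge meets
  a cut only for few shifts; together this makes the average cost quadratic in the length of the
  edge, for short and long edges alike.

  The power of \<open>k\<close> comes from the mass budget: \<open>k\<close> groups must be formed
  from total mass \<open>k\<close>, so the total loss must stay below a constant (about
  \<open>k^2\<close> shifts) and one cell may exceed mass 1 only by \<open>O(1/k)\<close> (squared
  diameter \<open>O(1/k)\<close>). Then \<open>\<eta>\<close> is of order \<open>k^(-3)\<close>, the
  averaged cost factor is \<open>1 / (\<eta>^2 M) = 200 k^4\<close> up to constants, and summing
  \<open>k\<close> eigenvalues gives one more factor \<open>k\<close>. The resulting
  \<open>k^5\<close> lies below \<open>k^6\<close>.\<close>

lemma symmetric_real_eigenvector:
  fixes S :: "real mat"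
  assumes S: "S \<in> carrier_mat n n" and sym: "transpose_mat S = S" and n: "n > 0"
  shows "\<exists>v e. v \<in> carrier_vec n \<and> v \<bullet> v = 1 \<and> S *\<^sub>v v = e \<cdot>\<^sub>v v"
proof -
  define A where "A = map_mat complex_of_real S"
  have A: "A \<in> carrier_mat n n" using S by (simp add: A_def)
  have "degree (char_poly A) = n" using degree_monic_char_poly[OF A] by simp
  then have "\<not> constant (poly (char_poly A))" using n by (simp add: constant_degree)
  then obtain e where e: "poly (char_poly A) e = 0" using fundamental_theorem_of_algebra by blast
  then obtain x where x: "eigenvector A x e"
    using eigenvalue_root_char_poly[OF A] unfolding eigenvalue_def by blast
  have xc: "x \<in> carrier_vec n" and x0: "x \<noteq> 0\<^sub>v n" and Ax: "A *\<^sub>v x = e \<cdot>\<^sub>v x"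
    using x A unfolding eigenvector_def by auto
  have symS: "S $$ (i, j) = S $$ (j, i)" if "i < n" "j < n" for i j
    using sym S that by (metis carrier_matD index_transpose_mat(1))
  have row: "(\<Sum>j<n. S $$ (i, j) * x $ j) = e * x $ i" if "i < n" for i
  proof -
    have "(A *\<^sub>v x) $ i = e * x $ i" using Ax xc that by simp
    then show ?thesis using that A S xc
      by (simp add: A_def scalar_prod_def lessThan_atLeast0)
  qed
  \<comment> \<open>\<open>X\<close> is the Hermitian form of \<open>S\<close> at \<open>x\<close>.
    It equals its own conjugate because \<open>S\<close> is real and symmetric, so
    \<open>X = e * r\<close> with \<open>r > 0\<close> makes \<open>e\<close> real. The vector
    \<open>x\<close> itself may be non-real; a real eigenvector comes from the real root of the
    characteristic polynomial.\<close>
  define X where "X = (\<Sum>i<n. \<Sum>j<n. S $$ (i, j) * x $ j * cnj (x $ i))"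
  define r where "r = (\<Sum>i<n. (cmod (x $ i))\<^sup>2)"
  have X: "X = e * r"
  proof -
    have "X = (\<Sum>i<n. (\<Sum>j<n. S $$ (i, j) * x $ j) * cnj (x $ i))"
      by (simp add: X_def sum_distrib_right)
    also have "\<dots> = (\<Sum>i<n. e * (cmod (x $ i))\<^sup>2)"
      by (intro sum.cong refl) (simp only: row complex_norm_square lessThan_iff mult.assoc)
    finally show ?thesis by (simp add: r_def sum_distrib_left)
  qed
  have "cnj X = (\<Sum>i<n. \<Sum>j<n. S $$ (i, j) * cnj (x $ j) * x $ i)" by (simp add: X_def)
  also have "\<dots> = (\<Sum>j<n. \<Sum>i<n. S $$ (i, j) * cnj (x $ j) * x $ i)" by (rule sum.swap)
  also have "\<dots> = X" unfolding X_def
    by (intro sum.cong refl) (simp add: symS mult_ac)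
  finally have cX: "cnj X = X" .
  obtain i where i: "i < n" "x $ i \<noteq> 0"
    using x0 xc by (metis carrier_vecD eq_vecI index_zero_vec)
  have "r > 0" unfolding r_def by (rule sum_pos2[of _ i]) (use i in auto)
  have "cnj e * r = e * r" using cX X by simp
  then have "cnj e = e" using \<open>r > 0\<close> by auto
  then obtain e' where e': "e = of_real e'" by (metis Reals_cases Reals_cnj_iff)
  have "poly (char_poly A) (of_real e') = of_real (poly (char_poly S) e')"
    unfolding A_def of_real_hom.char_poly_hom[OF S] by simp
  then have "poly (char_poly S) e' = 0" using e e' by simp
  then obtain y where "eigenvector S y e'"
    using eigenvalue_root_char_poly[OF S] unfolding eigenvalue_def by blast
  then have yc: "y \<in> carrier_vec n" and y0: "y \<noteq> 0\<^sub>v n" and Sy: "S *\<^sub>v y = e' \<cdot>\<^sub>v y"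
    using S unfolding eigenvector_def by auto
  obtain j where j: "j < n" "y $ j \<noteq> 0"
    using y0 yc by (metis carrier_vecD eq_vecI index_zero_vec)
  have pos: "y \<bullet> y > 0" unfolding scalar_prod_def
    by (rule sum_pos2[of _ j]) (use j yc in \<open>auto simp: zero_less_mult_iff\<close>)
  define v where "v = (1 / sqrt (y \<bullet> y)) \<cdot>\<^sub>v y"
  have "v \<bullet> v = 1" using pos yc by (simp add: v_def field_simps)
  moreover have "S *\<^sub>v v = e' \<cdot>\<^sub>v v" using S yc
    by (simp add: v_def mult_mat_vec Sy smult_smult_assoc mult.commute)
  moreover have "v \<in> carrier_vec n" using yc by (simp add: v_def)
  ultimately show ?thesis by blast
qed

text \<open>Reflection in the hyperplane orthogonal to \<open>x = v - e_0\<close>, which swaps the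
  unit vectors \<open>v\<close> and \<open>e_0\<close>. If \<open>v = e_0\<close>, then
  \<open>q = 0\<close>, the quotient in \<open>H\<close> is 0 by the convention for division, and
  \<open>H\<close> is the identity.\<close>

lemma householder:
  fixes v :: "real vec"
  assumes v: "v \<in> carrier_vec n" and unit: "v \<bullet> v = 1" and n: "n > 0"
  shows "\<exists>H \<in> carrier_mat n n. transpose_mat H = H \<and> H * H = 1\<^sub>m n \<and> col H 0 = v"
proof -
  define x where "x i = v $ i - (if i = 0 then 1 else 0)" for i
  define q where "q = (\<Sum>i<n. (x i)\<^sup>2)"
  define H where "H = mat n n (\<lambda>(i, j). (if i = j then 1 else 0) - 2 * x i * x j / q)"
  have H: "H \<in> carrier_mat n n" by (simp add: H_def)
  have vv: "(\<Sum>i<n. (v $ i)\<^sup>2) = 1"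
    using unit v by (simp add: scalar_prod_def lessThan_atLeast0 power2_eq_square)
  have "q = (\<Sum>i<n. (v $ i)\<^sup>2 + (if i = 0 then 1 - 2 * v $ 0 else 0))"
    unfolding q_def by (rule sum.cong) (auto simp: x_def power2_eq_square algebra_simps)
  then have q: "q = 2 - 2 * v $ 0" using n by (simp add: sum.distrib vv)
  have x0: "x i = 0" if "q = 0" "i < n" for i
    using that by (simp add: q_def sum_nonneg_eq_0_iff)
  have "transpose_mat H = H"
    by (rule eq_matI) (auto simp: H_def)
  moreover have "H * H = 1\<^sub>m n"
  proof (rule eq_matI)
    fix i j assume "i < dim_row (1\<^sub>m n :: real mat)" "j < dim_col (1\<^sub>m n :: real mat)"
    then have ij: "i < n" "j < n" by auto
    have "(H * H) $$ (i, j) = (\<Sum>l<n. ((if i = l then 1 else 0) - 2 * x i * x l / q)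
        * ((if l = j then 1 else 0) - 2 * x l * x j / q))"
      using ij by (simp add: H_def scalar_prod_def lessThan_atLeast0)
    also have "\<dots> = (\<Sum>l<n. (if i = l then (if l = j then 1 else 0) else 0)
        - (if i = l then 2 * x l * x j / q else 0) - (if l = j then 2 * x i * x l / q else 0)
        + 4 * x i * x j / q\<^sup>2 * (x l)\<^sup>2)"
      by (intro sum.cong refl) (auto simp: algebra_simps power2_eq_square)
    also have "\<dots> = (if i = j then 1 else 0) - 4 * x i * x j / q + 4 * x i * x j / q\<^sup>2 * q"
      using ij unfolding sum.distrib sum_subtractf sum_distrib_left[symmetric] q_def[symmetric]
      by simp
    also have "\<dots> = (if i = j then 1 else 0)"
      by (simp add: power2_eq_square)
    finally show "(H * H) $$ (i, j) = 1\<^sub>m n $$ (i, j)" using ij by simp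
  qed (use H in auto)
  moreover have "col H 0 = v"
  proof (rule eq_vecI)
    fix i assume "i < dim_vec v"
    then have i: "i < n" using v by simp
    show "col H 0 $ i = v $ i"
    proof (cases "q = 0")
      case True
      then show ?thesis using i n x0[OF True i] by (auto simp: H_def x_def)
    next
      case False
      have "x 0 = - q / 2" by (simp add: x_def q)
      then have "2 * x i * x 0 / q = - x i" using False by simp
      then show ?thesis using i n by (simp add: H_def x_def)
    qed
  qed (use v H in auto)
  ultimately show ?thesis using H by blast
qed

text \<open>Deflation: conjugating by a reflection that sends \<open>e_0\<close> to a unit
  eigenvector clears the first column, symmetry clears the first row, and induction applies to the
  remaining block.\<close>

theorem symmetric_real_diagonalizable:
  fixes S :: "real mat"
  assumes "S \<in> carrier_mat n n" and "transpose_mat S = S"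
  shows "\<exists>Q D. Q \<in> carrier_mat n n \<and> D \<in> carrier_mat n n \<and> transpose_mat Q * Q = 1\<^sub>m n
    \<and> diagonal_mat D \<and> transpose_mat Q * S * Q = D"
  using assms
proof (induction n arbitrary: S)
  case 0
  then show ?case
    by (intro exI[of _ "1\<^sub>m 0"] exI[of _ "0\<^sub>m 0 0"]) (auto simp: diagonal_mat_def)
next
  case (Suc n)
  note S = Suc.prems(1)
  obtain v e where v: "v \<in> carrier_vec (Suc n)" "v \<bullet> v = 1" "S *\<^sub>v v = e \<cdot>\<^sub>v v"
    using symmetric_real_eigenvector[OF Suc.prems] by auto
  obtain H where H: "H \<in> carrier_mat (Suc n) (Suc n)" and Ht: "transpose_mat H = H"
    and HH: "H * H = 1\<^sub>m (Suc n)" and H0: "col H 0 = v"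
    using householder[OF v(1,2)] by auto
  define T where "T = H * S * H"
  have T: "T \<in> carrier_mat (Suc n) (Suc n)" using H S by (simp add: T_def)
  have Tt: "transpose_mat T = T"
    using H S Ht Suc.prems(2)
    by (simp add: T_def transpose_mult[of _ "Suc n" "Suc n" _ "Suc n"]
        assoc_mult_mat[of _ "Suc n" "Suc n" _ "Suc n" _ "Suc n"])
  have "col T 0 = (H * S) *\<^sub>v v" unfolding T_def H0[symmetric]
    by (rule col_mult2[of _ "Suc n" "Suc n" _ "Suc n"]) (use H S in auto)
  also have "\<dots> = H *\<^sub>v (S *\<^sub>v v)" using assoc_mult_mat_vec[OF H S v(1)] .
  also have "\<dots> = e \<cdot>\<^sub>v (H *\<^sub>v v)" using H v by (simp add: mult_mat_vec)
  also have "H *\<^sub>v v = col (H * H) 0" unfolding H0[symmetric]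
    by (rule col_mult2[symmetric, of _ "Suc n" "Suc n" _ "Suc n"]) (use H in auto)
  also have "\<dots> = unit_vec (Suc n) 0" by (simp add: HH)
  finally have T0: "col T 0 = e \<cdot>\<^sub>v unit_vec (Suc n) 0" .
  have Ti0: "T $$ (i, 0) = (if i = 0 then e else 0)" if "i < Suc n" for i
    using arg_cong[OF T0, of "\<lambda>x. x $ i"] that T by auto
  have symT: "T $$ (i, j) = T $$ (j, i)" if "i < Suc n" "j < Suc n" for i j
    using Tt T that by (metis carrier_matD index_transpose_mat(1))
  define S' where "S' = mat n n (\<lambda>(i, j). T $$ (Suc i, Suc j))"
  have S': "S' \<in> carrier_mat n n" by (simp add: S'_def)
  have "transpose_mat S' = S'"
    by (rule eq_matI) (auto simp: S'_def symT)
  from Suc.IH[OF S' this] obtain Q' D' where Q': "Q' \<in> carrier_mat n n"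
    and D': "D' \<in> carrier_mat n n" and QQ': "transpose_mat Q' * Q' = 1\<^sub>m n"
    and dD': "diagonal_mat D'" and QSQ': "transpose_mat Q' * S' * Q' = D'" by blast
  define e' where "e' = e \<cdot>\<^sub>m (1\<^sub>m 1 :: real mat)"
  have e': "e' \<in> carrier_mat 1 1" by (simp add: e'_def)
  let ?Z1 = "0\<^sub>m 1 n :: real mat" and ?Z2 = "0\<^sub>m n 1 :: real mat"
  define F where "F = four_block_mat (1\<^sub>m 1) ?Z1 ?Z2 Q'"
  define D where "D = four_block_mat e' ?Z1 ?Z2 D'"
  have F: "F \<in> carrier_mat (Suc n) (Suc n)" using four_block_carrier_mat[of "1\<^sub>m 1 :: real mat" 1 1 Q' n n] Q' by (simp add: F_def)
  have D: "D \<in> carrier_mat (Suc n) (Suc n)" using four_block_carrier_mat[OF e' D'] by (simp add: D_def)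
  have Ft: "transpose_mat F = four_block_mat (1\<^sub>m 1) ?Z1 ?Z2 (transpose_mat Q')"
    unfolding F_def by (subst transpose_four_block_mat[of _ 1 1 _ n _ n]) (use Q' in auto)
  have TT: "T = four_block_mat e' ?Z1 ?Z2 S'"
  proof (rule eq_matI)
    fix i j assume "i < dim_row (four_block_mat e' ?Z1 ?Z2 S')"
      "j < dim_col (four_block_mat e' ?Z1 ?Z2 S')"
    then have ij: "i < Suc n" "j < Suc n" using e' S' by auto
    then show "T $$ (i, j) = four_block_mat e' ?Z1 ?Z2 S' $$ (i, j)"
      using e' S' Ti0[of i] Ti0[of j] symT[of i j]
      by (cases i; cases j) (auto simp: S'_def e'_def)
  qed (use T e' S' in auto)
  have FF: "transpose_mat F * F = 1\<^sub>m (Suc n)"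
  proof -
    have "transpose_mat F * F = four_block_mat (1\<^sub>m 1) ?Z1 ?Z2 (1\<^sub>m n)"
      unfolding Ft unfolding F_def
      by (subst mult_four_block_mat[of _ 1 1 _ n _ n]) (use Q' QQ' in auto)
    then show ?thesis by (simp add: four_block_one_mat)
  qed
  have FTF: "transpose_mat F * T * F = D"
  proof -
    have "transpose_mat F * T = four_block_mat e' ?Z1 ?Z2 (transpose_mat Q' * S')"
      unfolding Ft TT by (subst mult_four_block_mat[of _ 1 1 _ n _ n]) (use Q' e' S' in auto)
    also have "\<dots> * F = D" unfolding F_def D_def
      by (subst mult_four_block_mat[of _ 1 1 _ n _ n]) (use Q' e' S' QSQ' in auto)
    finally show ?thesis .
  qed
  define Q where "Q = H * F"
  have Q: "Q \<in> carrier_mat (Suc n) (Suc n)" using H F by (simp add: Q_def)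
  have Qt: "transpose_mat Q = transpose_mat F * H"
    unfolding Q_def by (subst transpose_mult[OF H F]) (simp add: Ht)
  note assoc = assoc_mult_mat[of _ "Suc n" "Suc n" _ "Suc n" _ "Suc n"]
  have Ftc: "transpose_mat F \<in> carrier_mat (Suc n) (Suc n)" using F by simp
  have "transpose_mat Q * Q = transpose_mat F * (H * H) * F"
    unfolding Qt unfolding Q_def using H F Ftc by (simp add: assoc)
  then have 1: "transpose_mat Q * Q = 1\<^sub>m (Suc n)" using Ftc FF by (simp add: HH)
  have "transpose_mat Q * S * Q = transpose_mat F * T * F"
    unfolding Qt T_def unfolding Q_def using H F Ftc S by (simp add: assoc)
  then have 2: "transpose_mat Q * S * Q = D" by (simp add: FTF)
  have "diagonal_mat D" unfolding diagonal_mat_def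
  proof (intro allI impI)
    fix i j assume ij: "i < dim_row D" "j < dim_col D" "i \<noteq> j"
    then show "D $$ (i, j) = 0" using D' e' dD'
      by (auto simp: D_def e'_def diagonal_mat_def)
  qed
  with 1 2 Q D show ?case by blast
qed

section \<open>The spectrum of the signed Laplacian\<close>

lemma proots_linear_factors:
  "proots (\<Prod>a\<leftarrow>xs. [:- a, 1:]) = mset (xs :: real list)"
proof (induction xs)
  case (Cons x xs)
  have "(\<Prod>a\<leftarrow>xs. [:- a, 1:]) \<noteq> 0" by (auto simp: prod_list_zero_iff)
  then show ?case using Cons.IH by (simp add: proots_mult proots_linear_factor del: mult_pCons_left)
qed simp

text \<open>These are \<open>n\<close> equations in \<open>n + 1\<close> unknowns. A zero row makes
  the matrix square, and that row forces its determinant to vanish.\<close>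

lemma nontrivial_kernel:
  fixes m :: "nat \<Rightarrow> nat \<Rightarrow> real"
  shows "\<exists>a. (\<exists>j\<le>n. a j \<noteq> 0) \<and> (\<forall>i<n. (\<Sum>j\<le>n. m i j * a j) = 0)"
proof -
  define M where "M = mat (Suc n) (Suc n) (\<lambda>(i, j). if i < n then m i j else 0)"
  have M: "M \<in> carrier_mat (Suc n) (Suc n)" by (simp add: M_def)
  have "transpose_mat M *\<^sub>v unit_vec (Suc n) n = 0\<^sub>v (Suc n)"
    by (rule eq_vecI) (auto simp: M_def)
  moreover have "unit_vec (Suc n) n \<noteq> (0\<^sub>v (Suc n) :: real vec)" by simp
  ultimately have "det (transpose_mat M) = 0"
    using M det_0_iff_vec_prod_zero[of "transpose_mat M" "Suc n"]
    by (metis transpose_carrier_mat unit_vec_carrier)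
  then have "det M = 0" using M by (simp add: det_transpose)
  then obtain v where v: "v \<in> carrier_vec (Suc n)" "v \<noteq> 0\<^sub>v (Suc n)" "M *\<^sub>v v = 0\<^sub>v (Suc n)"
    using det_0_iff_vec_prod_zero[OF M] by blast
  have "\<exists>j<Suc n. v $ j \<noteq> 0" using v(1,2) by (metis carrier_vecD eq_vecI index_zero_vec)
  moreover have "(\<Sum>j\<le>n. m i j * v $ j) = 0" if "i < n" for i
  proof -
    have "(M *\<^sub>v v) $ i = 0" using v(3) that by simp
    then show ?thesis using that v(1)
      by (simp add: M_def scalar_prod_def lessThan_atLeast0[symmetric] lessThan_Suc_atMost)
  qed
  ultimately show ?thesis by (metis less_Suc_eq_le)
qed

section \<open>Energy, norm and eigenbasis of the signed Laplacian\<close>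

context signed_graph
begin

text \<open>The value 1 on non-edges makes \<open>sign\<close> everywhere 1 or -1; those pairs have
  weight 0.\<close>

definition sign :: "nat \<Rightarrow> nat \<Rightarrow> real" where
  "sign u v = (if {u, v} \<in> E then \<sigma> {u, v} else 1)"

text \<open>The quadratic form of the Laplacian for the inner product weighted by
  \<open>degree\<close> (see \<open>energy_eq\<close>); the factor 1/2 compensates for counting
  ordered pairs.\<close>

definition energy :: "(nat \<Rightarrow> real) \<Rightarrow> real" where
  "energy f = (\<Sum>u<N. \<Sum>v<N. w u v * (f u - sign u v * f v)\<^sup>2) / 2"

definition sqnorm :: "(nat \<Rightarrow> real) \<Rightarrow> real" where
  "sqnorm f = (\<Sum>u<N. degree u * (f u)\<^sup>2)"

lemma sign_cases: "sign u v = 1 \<or> sign u v = -1"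
  using signature[of "{u, v}"] by (auto simp: sign_def)

lemma sign_commute: "sign u v = sign v u"
  by (simp add: sign_def insert_commute)

lemma sign_square [simp]: "(sign u v)\<^sup>2 = 1"
  using sign_cases[of u v] by auto

lemma abs_sign [simp]: "\<bar>sign u v\<bar> = 1"
  using sign_cases[of u v] by auto

lemma weight_nonneg: "w u v \<ge> 0"
  using w_pos[of u v] w_zero[of u v] by fastforce

lemma degree_positive: "u < N \<Longrightarrow> degree u > 0"
  unfolding degree_def by (rule degree_pos)

lemma sum_weight_left: "(\<Sum>u<N. \<Sum>v<N. w u v * h u) = (\<Sum>u<N. degree u * h u)"
  by (simp add: degree_def sum_distrib_right)

lemma sum_weight_right: "(\<Sum>u<N. \<Sum>v<N. w u v * h v) = (\<Sum>u<N. degree u * h u)"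
  by (subst sum.swap) (simp add: degree_def sum_distrib_right w_sym)

lemma energy_nonneg: "energy f \<ge> 0"
  by (auto simp: energy_def intro!: sum_nonneg mult_nonneg_nonneg weight_nonneg)

lemma sqnorm_nonneg: "sqnorm f \<ge> 0"
  by (auto simp: sqnorm_def intro!: sum_nonneg mult_nonneg_nonneg less_imp_le[OF degree_positive])

lemma energy_eq:
  "energy f = sqnorm f - (\<Sum>u<N. \<Sum>v<N. sign u v * w u v * f u * f v)"
proof -
  have "w u v * (f u - sign u v * f v)\<^sup>2 =
    w u v * (f u)\<^sup>2 + w u v * (f v)\<^sup>2 - 2 * (sign u v * w u v * f u * f v)" for u v
    using sign_cases[of u v] by (auto simp: power2_eq_square algebra_simps)
  then have "2 * energy f = (\<Sum>u<N. \<Sum>v<N. w u v * (f u)\<^sup>2) + (\<Sum>u<N. \<Sum>v<N. w u v * (f v)\<^sup>2)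
      - 2 * (\<Sum>u<N. \<Sum>v<N. sign u v * w u v * f u * f v)"
    by (simp add: energy_def sum.distrib sum_subtractf flip: sum_distrib_left)
  then show ?thesis by (simp add: sum_weight_left sum_weight_right sqnorm_def)
qed

lemma energy_le_two_sqnorm: "energy f \<le> 2 * sqnorm f"
proof -
  have "w u v * (f u - sign u v * f v)\<^sup>2 \<le> 2 * (w u v * (f u)\<^sup>2) + 2 * (w u v * (f v)\<^sup>2)" for u v
  proof -
    have "0 \<le> w u v * (f u + sign u v * f v)\<^sup>2" by (simp add: weight_nonneg)
    then show ?thesis
      using sign_cases[of u v] by (auto simp: power2_eq_square algebra_simps)
  qed
  then have "2 * energy f \<le> (\<Sum>u<N. \<Sum>v<N. 2 * (w u v * (f u)\<^sup>2) + 2 * (w u v * (f v)\<^sup>2))"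
    by (simp add: energy_def sum_mono)
  also have "\<dots> = 4 * sqnorm f"
    by (simp add: sum.distrib sum_weight_left sum_weight_right sqnorm_def flip: sum_distrib_left)
  finally show ?thesis by simp
qed

text \<open>Conjugation by the square root of the degree matrix turns the Laplacian into the
  symmetric \<open>S\<close>. Its orthonormal eigenvectors, divided by \<open>s u\<close>, become
  orthonormal for the weights \<open>degree\<close>; the third clause is the eigenvalue equation
  multiplied by \<open>degree u\<close>.\<close>

lemma spectral_basis:
  obtains \<phi> :: "nat \<Rightarrow> nat \<Rightarrow> real" where
    "\<And>i j. i < N \<Longrightarrow> j < N \<Longrightarrow> (\<Sum>u<N. degree u * \<phi> i u * \<phi> j u) = (if i = j then 1 else 0)"
    "\<And>u v. u < N \<Longrightarrow> v < N \<Longrightarrow> (\<Sum>i<N. \<phi> i u * \<phi> i v) * degree v = (if u = v then 1 else 0)"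
    "\<And>i u. i < N \<Longrightarrow> u < N \<Longrightarrow>
       (\<Sum>v<N. sign u v * w u v * \<phi> i v) = (1 - lam (Suc i)) * degree u * \<phi> i u"
    "\<And>i j. i \<le> j \<Longrightarrow> j < N \<Longrightarrow> lam (Suc i) \<le> lam (Suc j)"
proof -
  define s where "s u = sqrt (degree u)" for u
  have s: "s u > 0" "s u * s u = degree u" if "u < N" for u
    using degree_positive[OF that] by (auto simp: s_def)
  define S where "S = mat N N (\<lambda>(u, v). (if u = v then 1 else 0) - sign u v * w u v / (s u * s v))"
  have S: "S \<in> carrier_mat N N" by (simp add: S_def)
  have "transpose_mat S = S"
    by (rule eq_matI) (auto simp: S_def sign_commute w_sym mult.commute)
  then obtain Q D where Q: "Q \<in> carrier_mat N N" and D: "D \<in> carrier_mat N N"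
    and QQ: "transpose_mat Q * Q = 1\<^sub>m N" and dD: "diagonal_mat D"
    and QSQ: "transpose_mat Q * S * Q = D"
    using symmetric_real_diagonalizable[OF S] by blast
  have Qt: "transpose_mat Q \<in> carrier_mat N N" using Q by simp
  have QQ': "Q * transpose_mat Q = 1\<^sub>m N" using mat_mult_left_right_inverse[OF Qt Q QQ] .
  note assoc = assoc_mult_mat[of _ N N _ N _ N]
  have SQD: "S * Q = Q * D"
  proof -
    have "Q * D = (Q * transpose_mat Q) * (S * Q)"
      unfolding QSQ[symmetric] using Q Qt S by (simp add: assoc)
    then show ?thesis using QQ' Q S by simp
  qed
  define L where "L = mat_diag N (\<lambda>u. inverse (s u))"
  define R where "R = mat_diag N s"
  have LR: "L \<in> carrier_mat N N" "R \<in> carrier_mat N N" by (auto simp: L_def R_def)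
  have L_mult: "L * A = mat N N (\<lambda>(i, j). inverse (s i) * A $$ (i, j))" if "A \<in> carrier_mat N N" for A
    unfolding L_def by (rule mat_diag_mult_left[OF that])
  have lap: "signed_laplacian = L * S * R"
  proof (rule eq_matI)
    fix u v assume "u < dim_row (L * S * R)" "v < dim_col (L * S * R)"
    then have uv: "u < N" "v < N" using LR by auto
    have "(L * S * R) $$ (u, v) = inverse (s u) * S $$ (u, v) * s v"
      using uv LR S unfolding R_def L_mult[OF S]
      by (subst mat_diag_mult_right[of _ N N]) auto
    also have "\<dots> = (if u = v then 1 else 0) - sign u v * w u v / degree u"
      using uv s(1)[of u] s(1)[of v] by (auto simp: S_def s(2)[OF uv(1), symmetric] field_simps)
    also have "\<dots> = signed_laplacian $$ (u, v)"
    proof -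
      have "(mat_diag N (\<lambda>u. inverse (degree u)) * signed_adjacency) $$ (u, v)
        = inverse (degree u) * signed_adjacency $$ (u, v)"
        using uv by (subst mat_diag_mult_left[of _ N N]) (auto simp: signed_adjacency_def)
      moreover have "signed_adjacency $$ (u, v) = sign u v * w u v"
        using uv w_zero[of u v] by (auto simp: signed_adjacency_def sign_def)
      moreover have "signed_laplacian $$ (u, v) = 1\<^sub>m N $$ (u, v)
          - (mat_diag N (\<lambda>u. inverse (degree u)) * signed_adjacency) $$ (u, v)"
        unfolding signed_laplacian_def
        by (rule index_minus_mat) (use uv in \<open>auto simp: signed_adjacency_def mat_diag_def\<close>)
      ultimately show ?thesis using uv by (simp add: field_simps)
    qed
    finally show "signed_laplacian $$ (u, v) = (L * S * R) $$ (u, v)" by simp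
  qed (auto simp: signed_laplacian_def signed_adjacency_def L_def R_def mat_diag_def)
  have "L * R = 1\<^sub>m N" "R * L = 1\<^sub>m N"
    unfolding L_def R_def mat_diag_diag using s(1)
    by (auto intro!: eq_matI simp: mat_diag_def less_imp_neq[symmetric])
  then have "similar_mat_wit signed_laplacian S L R"
    using lap LR S unfolding similar_mat_wit_def Let_def
    by (auto simp: signed_laplacian_def signed_adjacency_def mat_diag_def)
  then have "char_poly signed_laplacian = char_poly S"
    by (intro char_poly_similar) (auto simp: similar_mat_def)
  also have "similar_mat_wit D S (transpose_mat Q) Q"
    using Q Qt D S QQ QQ' QSQ unfolding similar_mat_wit_def Let_def by auto
  then have "char_poly S = char_poly D"
    by (intro char_poly_similar[symmetric]) (auto simp: similar_mat_def)
  also have "upper_triangular D" using dD D unfolding diagonal_mat_def upper_triangular_def by auto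
  then have "char_poly D = (\<Prod>a\<leftarrow>diag_mat D. [:- a, 1:])"
    by (rule char_poly_upper_triangular[OF D])
  finally have "proots (char_poly signed_laplacian) = mset (diag_mat D)"
    by (simp add: proots_linear_factors)
  then have lam: "lam k = sort (diag_mat D) ! (k - 1)" for k
    by (simp add: lam_def)
  have len: "length (diag_mat D) = N" using D by (simp add: diag_mat_def)
  \<comment> \<open>The diagonalization comes in no particular order, whereas \<open>lam\<close> is
    read off the sorted list of roots; \<open>p\<close> matches the two.\<close>
  have "mset (sort (diag_mat D)) = mset (diag_mat D)" by simp
  then obtain p where p: "p permutes {..<N}" "permute_list p (diag_mat D) = sort (diag_mat D)"
    using mset_eq_permutation[of "sort (diag_mat D)" "diag_mat D"] len by metis
  have lam_p: "lam (Suc i) = D $$ (p i, p i)" if "i < N" for i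
  proof -
    have "p i < N" using p(1) that permutes_in_image by fastforce
    moreover have "permute_list p (diag_mat D) ! i = diag_mat D ! p i"
      by (rule permute_list_nth) (use p(1) that len in auto)
    ultimately show ?thesis using D by (simp add: lam p(2)) (simp add: diag_mat_def)
  qed
  have pN: "p i < N" if "i < N" for i using p(1) that permutes_in_image by fastforce
  define \<phi> where "\<phi> i u = Q $$ (u, p i) / s u" for i u
  show ?thesis
  proof (rule that[of \<phi>])
    fix i j assume ij: "i < N" "j < N"
    have "(\<Sum>u<N. degree u * \<phi> i u * \<phi> j u) = (\<Sum>u<N. Q $$ (u, p i) * Q $$ (u, p j))"
      by (intro sum.cong refl) (use s(1) in \<open>fastforce simp: \<phi>_def s(2)[symmetric]\<close>)
    also have "\<dots> = (transpose_mat Q * Q) $$ (p i, p j)"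
      using pN[OF ij(1)] pN[OF ij(2)] Q by (simp add: scalar_prod_def lessThan_atLeast0)
    also have "\<dots> = (if i = j then 1 else 0)"
      using pN[OF ij(1)] pN[OF ij(2)] permutes_inj[OF p(1)] by (auto simp: QQ inj_eq)
    finally show "(\<Sum>u<N. degree u * \<phi> i u * \<phi> j u) = (if i = j then 1 else 0)" .
  next
    fix u v assume uv: "u < N" "v < N"
    have "(\<Sum>i<N. \<phi> i u * \<phi> i v) = (\<Sum>i<N. Q $$ (u, p i) * Q $$ (v, p i)) / (s u * s v)"
      by (simp add: \<phi>_def sum_divide_distrib)
    also have "(\<Sum>i<N. Q $$ (u, p i) * Q $$ (v, p i)) = (\<Sum>i<N. Q $$ (u, i) * Q $$ (v, i))"
      using sum.permute[OF p(1), of "\<lambda>i. Q $$ (u, i) * Q $$ (v, i)"] by (simp add: o_def)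
    also have "\<dots> = (Q * transpose_mat Q) $$ (u, v)"
      using uv Q by (simp add: scalar_prod_def lessThan_atLeast0)
    also have "\<dots> = (if u = v then 1 else 0)" using uv by (simp add: QQ')
    finally show "(\<Sum>i<N. \<phi> i u * \<phi> i v) * degree v = (if u = v then 1 else 0)"
      using uv s[of v] by auto
  next
    fix i u assume iu: "i < N" "u < N"
    have "(S * Q) $$ (u, p i) = (\<Sum>v<N. S $$ (u, v) * Q $$ (v, p i))"
      using iu pN S Q by (simp add: scalar_prod_def lessThan_atLeast0)
    also have "\<dots> = (\<Sum>v<N. (if u = v then Q $$ (v, p i) else 0)
        - sign u v * w u v * \<phi> i v / s u)"
      by (intro sum.cong refl) (use iu s in \<open>auto simp: S_def \<phi>_def field_simps\<close>)
    also have "\<dots> = s u * \<phi> i u - (\<Sum>v<N. sign u v * w u v * \<phi> i v) / s u"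
      using iu s[of u] by (simp add: sum_subtractf sum_divide_distrib \<phi>_def)
    finally have 1: "(S * Q) $$ (u, p i) = s u * \<phi> i u - (\<Sum>v<N. sign u v * w u v * \<phi> i v) / s u" .
    have "(Q * D) $$ (u, p i) = (\<Sum>v<N. Q $$ (u, v) * D $$ (v, p i))"
      using iu pN D Q by (simp add: scalar_prod_def lessThan_atLeast0)
    also have "\<dots> = (\<Sum>v<N. if v = p i then Q $$ (u, p i) * lam (Suc i) else 0)"
      by (intro sum.cong refl)
        (use iu pN D dD in \<open>auto simp: lam_p diagonal_mat_def\<close>)
    also have "\<dots> = lam (Suc i) * (s u * \<phi> i u)"
      using pN iu s[of u] by (simp add: \<phi>_def)
    finally have "s u * \<phi> i u - (\<Sum>v<N. sign u v * w u v * \<phi> i v) / s u = lam (Suc i) * (s u * \<phi> i u)"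
      using 1 SQD by simp
    then have "(\<Sum>v<N. sign u v * w u v * \<phi> i v) = (1 - lam (Suc i)) * (s u * s u) * \<phi> i u"
      using iu s(1)[of u] by (simp add: field_simps)
    then show "(\<Sum>v<N. sign u v * w u v * \<phi> i v) = (1 - lam (Suc i)) * degree u * \<phi> i u"
      using iu s by simp
  next
    fix i j assume "i \<le> j" "j < N"
    then show "lam (Suc i) \<le> lam (Suc j)"
      using sorted_nth_mono[of "sort (diag_mat D)" i j] len by (simp add: lam)
  qed
qed

text \<open>Parseval for the inner product weighted by \<open>degree\<close>: completeness expands
  \<open>f\<close> in the basis, and the eigenvalue equation diagonalizes the energy.\<close>

lemma eigenfunctions:
  obtains \<phi> :: "nat \<Rightarrow> nat \<Rightarrow> real" where
    "\<And>i j. i < N \<Longrightarrow> j < N \<Longrightarrow> (\<Sum>u<N. degree u * \<phi> i u * \<phi> j u) = (if i = j then 1 else 0)"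
    "\<And>f. sqnorm f = (\<Sum>i<N. (\<Sum>u<N. degree u * f u * \<phi> i u)\<^sup>2)"
    "\<And>f. energy f = (\<Sum>i<N. lam (Suc i) * (\<Sum>u<N. degree u * f u * \<phi> i u)\<^sup>2)"
    "\<And>i j. i \<le> j \<Longrightarrow> j < N \<Longrightarrow> lam (Suc i) \<le> lam (Suc j)"
proof -
  obtain \<phi> where orth: "\<And>i j. i < N \<Longrightarrow> j < N \<Longrightarrow>
      (\<Sum>u<N. degree u * \<phi> i u * \<phi> j u) = (if i = j then 1 else 0 :: real)"
    and compl: "\<And>u v. u < N \<Longrightarrow> v < N \<Longrightarrow>
      (\<Sum>i<N. \<phi> i u * \<phi> i v) * degree v = (if u = v then 1 else 0)"
    and eig: "\<And>i u. i < N \<Longrightarrow> u < N \<Longrightarrow>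
      (\<Sum>v<N. sign u v * w u v * \<phi> i v) = (1 - lam (Suc i)) * degree u * \<phi> i u"
    and mono: "\<And>i j. i \<le> j \<Longrightarrow> j < N \<Longrightarrow> lam (Suc i) \<le> lam (Suc j)"
    by (rule spectral_basis) (rule that)
  have expand: "f v = (\<Sum>i<N. (\<Sum>u<N. degree u * f u * \<phi> i u) * \<phi> i v)" if v: "v < N" for f v
  proof -
    have "(\<Sum>i<N. (\<Sum>u<N. degree u * f u * \<phi> i u) * \<phi> i v)
        = (\<Sum>i<N. \<Sum>u<N. f u * (\<phi> i v * \<phi> i u * degree u))"
      by (simp add: sum_distrib_left sum_distrib_right mult_ac)
    also have "\<dots> = (\<Sum>u<N. \<Sum>i<N. f u * (\<phi> i v * \<phi> i u * degree u))"
      by (rule sum.swap)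
    also have "\<dots> = (\<Sum>u<N. f u * ((\<Sum>i<N. \<phi> i v * \<phi> i u) * degree u))"
      by (simp add: sum_distrib_left sum_distrib_right)
    also have "\<dots> = (\<Sum>u<N. if v = u then f u else 0)"
      by (intro sum.cong refl) (simp add: compl v)
    finally show ?thesis using v by simp
  qed
  have norm: "sqnorm f = (\<Sum>i<N. (\<Sum>u<N. degree u * f u * \<phi> i u)\<^sup>2)" for f
  proof -
    let ?c = "\<lambda>i. \<Sum>u<N. degree u * f u * \<phi> i u"
    have "sqnorm f = (\<Sum>v<N. degree v * f v * (\<Sum>i<N. ?c i * \<phi> i v))"
      unfolding sqnorm_def
    proof (intro sum.cong refl)
      fix v assume "v \<in> {..<N}"
      then have "f v = (\<Sum>i<N. ?c i * \<phi> i v)" using expand by blast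
      then show "degree v * (f v)\<^sup>2 = degree v * f v * (\<Sum>i<N. ?c i * \<phi> i v)"
        unfolding power2_eq_square mult.assoc by (rule arg_cong)
    qed
    also have "\<dots> = (\<Sum>v<N. \<Sum>i<N. ?c i * (degree v * f v * \<phi> i v))"
      by (simp add: sum_distrib_left mult_ac)
    also have "\<dots> = (\<Sum>i<N. \<Sum>v<N. ?c i * (degree v * f v * \<phi> i v))" by (rule sum.swap)
    also have "\<dots> = (\<Sum>i<N. ?c i * ?c i)" by (simp add: sum_distrib_left)
    finally show ?thesis by (simp add: power2_eq_square)
  qed
  have "energy f = (\<Sum>i<N. lam (Suc i) * (\<Sum>u<N. degree u * f u * \<phi> i u)\<^sup>2)" for f
  proof -
    let ?c = "\<lambda>i. \<Sum>u<N. degree u * f u * \<phi> i u"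
    have "(\<Sum>u<N. \<Sum>v<N. sign u v * w u v * f u * f v)
        = (\<Sum>u<N. f u * (\<Sum>v<N. sign u v * w u v * (\<Sum>i<N. ?c i * \<phi> i v)))"
    proof (intro sum.cong refl)
      fix u
      have "(\<Sum>v<N. sign u v * w u v * f u * f v) = f u * (\<Sum>v<N. sign u v * w u v * f v)"
        by (simp add: sum_distrib_left mult_ac)
      also have "(\<Sum>v<N. sign u v * w u v * f v)
          = (\<Sum>v<N. sign u v * w u v * (\<Sum>i<N. ?c i * \<phi> i v))"
        by (intro sum.cong refl arg_cong[where f = "\<lambda>x. _ * x"]) (use expand in blast)
      finally show "(\<Sum>v<N. sign u v * w u v * f u * f v)
          = f u * (\<Sum>v<N. sign u v * w u v * (\<Sum>i<N. ?c i * \<phi> i v))" .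
    qed
    also have "\<dots> = (\<Sum>u<N. f u * (\<Sum>v<N. \<Sum>i<N. ?c i * (sign u v * w u v * \<phi> i v)))"
      by (simp add: sum_distrib_left mult_ac)
    also have "\<dots> = (\<Sum>u<N. f u * (\<Sum>i<N. \<Sum>v<N. ?c i * (sign u v * w u v * \<phi> i v)))"
    proof (intro sum.cong refl)
      fix u
      show "f u * (\<Sum>v<N. \<Sum>i<N. ?c i * (sign u v * w u v * \<phi> i v))
          = f u * (\<Sum>i<N. \<Sum>v<N. ?c i * (sign u v * w u v * \<phi> i v))"
        by (subst sum.swap) (rule refl)
    qed
    also have "\<dots> = (\<Sum>u<N. f u * (\<Sum>i<N. ?c i * ((1 - lam (Suc i)) * degree u * \<phi> i u)))"
    proof (intro sum.cong refl)
      fix u assume "u \<in> {..<N}"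
      then show "f u * (\<Sum>i<N. \<Sum>v<N. ?c i * (sign u v * w u v * \<phi> i v))
          = f u * (\<Sum>i<N. ?c i * ((1 - lam (Suc i)) * degree u * \<phi> i u))"
        by (simp add: eig flip: sum_distrib_left)
    qed
    also have "\<dots> = (\<Sum>u<N. \<Sum>i<N. ?c i * (1 - lam (Suc i)) * (degree u * f u * \<phi> i u))"
      by (simp add: sum_distrib_left mult_ac)
    also have "\<dots> = (\<Sum>i<N. \<Sum>u<N. ?c i * (1 - lam (Suc i)) * (degree u * f u * \<phi> i u))"
      by (rule sum.swap)
    also have "\<dots> = (\<Sum>i<N. ?c i * (1 - lam (Suc i)) * ?c i)" by (simp add: sum_distrib_left)
    finally show ?thesis
      by (simp add: energy_eq norm power2_eq_square algebra_simps flip: sum_subtractf)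
  qed
  from that[OF orth norm this mono] show ?thesis by blast
qed

lemma energy_eigenfunction:
  assumes "i < N"
    and "\<And>i j. i < N \<Longrightarrow> j < N \<Longrightarrow> (\<Sum>u<N. degree u * \<phi> i u * \<phi> j u) = (if i = j then 1 else 0)"
    and "\<And>f. energy f = (\<Sum>i<N. lam (Suc i) * (\<Sum>u<N. degree u * f u * \<phi> i u)\<^sup>2)"
  shows "energy (\<phi> i) = lam (Suc i)"
proof -
  have "energy (\<phi> i) = (\<Sum>j<N. if j = i then lam (Suc i) else 0)"
    unfolding assms(3) by (intro sum.cong refl) (use assms(1,2) in auto)
  then show ?thesis using assms(1) by simp
qed

text \<open>The eigenvalues are energies of functions of norm 1. The upper bound later absorbs the
  energy into a multiple of energy divided by \<open>sqrt (lam l)\<close>.\<close>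

lemma lam_bounds:
  assumes "1 \<le> l" "l \<le> N"
  shows "0 \<le> lam l" "lam l \<le> 2"
proof -
  obtain \<phi> where \<phi>: "\<And>i j. i < N \<Longrightarrow> j < N \<Longrightarrow>
      (\<Sum>u<N. degree u * \<phi> i u * \<phi> j u) = (if i = j then 1 else 0 :: real)"
    "\<And>f. energy f = (\<Sum>i<N. lam (Suc i) * (\<Sum>u<N. degree u * f u * \<phi> i u)\<^sup>2)"
    by (rule eigenfunctions) (rule that)
  from assms obtain i where i: "l = Suc i" "i < N" by (cases l) auto
  have "energy (\<phi> i) = lam l" using energy_eigenfunction[OF i(2) \<phi>] i by simp
  moreover have "sqnorm (\<phi> i) = 1" using \<phi>(1)[OF i(2) i(2)]
    by (simp add: sqnorm_def power2_eq_square mult.assoc)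
  ultimately show "0 \<le> lam l" "lam l \<le> 2"
    using energy_nonneg[of "\<phi> i"] energy_le_two_sqnorm[of "\<phi> i"] by auto
qed

lemma lam_mono:
  assumes "1 \<le> k" "k \<le> l" "l \<le> N"
  shows "lam k \<le> lam l"
proof -
  obtain \<phi> :: "nat \<Rightarrow> nat \<Rightarrow> real" where
    "\<And>i j. i \<le> j \<Longrightarrow> j < N \<Longrightarrow> lam (Suc i) \<le> lam (Suc j)"
    by (rule spectral_basis) (rule that)
  from this[of "k - 1" "l - 1"] assms show ?thesis by (cases k; cases l) auto
qed

text \<open>Some combination of the \<open>g j\<close> is orthogonal to the first \<open>l - 1\<close> eigenfunctions.\<close>

lemma lam_le_combination:
  assumes "1 \<le> l" "l \<le> N"
  shows "\<exists>a. (\<exists>j<l. a j \<noteq> 0) \<and>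
    lam l * sqnorm (\<lambda>u. \<Sum>j<l. a j * g j u) \<le> energy (\<lambda>u. \<Sum>j<l. a j * g j u)"
proof -
  obtain \<phi> where \<phi>:
    "\<And>f. sqnorm f = (\<Sum>i<N. (\<Sum>u<N. degree u * f u * \<phi> i u)\<^sup>2)"
    "\<And>f. energy f = (\<Sum>i<N. lam (Suc i) * (\<Sum>u<N. degree u * f u * \<phi> i u)\<^sup>2)"
    by (rule eigenfunctions) (rule that)
  obtain n where n: "l = Suc n" using assms(1) by (cases l) auto
  obtain a where a: "\<exists>j\<le>n. a j \<noteq> 0"
    and orth: "\<And>i. i < n \<Longrightarrow> (\<Sum>j\<le>n. (\<Sum>u<N. degree u * g j u * \<phi> i u) * a j) = 0"
    using nontrivial_kernel[of n "\<lambda>i j. \<Sum>u<N. degree u * g j u * \<phi> i u"] by blast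
  define f where "f u = (\<Sum>j<l. a j * g j u)" for u
  have c0: "(\<Sum>u<N. degree u * f u * \<phi> i u) = 0" if "i < n" for i
  proof -
    have "(\<Sum>u<N. degree u * f u * \<phi> i u) = (\<Sum>u<N. \<Sum>j<l. (degree u * g j u * \<phi> i u) * a j)"
      by (simp add: f_def sum_distrib_left sum_distrib_right mult_ac)
    also have "\<dots> = (\<Sum>j<l. \<Sum>u<N. (degree u * g j u * \<phi> i u) * a j)" by (rule sum.swap)
    also have "\<dots> = (\<Sum>j\<le>n. (\<Sum>u<N. degree u * g j u * \<phi> i u) * a j)"
      by (simp add: n lessThan_Suc_atMost sum_distrib_right)
    finally show ?thesis using orth[OF that] by simp
  qed
  have "lam l * sqnorm f \<le> energy f"
    unfolding \<phi>[of f] sum_distrib_left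
  proof (rule sum_mono)
    fix i assume "i \<in> {..<N}"
    then show "lam l * (\<Sum>u<N. degree u * f u * \<phi> i u)\<^sup>2
        \<le> lam (Suc i) * (\<Sum>u<N. degree u * f u * \<phi> i u)\<^sup>2"
      using c0[of i] lam_mono[of l "Suc i"] assms n
      by (cases "i < n") (auto intro!: mult_right_mono)
  qed
  moreover have "\<exists>j<l. a j \<noteq> 0" using a n by (auto simp: less_Suc_eq_le)
  ultimately show ?thesis unfolding f_def by blast
qed

end

section \<open>Threshold profiles and the coarea formula\<close>

lemma cauchy_schwarz_sum:
  fixes x y :: "'a \<Rightarrow> real"
  shows "(\<Sum>i\<in>A. x i * y i)\<^sup>2 \<le> (\<Sum>i\<in>A. (x i)\<^sup>2) * (\<Sum>i\<in>A. (y i)\<^sup>2)"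
proof -
  have "\<bar>\<Sum>i\<in>A. x i * y i\<bar> \<le> (\<Sum>i\<in>A. \<bar>x i\<bar> * \<bar>y i\<bar>)"
    using sum_abs[of "\<lambda>i. x i * y i" A] by (simp add: abs_mult)
  also have "\<dots> \<le> L2_set x A * L2_set y A" by (rule L2_set_mult_ineq)
  finally have "\<bar>\<Sum>i\<in>A. x i * y i\<bar>\<^sup>2 \<le> (L2_set x A * L2_set y A)\<^sup>2"
    by (rule power_mono) simp
  then show ?thesis by (simp add: L2_set_def power_mult_distrib sum_nonneg)
qed

lemma sum_squares_le_square_sum:
  fixes x :: "'a \<Rightarrow> real"
  assumes "\<And>i. i \<in> A \<Longrightarrow> x i \<ge> 0"
  shows "(\<Sum>i\<in>A. (x i)\<^sup>2) \<le> (\<Sum>i\<in>A. x i)\<^sup>2"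
  using assms
proof (induction A rule: infinite_finite_induct)
  case (insert a A)
  have "(\<Sum>i\<in>A. x i) \<ge> 0" using insert.prems by (intro sum_nonneg) auto
  then have "x a * (\<Sum>i\<in>A. x i) \<ge> 0" using insert.prems by auto
  then show ?case using insert by (simp add: power2_sum)
qed auto

lemma square_sum_disjoint:
  fixes x :: "'a \<Rightarrow> real"
  assumes "\<And>i j. i \<in> A \<Longrightarrow> j \<in> A \<Longrightarrow> i \<noteq> j \<Longrightarrow> x i = 0 \<or> x j = 0"
  shows "(\<Sum>i\<in>A. x i)\<^sup>2 = (\<Sum>i\<in>A. (x i)\<^sup>2)"
  using assms
proof (induction A rule: infinite_finite_induct)
  case (insert a A)
  have "x a * (\<Sum>i\<in>A. x i) = (\<Sum>i\<in>A. x a * x i)" by (rule sum_distrib_left)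
  also have "\<dots> = 0" by (rule sum.neutral) (use insert in force)
  finally have "2 * x a * (\<Sum>i\<in>A. x i) = 0" by simp
  then show ?case using insert by (simp add: power2_sum)
qed auto

lemma sum_single_support:
  fixes x :: "nat \<Rightarrow> real"
  assumes "\<And>i j. i < n \<Longrightarrow> j < n \<Longrightarrow> i \<noteq> j \<Longrightarrow> x i = 0 \<or> x j = 0" "n > 0"
  obtains i where "i < n" "\<And>j. j < n \<Longrightarrow> j \<noteq> i \<Longrightarrow> x j = 0"
  using assms by metis

text \<open>At most one \<open>x i\<close> and at most one \<open>y k\<close> are nonzero, so the
  sum has at most two terms and \<open>(a + b)^2 \<le> 2 (a^2 + b^2)\<close> suffices, whatever
  \<open>n\<close> is.\<close>

lemma square_sum_diff_disjoint:
  fixes x y :: "nat \<Rightarrow> real"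
  assumes x: "\<And>i j. i < n \<Longrightarrow> j < n \<Longrightarrow> i \<noteq> j \<Longrightarrow> x i = 0 \<or> x j = 0"
    and y: "\<And>i j. i < n \<Longrightarrow> j < n \<Longrightarrow> i \<noteq> j \<Longrightarrow> y i = 0 \<or> y j = 0"
  shows "(\<Sum>j<n. x j - y j)\<^sup>2 \<le> 2 * (\<Sum>j<n. (x j - y j)\<^sup>2)"
proof (cases "n = 0")
  case False
  obtain i where i: "i < n" "\<And>j. j < n \<Longrightarrow> j \<noteq> i \<Longrightarrow> x j = 0"
    using sum_single_support[of n x] x False by blast
  obtain k where k: "k < n" "\<And>j. j < n \<Longrightarrow> j \<noteq> k \<Longrightarrow> y j = 0"
    using sum_single_support[of n y] y False by blast
  have "(\<Sum>j<n. x j - y j) = (\<Sum>j\<in>{i, k}. x j - y j)"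
    by (rule sum.mono_neutral_right) (use i k in auto)
  moreover have "(\<Sum>j<n. (x j - y j)\<^sup>2) = (\<Sum>j\<in>{i, k}. (x j - y j)\<^sup>2)"
    by (rule sum.mono_neutral_right) (use i k in auto)
  moreover have "(a + b)\<^sup>2 \<le> 2 * (a\<^sup>2 + b\<^sup>2)" for a b :: real
    using zero_le_power2[of "a - b"] by (simp add: power2_eq_square algebra_simps)
  ultimately show ?thesis by (cases "i = k") auto
qed simp

text \<open>For \<open>a \<le> b\<close>, the length of the part of the interval from
  \<open>a\<close> to \<open>b\<close> that lies below \<open>x\<close>. Ramps over consecutive
  intervals telescope.\<close>

definition ramp :: "real \<Rightarrow> real \<Rightarrow> real \<Rightarrow> real" where
  "ramp a b x = min x b - min x a"

text \<open>For \<open>a \<le> b\<close>, the distance from \<open>x\<close> to the complement of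
  the open interval.\<close>

definition tent :: "real \<Rightarrow> real \<Rightarrow> real \<Rightarrow> real" where
  "tent a b x = max 0 (min (x - a) (b - x))"

text \<open>The cubic is a primitive of \<open>6 c (1 - c / L)\<close> (where \<open>L = b - a\<close>), which is at most six times the tent.\<close>

definition smooth_step :: "real \<Rightarrow> real \<Rightarrow> real \<Rightarrow> real" where
  "smooth_step a b x = (ramp a b x)\<^sup>2 * (3 * (b - a) - 2 * ramp a b x) / (b - a)"

lemma ramp_bounds: "a \<le> b \<Longrightarrow> 0 \<le> ramp a b x \<and> ramp a b x \<le> b - a"
  by (auto simp: ramp_def min_def)

lemma ramp_mono: "a \<le> b \<Longrightarrow> x \<le> y \<Longrightarrow> ramp a b x \<le> ramp a b y"
  by (auto simp: ramp_def min_def)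

lemma tent_nonneg: "0 \<le> tent a b x"
  by (simp add: tent_def)

lemma tent_eq: "a \<le> b \<Longrightarrow> tent a b x = min (ramp a b x) (b - a - ramp a b x)"
  by (auto simp: tent_def ramp_def min_def max_def)

lemma tent_le_ramp: "a \<le> b \<Longrightarrow> tent a b x \<le> ramp a b x"
  by (simp add: tent_eq)

text \<open>Measuring by ramps instead of by \<open>x - y\<close> keeps the bound summable: the ramp
  differences over all intervals add up to at most the distance of \<open>x\<close> and
  \<open>y\<close>.\<close>

lemma tent_lipschitz: "a \<le> b \<Longrightarrow> \<bar>tent a b x - tent a b y\<bar> \<le> \<bar>ramp a b x - ramp a b y\<bar>"
  by (auto simp: tent_eq min_def abs_if)

text \<open>With \<open>p c = c (1 - c / L)\<close>, half the sum of the derivatives at both ends is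
  \<open>3 p c + 3 p d\<close>, and the error of the trapezoid rule for the cubic is exactly
  \<open>(c - d)^3 / L\<close>. Then \<open>p\<close> is bounded by the tent, and
  \<open>\<bar>c - d\<bar> \<le> L\<close> bounds the error.\<close>

lemma smooth_step_diff:
  assumes "a \<le> b"
  shows "\<bar>smooth_step a b x - smooth_step a b y\<bar>
    \<le> \<bar>ramp a b x - ramp a b y\<bar> * (3 * tent a b x + 3 * tent a b y + \<bar>ramp a b x - ramp a b y\<bar>)"
proof (cases "a = b")
  case False
  define L where "L = b - a"
  have L: "L > 0" using False assms by (simp add: L_def)
  have tent: "0 \<le> c * (1 - c / L) \<and> c * (1 - c / L) \<le> tent a b z"
    if "c = ramp a b z" for c z
  proof -
    have c: "0 \<le> c" "c \<le> L" using ramp_bounds[OF assms, of z] that by (auto simp: L_def)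
    then have r: "0 \<le> c / L" "c / L \<le> 1" using L by auto
    have "c * (1 - c / L) \<le> c" using c r by (simp add: mult_left_le)
    moreover have "c * (1 - c / L) = (c / L) * (L - c)" using L by (simp add: field_simps)
    then have "c * (1 - c / L) \<le> L - c" using c r mult_right_mono[of "c / L" 1 "L - c"] by simp
    ultimately show ?thesis using c r that by (auto simp: tent_eq[OF assms] L_def)
  qed
  define c d where "c = ramp a b x" and "d = ramp a b y"
  have cd: "0 \<le> c" "c \<le> L" "0 \<le> d" "d \<le> L"
    using ramp_bounds[OF assms] by (auto simp: c_def d_def L_def)
  have "smooth_step a b x - smooth_step a b y
      = (c - d) * (3 * (c * (1 - c / L)) + 3 * (d * (1 - d / L)) + (c - d)\<^sup>2 / L)"
    using L by (simp add: smooth_step_def c_def[symmetric] d_def[symmetric] L_def[symmetric]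
        field_simps power2_eq_square)
  then have "\<bar>smooth_step a b x - smooth_step a b y\<bar>
      = \<bar>c - d\<bar> * \<bar>3 * (c * (1 - c / L)) + 3 * (d * (1 - d / L)) + (c - d)\<^sup>2 / L\<bar>"
    by (simp add: abs_mult)
  also have "\<dots> \<le> \<bar>c - d\<bar> * (3 * tent a b x + 3 * tent a b y + \<bar>c - d\<bar>)"
  proof (rule mult_left_mono)
    have "\<bar>c - d\<bar> * \<bar>c - d\<bar> \<le> \<bar>c - d\<bar> * L" using cd by (intro mult_left_mono) auto
    then have "(c - d)\<^sup>2 / L \<le> \<bar>c - d\<bar>" using L by (simp add: power2_eq_square field_simps)
    moreover have "(c - d)\<^sup>2 / L \<ge> 0" using L by simp
    ultimately show "\<bar>3 * (c * (1 - c / L)) + 3 * (d * (1 - d / L)) + (c - d)\<^sup>2 / L\<bar>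
        \<le> 3 * tent a b x + 3 * tent a b y + \<bar>c - d\<bar>"
      using tent[OF c_def] tent[OF d_def] by linarith
  qed simp
  finally show ?thesis by (simp add: c_def d_def)
qed (simp add: smooth_step_def tent_nonneg)

lemma smooth_step_ge:
  assumes "a \<le> b"
  shows "(ramp a b x)\<^sup>2 \<le> smooth_step a b x"
proof (cases "a = b")
  case False
  then have "b - a > 0" using assms by simp
  moreover have "(ramp a b x)\<^sup>2 * (b - a) \<le> (ramp a b x)\<^sup>2 * (3 * (b - a) - 2 * ramp a b x)"
    using ramp_bounds[OF assms, of x] by (intro mult_left_mono) auto
  ultimately show ?thesis by (simp add: smooth_step_def field_simps)
qed (simp add: smooth_step_def ramp_def)

lemma sgn_mult_diff_le:
  fixes x y :: real
  assumes "sgn x = sgn y"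
  shows "\<bar>sgn x * a - sgn y * b\<bar> \<le> \<bar>a - b\<bar>"
proof -
  have "sgn x * a - sgn y * b = sgn y * (a - b)" by (simp add: assms right_diff_distrib)
  then have "\<bar>sgn x * a - sgn y * b\<bar> = \<bar>sgn y\<bar> * \<bar>a - b\<bar>" by (simp only: abs_mult)
  also have "\<dots> \<le> 1 * \<bar>a - b\<bar>" by (rule mult_right_mono) (auto simp: sgn_if)
  finally show ?thesis by simp
qed

locale thresholds =
  fixes s :: "nat \<Rightarrow> real" and m :: nat
  assumes s_mono: "mono s" and s_0: "s 0 = 0"
begin

lemma s_Suc: "s j \<le> s (Suc j)"
  using s_mono by (simp add: monoD)

lemma s_nonneg: "0 \<le> s j"
  using monoD[OF s_mono, of 0 j] s_0 by simp

lemma sum_ramp: "x \<ge> 0 \<Longrightarrow> (\<Sum>j<m. ramp (s j) (s (Suc j)) x) = min x (s m)"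
  using sum_lessThan_telescope[of "\<lambda>j. min x (s j)" m] by (simp add: ramp_def s_0)

text \<open>All ramps are monotone, so for ordered arguments the absolute values drop and the sum
  telescopes.\<close>

lemma sum_ramp_diff:
  assumes "x \<ge> 0" "y \<ge> 0"
  shows "(\<Sum>j<m. \<bar>ramp (s j) (s (Suc j)) x - ramp (s j) (s (Suc j)) y\<bar>) \<le> \<bar>x - y\<bar>"
  using assms
proof (induction x y rule: linorder_wlog)
  case (le x y)
  then have "(\<Sum>j<m. \<bar>ramp (s j) (s (Suc j)) x - ramp (s j) (s (Suc j)) y\<bar>)
      = (\<Sum>j<m. ramp (s j) (s (Suc j)) y - ramp (s j) (s (Suc j)) x)"
    by (intro sum.cong refl) (use ramp_mono[OF s_Suc] in force)
  then show ?case using le by (simp add: sum_subtractf sum_ramp min_def)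
qed (simp add: abs_minus_commute)

lemma tent_disjoint:
  assumes "i \<noteq> j"
  shows "tent (s i) (s (Suc i)) x = 0 \<or> tent (s j) (s (Suc j)) x = 0"
proof (cases "i < j")
  case True
  then have "s (Suc i) \<le> s j" using s_mono by (simp add: monoD)
  then show ?thesis by (auto simp: tent_def min_def max_def)
next
  case False
  then have "s (Suc j) \<le> s i" using assms s_mono by (simp add: monoD)
  then show ?thesis by (auto simp: tent_def min_def max_def)
qed

text \<open>For equal signs, ramp differences bound the tent differences, and a sum of squares is at
  most the square of the sum. For different signs, tents are bounded by ramps and
  \<open>\<bar>x\<bar> + \<bar>y\<bar> = \<bar>x - y\<bar>\<close>. Consequently the tent pieces of
  one function have total energy at most that of the function, with no factor for their
  number.\<close>

lemma sum_tent_odd: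
  "(\<Sum>j<m. (sgn x * tent (s j) (s (Suc j)) \<bar>x\<bar> - sgn y * tent (s j) (s (Suc j)) \<bar>y\<bar>)\<^sup>2) \<le> (x - y)\<^sup>2"
proof (cases "sgn x = sgn y")
  case True
  have "(\<Sum>j<m. (sgn x * tent (s j) (s (Suc j)) \<bar>x\<bar> - sgn y * tent (s j) (s (Suc j)) \<bar>y\<bar>)\<^sup>2)
      \<le> (\<Sum>j<m. \<bar>ramp (s j) (s (Suc j)) \<bar>x\<bar> - ramp (s j) (s (Suc j)) \<bar>y\<bar>\<bar>\<^sup>2)"
  proof (rule sum_mono)
    fix j
    have "\<bar>sgn x * tent (s j) (s (Suc j)) \<bar>x\<bar> - sgn y * tent (s j) (s (Suc j)) \<bar>y\<bar>\<bar>
        \<le> \<bar>tent (s j) (s (Suc j)) \<bar>x\<bar> - tent (s j) (s (Suc j)) \<bar>y\<bar>\<bar>"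
      by (rule sgn_mult_diff_le[OF True])
    also have "\<dots> \<le> \<bar>ramp (s j) (s (Suc j)) \<bar>x\<bar> - ramp (s j) (s (Suc j)) \<bar>y\<bar>\<bar>"
      by (rule tent_lipschitz[OF s_Suc])
    finally show "(sgn x * tent (s j) (s (Suc j)) \<bar>x\<bar> - sgn y * tent (s j) (s (Suc j)) \<bar>y\<bar>)\<^sup>2
        \<le> \<bar>ramp (s j) (s (Suc j)) \<bar>x\<bar> - ramp (s j) (s (Suc j)) \<bar>y\<bar>\<bar>\<^sup>2"
      by (simp add: abs_le_square_iff[symmetric])
  qed
  also have "\<dots> \<le> (\<Sum>j<m. \<bar>ramp (s j) (s (Suc j)) \<bar>x\<bar> - ramp (s j) (s (Suc j)) \<bar>y\<bar>\<bar>)\<^sup>2"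
    by (rule sum_squares_le_square_sum) simp
  also have "\<dots> \<le> \<bar>\<bar>x\<bar> - \<bar>y\<bar>\<bar>\<^sup>2"
    by (intro power_mono sum_ramp_diff sum_nonneg) auto
  also have "\<bar>\<bar>x\<bar> - \<bar>y\<bar>\<bar>\<^sup>2 \<le> (x - y)\<^sup>2" by (simp add: abs_le_square_iff[symmetric])
  finally show ?thesis .
next
  case False
  have "(\<Sum>j<m. (sgn x * tent (s j) (s (Suc j)) \<bar>x\<bar> - sgn y * tent (s j) (s (Suc j)) \<bar>y\<bar>)\<^sup>2)
      \<le> (\<Sum>j<m. (ramp (s j) (s (Suc j)) \<bar>x\<bar> + ramp (s j) (s (Suc j)) \<bar>y\<bar>)\<^sup>2)"
  proof (rule sum_mono)
    fix j
    have "\<bar>sgn x * tent (s j) (s (Suc j)) \<bar>x\<bar> - sgn y * tent (s j) (s (Suc j)) \<bar>y\<bar>\<bar>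
        \<le> tent (s j) (s (Suc j)) \<bar>x\<bar> + tent (s j) (s (Suc j)) \<bar>y\<bar>"
      using tent_nonneg[of "s j" "s (Suc j)" "\<bar>x\<bar>"] tent_nonneg[of "s j" "s (Suc j)" "\<bar>y\<bar>"]
      by (auto simp: sgn_if abs_if)
    also have "\<dots> \<le> ramp (s j) (s (Suc j)) \<bar>x\<bar> + ramp (s j) (s (Suc j)) \<bar>y\<bar>"
      by (intro add_mono tent_le_ramp s_Suc)
    finally have le: "\<bar>sgn x * tent (s j) (s (Suc j)) \<bar>x\<bar> - sgn y * tent (s j) (s (Suc j)) \<bar>y\<bar>\<bar>
        \<le> ramp (s j) (s (Suc j)) \<bar>x\<bar> + ramp (s j) (s (Suc j)) \<bar>y\<bar>" .
    show "(sgn x * tent (s j) (s (Suc j)) \<bar>x\<bar> - sgn y * tent (s j) (s (Suc j)) \<bar>y\<bar>)\<^sup>2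
        \<le> (ramp (s j) (s (Suc j)) \<bar>x\<bar> + ramp (s j) (s (Suc j)) \<bar>y\<bar>)\<^sup>2"
      using power_mono[OF le abs_ge_zero, of 2] by simp
  qed
  also have "\<dots> \<le> (\<Sum>j<m. ramp (s j) (s (Suc j)) \<bar>x\<bar> + ramp (s j) (s (Suc j)) \<bar>y\<bar>)\<^sup>2"
    by (rule sum_squares_le_square_sum) (use ramp_bounds[OF s_Suc] in \<open>simp add: add_nonneg_nonneg\<close>)
  also have "\<dots> = (min \<bar>x\<bar> (s m) + min \<bar>y\<bar> (s m))\<^sup>2"
    by (simp add: sum.distrib sum_ramp)
  also have "\<dots> \<le> (\<bar>x\<bar> + \<bar>y\<bar>)\<^sup>2"
    by (intro power_mono) (use s_nonneg[of m] in auto)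
  also have "\<bar>x\<bar> + \<bar>y\<bar> = \<bar>x - y\<bar>" using False by (auto simp: sgn_if split: if_splits)
  finally show ?thesis by simp
qed

definition profile :: "real \<Rightarrow> real" where
  "profile x = (\<Sum>j<m. smooth_step (s j) (s (Suc j)) x)"

text \<open>On the range from 0 to \<open>s m\<close> this is the distance to the nearest threshold,
  since at most one tent is nonzero.\<close>

definition gap :: "real \<Rightarrow> real" where
  "gap x = (\<Sum>j<m. tent (s j) (s (Suc j)) x)"

lemma gap_nonneg: "0 \<le> gap x"
  unfolding gap_def by (intro sum_nonneg tent_nonneg)

lemma gap_square: "(gap x)\<^sup>2 = (\<Sum>j<m. (tent (s j) (s (Suc j)) x)\<^sup>2)"
  unfolding gap_def by (rule square_sum_disjoint) (use tent_disjoint in blast)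

lemma profile_gap_0: "profile 0 = 0" "gap 0 = 0"
proof -
  have "ramp (s j) (s (Suc j)) 0 = 0" "tent (s j) (s (Suc j)) 0 = 0" for j
    using s_nonneg[of j] s_nonneg[of "Suc j"] by (auto simp: ramp_def tent_def)
  then show "profile 0 = 0" "gap 0 = 0" by (simp_all add: profile_def gap_def smooth_step_def)
qed

lemma profile_diff:
  assumes "x \<ge> 0" "y \<ge> 0"
  shows "\<bar>profile x - profile y\<bar> \<le> \<bar>x - y\<bar> * (3 * gap x + 3 * gap y + \<bar>x - y\<bar>)"
proof -
  let ?r = "\<lambda>j. \<bar>ramp (s j) (s (Suc j)) x - ramp (s j) (s (Suc j)) y\<bar>"
  have r: "(\<Sum>j<m. ?r j) \<le> \<bar>x - y\<bar>" using sum_ramp_diff[OF assms] .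
  have "\<bar>profile x - profile y\<bar> \<le> (\<Sum>j<m. \<bar>smooth_step (s j) (s (Suc j)) x - smooth_step (s j) (s (Suc j)) y\<bar>)"
    unfolding profile_def by (simp add: sum_subtractf[symmetric])
  also have "\<dots> \<le> (\<Sum>j<m. ?r j * (3 * gap x + 3 * gap y + \<bar>x - y\<bar>))"
  proof (rule sum_mono)
    fix j assume j: "j \<in> {..<m}"
    have "?r j \<le> (\<Sum>j<m. ?r j)" by (rule member_le_sum[OF j]) auto
    moreover have "tent (s j) (s (Suc j)) z \<le> gap z" for z
      unfolding gap_def by (rule member_le_sum[OF j]) (auto simp: tent_nonneg)
    ultimately have "?r j * (3 * tent (s j) (s (Suc j)) x + 3 * tent (s j) (s (Suc j)) y + ?r j)
      \<le> ?r j * (3 * gap x + 3 * gap y + \<bar>x - y\<bar>)"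
      using r by (intro mult_left_mono add_mono) auto
    with smooth_step_diff[OF s_Suc, of j x y]
    show "\<bar>smooth_step (s j) (s (Suc j)) x - smooth_step (s j) (s (Suc j)) y\<bar>
        \<le> ?r j * (3 * gap x + 3 * gap y + \<bar>x - y\<bar>)" by linarith
  qed
  also have "\<dots> = (\<Sum>j<m. ?r j) * (3 * gap x + 3 * gap y + \<bar>x - y\<bar>)"
    by (simp add: sum_distrib_right)
  also have "\<dots> \<le> \<bar>x - y\<bar> * (3 * gap x + 3 * gap y + \<bar>x - y\<bar>)"
    using r gap_nonneg by (intro mult_right_mono) (auto intro!: add_nonneg_nonneg)
  finally show ?thesis .
qed

lemma profile_nonneg: "0 \<le> profile x"
  unfolding profile_def
  by (intro sum_nonneg) (use smooth_step_ge[OF s_Suc] zero_le_power2 order_trans in blast)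

text \<open>On this range \<open>x\<close> is the sum of its \<open>m\<close> ramps, and
  Cauchy-Schwarz costs the factor \<open>m\<close>. This is the source of the factor
  \<open>l\<close> in the final bound.\<close>

lemma profile_ge:
  assumes "0 \<le> x" "x \<le> s m" "m > 0"
  shows "x\<^sup>2 \<le> m * profile x"
proof -
  have "x\<^sup>2 = (\<Sum>j<m. ramp (s j) (s (Suc j)) x)\<^sup>2" using assms by (simp add: sum_ramp min_def)
  also have "\<dots> \<le> m * (\<Sum>j<m. (ramp (s j) (s (Suc j)) x)\<^sup>2)"
    using cauchy_schwarz_sum[of "\<lambda>j. ramp (s j) (s (Suc j)) x" "\<lambda>j. 1" "{..<m}"]
    by (simp add: mult.commute)
  also have "\<dots> \<le> m * profile x"
    unfolding profile_def by (intro mult_left_mono sum_mono smooth_step_ge s_Suc) auto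
  finally show ?thesis .
qed

text \<open>The odd extension is what signed edges call for: it commutes with multiplication by -1.
  Across the origin, each side is compared with 0, where \<open>profile\<close> and
  \<open>gap\<close> vanish.\<close>

lemma profile_odd:
  "\<bar>sgn x * profile \<bar>x\<bar> - sgn y * profile \<bar>y\<bar>\<bar> \<le> \<bar>x - y\<bar> * (3 * gap \<bar>x\<bar> + 3 * gap \<bar>y\<bar> + \<bar>x - y\<bar>)"
proof (cases "sgn x = sgn y")
  case True
  then have "\<bar>\<bar>x\<bar> - \<bar>y\<bar>\<bar> = \<bar>x - y\<bar>" by (auto simp: sgn_if split: if_splits)
  moreover have "\<bar>sgn x * profile \<bar>x\<bar> - sgn y * profile \<bar>y\<bar>\<bar> \<le> \<bar>profile \<bar>x\<bar> - profile \<bar>y\<bar>\<bar>"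
    by (rule sgn_mult_diff_le[OF True])
  ultimately show ?thesis using profile_diff[of "\<bar>x\<bar>" "\<bar>y\<bar>"] by auto
next
  case False
  then have xy: "\<bar>x - y\<bar> = \<bar>x\<bar> + \<bar>y\<bar>" by (auto simp: sgn_if split: if_splits)
  have P: "profile \<bar>z\<bar> \<le> \<bar>z\<bar> * (3 * gap \<bar>z\<bar> + \<bar>z\<bar>)" for z
    using profile_diff[of "\<bar>z\<bar>" 0] profile_nonneg[of "\<bar>z\<bar>"] by (simp add: profile_gap_0)
  have "\<bar>sgn x * profile \<bar>x\<bar> - sgn y * profile \<bar>y\<bar>\<bar> \<le> profile \<bar>x\<bar> + profile \<bar>y\<bar>"
    using profile_nonneg[of "\<bar>x\<bar>"] profile_nonneg[of "\<bar>y\<bar>"] by (auto simp: sgn_if abs_if)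
  also have "\<dots> \<le> \<bar>x\<bar> * (3 * gap \<bar>x\<bar> + \<bar>x\<bar>) + \<bar>y\<bar> * (3 * gap \<bar>y\<bar> + \<bar>y\<bar>)"
    by (intro add_mono P)
  also have "\<dots> \<le> \<bar>x\<bar> * (3 * gap \<bar>x\<bar> + 3 * gap \<bar>y\<bar> + (\<bar>x\<bar> + \<bar>y\<bar>))
      + \<bar>y\<bar> * (3 * gap \<bar>x\<bar> + 3 * gap \<bar>y\<bar> + (\<bar>x\<bar> + \<bar>y\<bar>))"
    by (intro add_mono mult_left_mono) (use gap_nonneg in auto)
  also have "\<dots> = \<bar>x - y\<bar> * (3 * gap \<bar>x\<bar> + 3 * gap \<bar>y\<bar> + \<bar>x - y\<bar>)"
    unfolding xy by (simp add: algebra_simps)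
  finally show ?thesis .
qed

end

section \<open>Level sets, coarea and the sweep\<close>

definition level :: "real \<Rightarrow> real \<Rightarrow> real" where
  "level t x = (if x \<ge> t then 1 else if x \<le> - t then - 1 else 0)"

text \<open>Removing the lowest layer, of height \<open>t\<close>, shifts the remaining levels by
  \<open>t\<close>, so every level of the peeled function is a level of the original one.\<close>

lemma level_peel:
  assumes "t > 0" "x = 0 \<or> \<bar>x\<bar> \<ge> t"
  shows "\<bar>x - t * level t x\<bar> = \<bar>x\<bar> - t * \<bar>level t x\<bar>"
    and "r > 0 \<Longrightarrow> level r (x - t * level t x) = level (r + t) x"
  using assms by (auto simp: level_def abs_if)

text \<open>No value lies strictly between 0 and \<open>t\<close> in modulus, so peeling either
  moves a value a full step towards 0 or leaves it at 0. It never reverses the order of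
  \<open>x\<close> and \<open>e * y\<close>, hence distances split without cancellation.\<close>

lemma level_peel_diff:
  assumes "t > 0" "x = 0 \<or> \<bar>x\<bar> \<ge> t" "y = 0 \<or> \<bar>y\<bar> \<ge> t" "e = 1 \<or> e = - 1"
  shows "\<bar>x - e * y\<bar> = \<bar>(x - t * level t x) - e * (y - t * level t y)\<bar> + t * \<bar>level t x - e * level t y\<bar>"
proof -
  have *: "z = 0 \<and> level t z = 0 \<or> z \<ge> t \<and> level t z = 1 \<or> z \<le> - t \<and> level t z = - 1"
    if "z = 0 \<or> \<bar>z\<bar> \<ge> t" for z
    using that assms(1) by (auto simp: level_def)
  show ?thesis using *[OF assms(2)] *[OF assms(3)] assms(1,4)
    by (elim disjE conjE; simp)
qed

context signed_graph
begin

definition variation :: "(nat \<Rightarrow> real) \<Rightarrow> real" where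
  "variation h = (\<Sum>u<N. \<Sum>v<N. w u v * \<bar>h u - sign u v * h v\<bar>) / 2"

definition mass :: "(nat \<Rightarrow> real) \<Rightarrow> real" where
  "mass h = (\<Sum>u<N. degree u * \<bar>h u\<bar>)"

lemma variation_nonneg: "variation h \<ge> 0"
  by (auto simp: variation_def intro!: sum_nonneg mult_nonneg_nonneg weight_nonneg)

text \<open>For the function with values 1, -1, 0, an edge inside the union that contradicts its
  sign contributes 2 and a boundary edge contributes 1. Summing over ordered pairs and halving gives
  exactly the numerator of the ratio.\<close>

lemma ratio_eq:
  assumes "A \<subseteq> {..<N}" "B \<subseteq> {..<N}" "A \<inter> B = {}"
    and z: "\<And>u. z u = (if u \<in> A then 1 else if u \<in> B then - 1 else 0)"
  shows "signed_bipartiteness_ratio degree A B = variation z / mass z"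
proof -
  define I where "I X Y s u v = (if u \<in> X \<and> v \<in> Y \<and> sign u v = s then w u v else 0)" for X Y s u v
  define J where "J X Y u v = (if u \<in> X \<and> v \<in> Y then w u v else 0)" for X Y u v
  have sew: "signed_edge_weight s X Y = (\<Sum>u<N. \<Sum>v<N. I X Y s u v)"
    if "X \<subseteq> {..<N}" "Y \<subseteq> {..<N}" for X Y s
  proof -
    have "signed_edge_weight s X Y = (\<Sum>u\<in>X. \<Sum>v<N. I X Y s u v)"
      unfolding signed_edge_weight_def
    proof (rule sum.cong[OF refl])
      fix u assume "u \<in> X"
      then show "(\<Sum>v\<in>{v \<in> Y. {u, v} \<in> E \<and> \<sigma> {u, v} = s}. w u v) = (\<Sum>v<N. I X Y s u v)"
        by (intro sum.mono_neutral_cong_left)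
          (use that w_zero[of u] in \<open>auto simp: I_def sign_def\<close>)
    qed
    also have "\<dots> = (\<Sum>u<N. \<Sum>v<N. I X Y s u v)"
      by (intro sum.mono_neutral_left) (use that in \<open>auto simp: I_def\<close>)
    finally show ?thesis .
  qed
  have ew: "edge_weight X Y = (\<Sum>u<N. \<Sum>v<N. J X Y u v)"
    if "X \<subseteq> {..<N}" "Y \<subseteq> {..<N}" for X Y
  proof -
    have "edge_weight X Y = (\<Sum>u\<in>X. \<Sum>v<N. J X Y u v)"
      unfolding edge_weight_def
    proof (rule sum.cong[OF refl])
      fix u assume "u \<in> X"
      then show "(\<Sum>v\<in>Y. w u v) = (\<Sum>v<N. J X Y u v)"
        by (intro sum.mono_neutral_cong_left) (use that in \<open>auto simp: J_def\<close>)
    qed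
    also have "\<dots> = (\<Sum>u<N. \<Sum>v<N. J X Y u v)"
      by (intro sum.mono_neutral_left) (use that in \<open>auto simp: J_def\<close>)
    finally show ?thesis .
  qed
  have I_swap: "(\<Sum>u<N. \<Sum>v<N. I X Y s u v) = (\<Sum>u<N. \<Sum>v<N. I Y X s u v)" for X Y s
  proof -
    have "I X Y s u v = I Y X s v u" for u v
      using w_sym[of u v] sign_commute[of u v] by (auto simp: I_def)
    then show ?thesis by (subst sum.swap) simp
  qed
  have J_swap: "(\<Sum>u<N. \<Sum>v<N. J X Y u v) = (\<Sum>u<N. \<Sum>v<N. J Y X u v)" for X Y
  proof -
    have "J X Y u v = J Y X v u" for u v using w_sym[of u v] by (auto simp: J_def)
    then show ?thesis by (subst sum.swap) simp
  qed
  let ?C = "{..<N} - (A \<union> B)"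
  have pointwise: "w u v * \<bar>z u - sign u v * z v\<bar> = 2 * I A B 1 u v + 2 * I B A 1 u v
      + 2 * I A A (-1) u v + 2 * I B B (-1) u v + J (A \<union> B) ?C u v + J ?C (A \<union> B) u v"
    if "u < N" "v < N" for u v
    using sign_cases[of u v]
  proof
    assume s: "sign u v = 1"
    show ?thesis using that assms(3) unfolding z s I_def J_def
      by (cases "u \<in> A"; cases "u \<in> B"; cases "v \<in> A"; cases "v \<in> B") auto
  next
    assume s: "sign u v = - 1"
    show ?thesis using that assms(3) unfolding z s I_def J_def
      by (cases "u \<in> A"; cases "u \<in> B"; cases "v \<in> A"; cases "v \<in> B") auto
  qed
  have "2 * variation z = (\<Sum>u<N. \<Sum>v<N. 2 * I A B 1 u v + 2 * I B A 1 u v + 2 * I A A (-1) u v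
      + 2 * I B B (-1) u v + J (A \<union> B) ?C u v + J ?C (A \<union> B) u v)"
    unfolding variation_def times_divide_eq_right
    using pointwise by simp
  also have "\<dots> = 2 * (\<Sum>u<N. \<Sum>v<N. I A B 1 u v) + 2 * (\<Sum>u<N. \<Sum>v<N. I B A 1 u v)
      + 2 * (\<Sum>u<N. \<Sum>v<N. I A A (-1) u v) + 2 * (\<Sum>u<N. \<Sum>v<N. I B B (-1) u v)
      + (\<Sum>u<N. \<Sum>v<N. J (A \<union> B) ?C u v) + (\<Sum>u<N. \<Sum>v<N. J ?C (A \<union> B) u v)"
    by (simp add: sum.distrib sum_distrib_left)
  also have "\<dots> = 2 * (2 * signed_edge_weight 1 A B + signed_edge_weight (-1) A A
      + signed_edge_weight (-1) B B + edge_weight (A \<union> B) ?C)"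
    using assms(1,2) by (simp add: sew ew I_swap[of B A] J_swap[of ?C])
  finally have "variation z = 2 * signed_edge_weight 1 A B + signed_edge_weight (-1) A A
      + signed_edge_weight (-1) B B + edge_weight (A \<union> B) ?C" by simp
  moreover have "mass z = vol degree (A \<union> B)"
    unfolding mass_def vol_def
    by (rule sum.mono_neutral_cong_right) (use assms in auto)
  ultimately show ?thesis by (simp add: signed_bipartiteness_ratio_def)
qed

text \<open>Both functionals are sums over layers, so a strict inequality on every layer passes to
  \<open>h\<close>. The induction removes the lowest layer; the weak inequality is carried along
  because the peeled function may be zero.\<close>

lemma coarea:
  assumes "\<And>t. t > 0 \<Longrightarrow> \<exists>u<N. level t (h u) \<noteq> 0 \<Longrightarrow>
    \<beta> * mass (\<lambda>u. level t (h u)) < variation (\<lambda>u. level t (h u))"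
  shows "\<beta> * mass h \<le> variation h \<and> ((\<exists>u<N. h u \<noteq> 0) \<longrightarrow> \<beta> * mass h < variation h)"
  using assms
proof (induction "card {u. u < N \<and> h u \<noteq> 0}" arbitrary: h rule: less_induct)
  case less
  show ?case
  proof (cases "\<exists>u<N. h u \<noteq> 0")
    case False
    then have "mass h = 0" by (simp add: mass_def)
    then show ?thesis using variation_nonneg False by auto
  next
    case True
    \<comment> \<open>The smallest nonzero modulus: subtracting this layer kills at least the vertex
      \<open>u0\<close> and creates no new support.\<close>
    define t where "t = Min ((\<lambda>u. \<bar>h u\<bar>) ` {u. u < N \<and> h u \<noteq> 0})"
    have "t \<in> (\<lambda>u. \<bar>h u\<bar>) ` {u. u < N \<and> h u \<noteq> 0}"
      unfolding t_def by (rule Min_in) (use True in auto)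
    then obtain u0 where u0: "u0 < N" "h u0 \<noteq> 0" "t = \<bar>h u0\<bar>" by auto
    have t: "t > 0" using u0 by simp
    have ht: "h u = 0 \<or> \<bar>h u\<bar> \<ge> t" if "u < N" for u
      using that unfolding t_def by (auto intro!: Min_le)
    define h' where "h' u = h u - t * level t (h u)" for u
    have h'0: "h u = 0 \<Longrightarrow> h' u = 0" for u using t by (simp add: h'_def level_def)
    moreover have "h' u0 = 0" using t u0 by (auto simp: h'_def level_def abs_if)
    ultimately have "{u. u < N \<and> h' u \<noteq> 0} \<subset> {u. u < N \<and> h u \<noteq> 0}" using u0 by auto
    then have card: "card {u. u < N \<and> h' u \<noteq> 0} < card {u. u < N \<and> h u \<noteq> 0}"
      by (intro psubset_card_mono) auto
    have mass_cong: "mass f = mass g" and var_cong: "variation f = variation g"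
      if "\<And>u. u < N \<Longrightarrow> f u = g u" for f g
      using that by (simp_all add: mass_def variation_def)
    have lev: "level r (h' u) = level (r + t) (h u)" if "r > 0" "u < N" for r u
      using level_peel(2)[OF t ht[OF that(2)] that(1)] by (simp add: h'_def)
    have "\<beta> * mass (\<lambda>u. level r (h' u)) < variation (\<lambda>u. level r (h' u))"
      if "r > 0" "\<exists>u<N. level r (h' u) \<noteq> 0" for r
    proof -
      have "\<beta> * mass (\<lambda>u. level (r + t) (h u)) < variation (\<lambda>u. level (r + t) (h u))"
        by (rule less.prems) (use t that lev in auto)
      then show ?thesis
        using mass_cong[of "\<lambda>u. level r (h' u)" "\<lambda>u. level (r + t) (h u)"]
          var_cong[of "\<lambda>u. level r (h' u)" "\<lambda>u. level (r + t) (h u)"] lev[OF that(1)] by simp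
    qed
    then have IH: "\<beta> * mass h' \<le> variation h'" using less.hyps[OF card] by blast
    have "\<beta> * mass (\<lambda>u. level t (h u)) < variation (\<lambda>u. level t (h u))"
      by (rule less.prems[OF t]) (use u0 in \<open>auto simp: level_def intro!: exI[of _ u0]\<close>)
    then have "t * (\<beta> * mass (\<lambda>u. level t (h u))) < t * variation (\<lambda>u. level t (h u))"
      using t by simp
    moreover have "mass h = mass h' + t * mass (\<lambda>u. level t (h u))"
    proof -
      have "degree u * \<bar>h u\<bar> = degree u * \<bar>h' u\<bar> + t * (degree u * \<bar>level t (h u)\<bar>)" if "u < N" for u
      proof -
        have "\<bar>h u\<bar> = \<bar>h' u\<bar> + t * \<bar>level t (h u)\<bar>"
          using level_peel(1)[OF t ht[OF that]] by (simp add: h'_def)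
        then show ?thesis by (metis distrib_left mult.left_commute)
      qed
      then show ?thesis by (simp add: mass_def sum.distrib sum_distrib_left)
    qed
    moreover have "variation h = variation h' + t * variation (\<lambda>u. level t (h u))"
    proof -
      have "w u v * \<bar>h u - sign u v * h v\<bar> = w u v * \<bar>h' u - sign u v * h' v\<bar>
          + t * (w u v * \<bar>level t (h u) - sign u v * level t (h v)\<bar>)" if "u < N" "v < N" for u v
      proof -
        have "\<bar>h u - sign u v * h v\<bar> = \<bar>h' u - sign u v * h' v\<bar>
            + t * \<bar>level t (h u) - sign u v * level t (h v)\<bar>"
          unfolding h'_def by (rule level_peel_diff[OF t ht[OF that(1)] ht[OF that(2)] sign_cases])
        then show ?thesis by (metis distrib_left mult.left_commute)
      qed
      then show ?thesis
        by (simp add: variation_def sum.distrib sum_distrib_left add_divide_distrib)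
    qed
    ultimately have "\<beta> * mass h < variation h" using IH by (simp add: algebra_simps)
    then show ?thesis by simp
  qed
qed

text \<open>Contrapositive of \<open>coarea\<close> with \<open>\<beta>\<close> the ratio of
  \<open>h\<close> itself: if every level did strictly worse, \<open>h\<close> would be strictly
  worse than itself.\<close>

lemma sweep:
  assumes "u < N" "h u \<noteq> 0"
  obtains A B where "sub_bipartition A B" "A \<union> B \<subseteq> {u. u < N \<and> h u \<noteq> 0}"
    "signed_bipartiteness_ratio degree A B \<le> variation h / mass h"
proof -
  have "degree u * \<bar>h u\<bar> \<le> mass h" unfolding mass_def
    by (rule member_le_sum) (use assms degree_positive in \<open>auto intro!: mult_nonneg_nonneg intro: less_imp_le\<close>)
  then have mass: "mass h > 0" using assms degree_positive[OF assms(1)]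
    by (smt (verit) mult_pos_pos zero_less_abs_iff)
  have "\<not> variation h / mass h * mass h < variation h" using mass by simp
  then obtain t where t: "t > 0" "\<exists>u<N. level t (h u) \<noteq> 0"
    "variation (\<lambda>u. level t (h u)) \<le> variation h / mass h * mass (\<lambda>u. level t (h u))"
    using coarea[of h "variation h / mass h"] assms not_less by blast
  define A B where "A = {u. u < N \<and> h u \<ge> t}" and "B = {u. u < N \<and> h u \<le> - t}"
  define z where "z u = (if u \<in> A then 1 else if u \<in> B then - 1 else 0 :: real)" for u
  have z: "z u = level t (h u)" if "u < N" for u using that by (auto simp: z_def A_def B_def level_def)
  have AB: "A \<subseteq> {..<N}" "B \<subseteq> {..<N}" "A \<inter> B = {}" using t(1) by (auto simp: A_def B_def)
  obtain x where x: "x < N" "level t (h x) \<noteq> 0" using t(2) by blast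
  then have xAB: "x \<in> A \<union> B" by (auto simp: A_def B_def level_def split: if_splits)
  have "degree x * \<bar>z x\<bar> \<le> mass z" unfolding mass_def
    by (rule member_le_sum) (use x degree_positive in \<open>auto intro!: mult_nonneg_nonneg intro: less_imp_le\<close>)
  then have mz: "mass z > 0" using z x degree_positive[OF x(1)]
    by (smt (verit) mult_pos_pos zero_less_abs_iff)
  have "variation z = variation (\<lambda>u. level t (h u))" "mass z = mass (\<lambda>u. level t (h u))"
    using z by (simp_all add: variation_def mass_def)
  then have "signed_bipartiteness_ratio degree A B \<le> variation h / mass h"
    using ratio_eq[OF AB z_def] mz t(3) by (simp add: pos_divide_le_eq)
  moreover have "sub_bipartition A B" using AB xAB by (auto simp: sub_bipartition_def)
  moreover have "A \<union> B \<subseteq> {u. u < N \<and> h u \<noteq> 0}" using t(1) by (auto simp: A_def B_def)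
  ultimately show ?thesis using that by blast
qed

text \<open>\<open>sweep\<close> is applied to the odd profile of \<open>f\<close>. Its mass is at
  least \<open>sqnorm f / m\<close>; its variation is at most the energy plus a cross term between
  edge differences and gaps, which Cauchy-Schwarz bounds by the energy and \<open>K\<close>.\<close>

lemma sweep_profile:
  assumes "thresholds s" and "m > 0" and s_m: "\<And>u. u < N \<Longrightarrow> \<bar>f u\<bar> \<le> s m"
    and f: "sqnorm f > 0"
    and K: "(\<Sum>j<m. \<Sum>u<N. degree u * (tent (s j) (s (Suc j)) \<bar>f u\<bar>)\<^sup>2) \<le> K"
  obtains A B where "sub_bipartition A B" "A \<union> B \<subseteq> {u. u < N \<and> f u \<noteq> 0}"
    "signed_bipartiteness_ratio degree A B \<le> m * (energy f + 3 * sqrt (2 * energy f * K)) / sqnorm f"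
proof -
  interpret thresholds s m by fact
  define h where "h u = sgn (f u) * profile \<bar>f u\<bar>" for u
  define p where "p u = gap \<bar>f u\<bar>" for u
  have hm: "sqnorm f \<le> m * mass h"
  proof -
    have "degree u * (f u)\<^sup>2 \<le> degree u * (m * \<bar>h u\<bar>)" if "u < N" for u
    proof (rule mult_left_mono)
      have "(f u)\<^sup>2 \<le> m * profile \<bar>f u\<bar>"
        using profile_ge[of "\<bar>f u\<bar>"] s_m[OF that] assms(2) by simp
      also have "profile \<bar>f u\<bar> = \<bar>h u\<bar>"
        using profile_nonneg[of "\<bar>f u\<bar>"] profile_gap_0 by (auto simp: h_def abs_mult sgn_if)
      finally show "(f u)\<^sup>2 \<le> m * \<bar>h u\<bar>" .
    qed (use degree_positive[OF that] in simp)
    then have "sqnorm f \<le> (\<Sum>u<N. degree u * (m * \<bar>h u\<bar>))"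
      unfolding sqnorm_def by (intro sum_mono) auto
    then show ?thesis by (simp add: mass_def sum_distrib_left mult_ac)
  qed
  define \<delta> where "\<delta> u v = \<bar>f u - sign u v * f v\<bar>" for u v
  have \<delta>_sym: "\<delta> u v = \<delta> v u" for u v
    using sign_cases[of u v] by (auto simp: \<delta>_def sign_commute[of v u] abs_minus_commute add.commute)
  have E: "(\<Sum>u<N. \<Sum>v<N. w u v * (\<delta> u v)\<^sup>2) = 2 * energy f" by (simp add: energy_def \<delta>_def)
  have pp: "(\<Sum>u<N. \<Sum>v<N. w u v * (p u)\<^sup>2) \<le> K"
  proof -
    have "(\<Sum>u<N. \<Sum>v<N. w u v * (p u)\<^sup>2) = (\<Sum>u<N. \<Sum>j<m. degree u * (tent (s j) (s (Suc j)) \<bar>f u\<bar>)\<^sup>2)"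
      unfolding sum_weight_left by (simp only: p_def gap_square sum_distrib_left)
    also have "\<dots> \<le> K" using K by (subst sum.swap)
    finally show ?thesis .
  qed
  have cross: "(\<Sum>u<N. \<Sum>v<N. w u v * (\<delta> u v * p u)) \<le> sqrt (2 * energy f * K)"
  proof (rule real_le_rsqrt)
    have 1: "(\<Sum>u<N. \<Sum>v<N. w u v * (\<delta> u v * p u))
        = (\<Sum>(u, v)\<in>{..<N} \<times> {..<N}. (sqrt (w u v) * \<delta> u v) * (sqrt (w u v) * p u))"
    proof -
      have "(sqrt (w u v) * \<delta> u v) * (sqrt (w u v) * p u) = w u v * (\<delta> u v * p u)" for u v
      proof -
        have "sqrt (w u v) * sqrt (w u v) = w u v" by (simp add: weight_nonneg)
        then show ?thesis by (metis mult.assoc mult.left_commute)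
      qed
      then show ?thesis by (simp only: sum.cartesian_product)
    qed
    have 2: "(\<Sum>(u, v)\<in>{..<N} \<times> {..<N}. (sqrt (w u v) * \<delta> u v)\<^sup>2) = 2 * energy f"
      unfolding E[symmetric]
      by (subst sum.cartesian_product[symmetric]) (simp add: weight_nonneg power_mult_distrib)
    have 3: "(\<Sum>(u, v)\<in>{..<N} \<times> {..<N}. (sqrt (w u v) * p u)\<^sup>2) \<le> K"
      using pp
      by (subst sum.cartesian_product[symmetric]) (simp add: weight_nonneg power_mult_distrib)
    have "(\<Sum>u<N. \<Sum>v<N. w u v * (\<delta> u v * p u))\<^sup>2
        \<le> 2 * energy f * (\<Sum>(u, v)\<in>{..<N} \<times> {..<N}. (sqrt (w u v) * p u)\<^sup>2)"
      unfolding 1 2[symmetric]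
      using cauchy_schwarz_sum[of "\<lambda>(u, v). sqrt (w u v) * \<delta> u v"
          "\<lambda>(u, v). sqrt (w u v) * p u" "{..<N} \<times> {..<N}"]
      by (simp add: case_prod_unfold)
    also have "\<dots> \<le> 2 * energy f * K" using 3 energy_nonneg by (intro mult_left_mono) auto
    finally show "(\<Sum>u<N. \<Sum>v<N. w u v * (\<delta> u v * p u))\<^sup>2 \<le> 2 * energy f * K" .
  qed
  have cross': "(\<Sum>u<N. \<Sum>v<N. w u v * (\<delta> u v * p v)) = (\<Sum>u<N. \<Sum>v<N. w u v * (\<delta> u v * p u))"
    by (subst sum.swap) (simp add: \<delta>_sym w_sym)
  have "2 * variation h \<le> (\<Sum>u<N. \<Sum>v<N. 3 * (w u v * (\<delta> u v * p u)) + 3 * (w u v * (\<delta> u v * p v))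
      + w u v * (\<delta> u v)\<^sup>2)"
  proof -
    have "w u v * \<bar>h u - sign u v * h v\<bar> \<le> 3 * (w u v * (\<delta> u v * p u)) + 3 * (w u v * (\<delta> u v * p v))
        + w u v * (\<delta> u v)\<^sup>2" for u v
    proof -
      \<comment> \<open>Oddness moves the sign inside the profile, so that the bound for two reals
        applies to \<open>f u\<close> and \<open>sign u v * f v\<close>.\<close>
      have "sign u v * h v = sgn (sign u v * f v) * profile \<bar>sign u v * f v\<bar>"
        using sign_cases[of u v] by (auto simp: h_def)
      then have "\<bar>h u - sign u v * h v\<bar>
          \<le> \<delta> u v * (3 * gap \<bar>f u\<bar> + 3 * gap \<bar>sign u v * f v\<bar> + \<delta> u v)"
        using profile_odd[of "f u" "sign u v * f v"] unfolding \<delta>_def by (simp only: h_def)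
      then have "\<bar>h u - sign u v * h v\<bar> \<le> \<delta> u v * (3 * p u + 3 * p v + \<delta> u v)"
        by (simp add: p_def abs_mult)
      then have "w u v * \<bar>h u - sign u v * h v\<bar> \<le> w u v * (\<delta> u v * (3 * p u + 3 * p v + \<delta> u v))"
        by (rule mult_left_mono) (rule weight_nonneg)
      then show ?thesis by (simp add: algebra_simps power2_eq_square)
    qed
    then show ?thesis by (simp add: variation_def sum_mono)
  qed
  also have "\<dots> = 6 * (\<Sum>u<N. \<Sum>v<N. w u v * (\<delta> u v * p u)) + 2 * energy f"
    by (simp add: sum.distrib E cross' flip: sum_distrib_left)
  finally have var: "variation h \<le> energy f + 3 * sqrt (2 * energy f * K)" using cross by linarith
  have "m * mass h > 0" using hm f by linarith
  then have mh: "mass h > 0" using assms(2) by (simp add: zero_less_mult_iff)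
  have "\<exists>u<N. h u \<noteq> 0"
  proof (rule ccontr)
    assume "\<not> ?thesis"
    then have "mass h = 0" by (simp add: mass_def)
    then show False using mh by simp
  qed
  then obtain A B where AB: "sub_bipartition A B" "A \<union> B \<subseteq> {u. u < N \<and> h u \<noteq> 0}"
    "signed_bipartiteness_ratio degree A B \<le> variation h / mass h" using sweep by blast
  have "variation h / mass h = m * variation h / (m * mass h)" using assms(2) by simp
  also have "\<dots> \<le> m * (energy f + 3 * sqrt (2 * energy f * K)) / sqnorm f"
    using var hm f order_trans[OF variation_nonneg var]
    by (intro frac_le mult_left_mono mult_nonneg_nonneg) auto
  finally have "signed_bipartiteness_ratio degree A B
      \<le> m * (energy f + 3 * sqrt (2 * energy f * K)) / sqnorm f" using AB(3) by linarith
  moreover have "A \<union> B \<subseteq> {u. u < N \<and> f u \<noteq> 0}" using AB(2) by (auto simp: h_def)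
  ultimately show ?thesis using that AB(1) by blast
qed

end

section \<open>The improved Cheeger inequality for one function\<close>

text \<open>Markov: if more than \<open>l\<close> of the \<open>2 l\<close> values exceeded
  \<open>S / l\<close>, they alone would sum to more than \<open>S\<close>.\<close>

lemma card_small_values:
  fixes x :: "nat \<Rightarrow> real"
  assumes "l > 0" and nonneg: "\<And>j. x j \<ge> 0" and sum: "(\<Sum>j<2 * l. x j) \<le> S"
  shows "l \<le> card {j. j < 2 * l \<and> x j \<le> S / l}"
proof (rule ccontr)
  assume less: "\<not> ?thesis"
  define B where "B = {j. j < 2 * l \<and> \<not> x j \<le> S / l}"
  have "card {..<2 * l} = card {j. j < 2 * l \<and> x j \<le> S / l} + card B"
  proof -
    have "{..<2 * l} = {j. j < 2 * l \<and> x j \<le> S / l} \<union> B" by (auto simp: B_def)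
    also have "card \<dots> = card {j. j < 2 * l \<and> x j \<le> S / l} + card B"
      by (rule card_Un_disjoint) (auto simp: B_def)
    finally show ?thesis .
  qed
  then have B: "l < card B" using less by simp
  have S: "S \<ge> 0" using sum sum_nonneg[of "{..<2 * l}" x] nonneg by force
  have "B \<noteq> {}" using B by auto
  have "S \<le> card B * (S / l)"
  proof -
    have "real l * (S / l) \<le> card B * (S / l)" using B S by (intro mult_right_mono) auto
    then show ?thesis using assms(1) by simp
  qed
  also have "\<dots> = (\<Sum>j\<in>B. S / l)" by simp
  also have "\<dots> < (\<Sum>j\<in>B. x j)"
    by (rule sum_strict_mono) (use \<open>B \<noteq> {}\<close> in \<open>auto simp: B_def\<close>)
  also have "\<dots> \<le> (\<Sum>j<2 * l. x j)"
    by (rule sum_mono2) (use nonneg in \<open>auto simp: B_def\<close>)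
  finally show False using sum by simp
qed

context signed_graph
begin

section \<open>Disjoint test functions and greedy thresholds\<close>

lemma sqnorm_combination_disjoint:
  fixes l :: nat
  assumes "\<And>u i j. i < l \<Longrightarrow> j < l \<Longrightarrow> i \<noteq> j \<Longrightarrow> g i u = 0 \<or> g j u = 0"
  shows "sqnorm (\<lambda>u. \<Sum>j<l. a j * g j u) = (\<Sum>j<l. (a j)\<^sup>2 * sqnorm (g j))"
proof -
  have "(\<Sum>j<l. a j * g j u)\<^sup>2 = (\<Sum>j<l. (a j)\<^sup>2 * (g j u)\<^sup>2)" for u
    using square_sum_disjoint[of "{..<l}" "\<lambda>j. a j * g j u"] assms
    by (auto simp: power_mult_distrib)
  then have "sqnorm (\<lambda>u. \<Sum>j<l. a j * g j u) = (\<Sum>u<N. \<Sum>j<l. (a j)\<^sup>2 * (degree u * (g j u)\<^sup>2))"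
    by (simp add: sqnorm_def sum_distrib_left mult_ac)
  also have "\<dots> = (\<Sum>j<l. (a j)\<^sup>2 * sqnorm (g j))"
    by (subst sum.swap) (simp add: sqnorm_def sum_distrib_left)
  finally show ?thesis .
qed

text \<open>Each end of an edge lies in the support of at most one function, so at most two indices
  interact; hence the factor 2.\<close>

lemma energy_combination_disjoint:
  fixes l :: nat
  assumes "\<And>u i j. i < l \<Longrightarrow> j < l \<Longrightarrow> i \<noteq> j \<Longrightarrow> g i u = 0 \<or> g j u = 0"
  shows "energy (\<lambda>u. \<Sum>j<l. a j * g j u) \<le> 2 * (\<Sum>j<l. (a j)\<^sup>2 * energy (g j))"
proof -
  have "w u v * ((\<Sum>j<l. a j * g j u) - sign u v * (\<Sum>j<l. a j * g j v))\<^sup>2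
      \<le> (\<Sum>j<l. 2 * (a j)\<^sup>2 * (w u v * (g j u - sign u v * g j v)\<^sup>2))" for u v
  proof -
    have "(\<Sum>j<l. a j * g j u) - sign u v * (\<Sum>j<l. a j * g j v)
        = (\<Sum>j<l. a j * g j u - sign u v * (a j * g j v))"
      by (simp add: sum_subtractf sum_distrib_left)
    also have "\<dots>\<^sup>2 \<le> 2 * (\<Sum>j<l. (a j * g j u - sign u v * (a j * g j v))\<^sup>2)"
      using square_sum_diff_disjoint[of l "\<lambda>j. a j * g j u" "\<lambda>j. sign u v * (a j * g j v)"] assms
      by fastforce
    also have "\<dots> = (\<Sum>j<l. 2 * (a j)\<^sup>2 * (g j u - sign u v * g j v)\<^sup>2)"
      unfolding sum_distrib_left
      by (intro sum.cong refl) (simp add: power_mult_distrib[symmetric] algebra_simps)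
    finally have "w u v * ((\<Sum>j<l. a j * g j u) - sign u v * (\<Sum>j<l. a j * g j v))\<^sup>2
      \<le> w u v * (\<Sum>j<l. 2 * (a j)\<^sup>2 * (g j u - sign u v * g j v)\<^sup>2)"
      by (rule mult_left_mono) (rule weight_nonneg)
    then show ?thesis by (simp add: sum_distrib_left mult_ac)
  qed
  then have "2 * energy (\<lambda>u. \<Sum>j<l. a j * g j u)
      \<le> (\<Sum>u<N. \<Sum>v<N. \<Sum>j<l. 2 * (a j)\<^sup>2 * (w u v * (g j u - sign u v * g j v)\<^sup>2))"
    by (simp add: energy_def sum_mono)
  also have "\<dots> = (\<Sum>u<N. \<Sum>j<l. \<Sum>v<N. 2 * (a j)\<^sup>2 * (w u v * (g j u - sign u v * g j v)\<^sup>2))"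
    by (intro sum.cong[OF refl]) (rule sum.swap)
  also have "\<dots> = (\<Sum>j<l. \<Sum>u<N. \<Sum>v<N. 2 * (a j)\<^sup>2 * (w u v * (g j u - sign u v * g j v)\<^sup>2))"
    by (rule sum.swap)
  also have "\<dots> = (\<Sum>j<l. 2 * (a j)\<^sup>2 * (2 * energy (g j)))"
    by (simp add: energy_def flip: sum_distrib_left)
  also have "\<dots> = 2 * (2 * (\<Sum>j<l. (a j)\<^sup>2 * energy (g j)))"
    by (simp add: sum_distrib_left mult_ac)
  finally show ?thesis by simp
qed

text \<open>The \<open>l\<close> cheapest of the \<open>2 l\<close> functions each have energy at
  most \<open>S / l\<close>. They span a test space for \<open>lam l\<close>; starting from twice as
  many functions makes a bound on the total energy sufficient.\<close>

lemma lam_le_disjoint: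
  assumes l: "1 \<le> l" "l \<le> N"
    and disj: "\<And>u i j. i < 2 * l \<Longrightarrow> j < 2 * l \<Longrightarrow> i \<noteq> j \<Longrightarrow> g i u = 0 \<or> g j u = 0"
    and norm: "\<And>j. j < 2 * l \<Longrightarrow> sqnorm (g j) = C" and C: "C > 0"
    and total: "(\<Sum>j<2 * l. energy (g j)) \<le> S"
  shows "lam l * l * C \<le> 2 * S"
proof -
  have "l \<le> card {j. j < 2 * l \<and> energy (g j) \<le> S / l}"
    using card_small_values[of l "\<lambda>j. energy (g j)"] l energy_nonneg total by simp
  then obtain J where J: "J \<subseteq> {j. j < 2 * l \<and> energy (g j) \<le> S / l}" "card J = l" "finite J"
    using obtain_subset_with_card_n by blast
  then obtain e where e: "bij_betw e {..<l} J"
    using ex_bij_betw_nat_finite[of J] by (auto simp: lessThan_atLeast0)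
  define g' where "g' j = g (e j)" for j
  have eJ: "e j < 2 * l" "energy (g' j) \<le> S / l" if "j < l" for j
    using e J(1) that bij_betwE[OF e] by (auto simp: g'_def)
  have disj': "g' i u = 0 \<or> g' j u = 0" if "i < l" "j < l" "i \<noteq> j" for u i j
    unfolding g'_def using that e eJ by (intro disj) (auto simp: bij_betw_def inj_on_def)
  obtain a where a: "\<exists>j<l. a j \<noteq> 0"
    "lam l * sqnorm (\<lambda>u. \<Sum>j<l. a j * g' j u) \<le> energy (\<lambda>u. \<Sum>j<l. a j * g' j u)"
    using lam_le_combination[OF l] by blast
  define Z where "Z = (\<Sum>j<l. (a j)\<^sup>2)"
  have "Z > 0" unfolding Z_def using a(1) by (auto intro: sum_pos2)
  have "sqnorm (\<lambda>u. \<Sum>j<l. a j * g' j u) = (\<Sum>j<l. (a j)\<^sup>2 * sqnorm (g' j))"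
    by (rule sqnorm_combination_disjoint) (rule disj')
  then have "sqnorm (\<lambda>u. \<Sum>j<l. a j * g' j u) = Z * C"
    using eJ(1) norm by (simp add: Z_def g'_def sum_distrib_right)
  moreover have "energy (\<lambda>u. \<Sum>j<l. a j * g' j u) \<le> 2 * (\<Sum>j<l. (a j)\<^sup>2 * energy (g' j))"
    by (rule energy_combination_disjoint) (rule disj')
  moreover have "(\<Sum>j<l. (a j)\<^sup>2 * energy (g' j)) \<le> Z * (S / l)"
    unfolding Z_def sum_distrib_right by (intro sum_mono mult_left_mono eJ(2)) auto
  ultimately have "lam l * (Z * C) \<le> 2 * (Z * (S / l))" using a(2) by simp
  then have "Z * (lam l * C) \<le> Z * (2 * (S / l))" by (simp only: mult.left_commute)
  then have "lam l * C \<le> 2 * (S / l)" using \<open>Z > 0\<close> by (rule mult_left_le_imp_le)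
  then show ?thesis using l by (simp add: field_simps)
qed

text \<open>The sum is continuous in \<open>b\<close> and vanishes at \<open>b = a\<close>, so it
  takes the value \<open>C\<close> before \<open>T\<close> unless it is still at most
  \<open>C\<close> at \<open>T\<close>.\<close>

lemma next_threshold:
  assumes "C > 0" "a \<le> T"
  obtains b where "a \<le> b" "b \<le> T" "(\<Sum>u<N. degree u * (tent a b \<bar>f u\<bar>)\<^sup>2) \<le> C"
    "b = T \<or> (\<Sum>u<N. degree u * (tent a b \<bar>f u\<bar>)\<^sup>2) = C"
proof -
  define Q where "Q b = (\<Sum>u<N. degree u * (tent a b \<bar>f u\<bar>)\<^sup>2)" for b
  show ?thesis
  proof (cases "Q T \<le> C")
    case True
    then show ?thesis using that[of T] assms by (simp add: Q_def)
  next
    case False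
    have "Q a = 0" by (auto simp: Q_def tent_def max_def min_def intro!: sum.neutral)
    then have "Q a \<le> C" "C \<le> Q T" using assms False by auto
    moreover have "continuous_on {a..T} Q"
      unfolding Q_def tent_def by (intro continuous_intros)
    ultimately obtain b where "a \<le> b" "b \<le> T" "Q b = C"
      using IVT'[of Q a C T] assms(2) by blast
    then show ?thesis using that[of b] by (simp add: Q_def)
  qed
qed

text \<open>If the greedy choice had not reached \<open>T\<close> after \<open>2 l\<close> steps,
  each interval would carry exactly \<open>C\<close>, and the signed tents would contradict
  \<open>gap\<close> through \<open>lam_le_disjoint\<close>.\<close>

lemma thresholds_exist:
  assumes l: "1 \<le> l" "l \<le> N" and C: "C > 0" and gap: "2 * energy f < lam l * l * C"
    and T: "0 \<le> T"
  obtains s where "thresholds s" "s (2 * l) = T"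
    "\<And>j. (\<Sum>u<N. degree u * (tent (s j) (s (Suc j)) \<bar>f u\<bar>)\<^sup>2) \<le> C"
proof -
  define Q where "Q a b = (\<Sum>u<N. degree u * (tent a b \<bar>f u\<bar>)\<^sup>2)" for a b
  have "\<forall>a. \<exists>b. a \<le> T \<longrightarrow> a \<le> b \<and> b \<le> T \<and> Q a b \<le> C \<and> (b = T \<or> Q a b = C)"
    unfolding Q_def using next_threshold[OF C] by metis
  then obtain nx where nx: "\<And>a. a \<le> T \<Longrightarrow> a \<le> nx a \<and> nx a \<le> T \<and> Q a (nx a) \<le> C
      \<and> (nx a = T \<or> Q a (nx a) = C)" by metis
  define s where "s j = (nx ^^ j) 0" for j
  have s_step: "s (Suc j) = nx (s j)" for j by (simp add: s_def)
  have sT: "s j \<le> T" for j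
  proof (induction j)
    case 0
    show ?case using T by (simp add: s_def)
  next
    case (Suc j)
    then show ?case using nx[of "s j"] by (simp add: s_step)
  qed
  have s_mono: "mono s" using nx[OF sT] by (intro mono_iff_le_Suc[THEN iffD2]) (simp add: s_step)
  have s_0: "s 0 = 0" by (simp add: s_def)
  have Q: "Q (s j) (s (Suc j)) \<le> C" for j using nx[OF sT] by (simp add: s_step)
  interpret thresholds s "2 * l" by unfold_locales (fact s_mono, fact s_0)
  have "s (2 * l) = T"
  proof (rule ccontr)
    assume ne: "s (2 * l) \<noteq> T"
    define g where "g j u = sgn (f u) * tent (s j) (s (Suc j)) \<bar>f u\<bar>" for j u
    \<comment> \<open>The sequence is monotone and bounded by \<open>T\<close>, so it would stay at
      \<open>T\<close> once there.\<close>
    have "s (Suc j) \<noteq> T" if "j < 2 * l" for j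
    proof
      assume "s (Suc j) = T"
      moreover have "s (Suc j) \<le> s (2 * l)" using that by (intro monoD[OF s_mono]) auto
      ultimately show False using ne sT[of "2 * l"] by simp
    qed
    then have QC: "Q (s j) (s (Suc j)) = C" if "j < 2 * l" for j
      using nx[OF sT[of j]] that by (auto simp: s_step)
    have norm: "sqnorm (g j) = C" if "j < 2 * l" for j
    proof -
      have "(g j u)\<^sup>2 = (tent (s j) (s (Suc j)) \<bar>f u\<bar>)\<^sup>2" for u
        using s_nonneg[of j] by (cases "f u = 0") (auto simp: g_def power_mult_distrib tent_def sgn_if)
      then show ?thesis using QC[OF that] by (simp add: sqnorm_def Q_def)
    qed
    have "(\<Sum>j<2 * l. energy (g j)) \<le> energy f"
    proof -
      have "(\<Sum>j<2 * l. 2 * energy (g j))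
          = (\<Sum>j<2 * l. \<Sum>u<N. \<Sum>v<N. w u v * (g j u - sign u v * g j v)\<^sup>2)"
        by (simp add: energy_def)
      also have "\<dots> = (\<Sum>u<N. \<Sum>j<2 * l. \<Sum>v<N. w u v * (g j u - sign u v * g j v)\<^sup>2)"
        by (rule sum.swap)
      also have "\<dots> = (\<Sum>u<N. \<Sum>v<N. \<Sum>j<2 * l. w u v * (g j u - sign u v * g j v)\<^sup>2)"
        by (intro sum.cong[OF refl]) (rule sum.swap)
      also have "\<dots> \<le> (\<Sum>u<N. \<Sum>v<N. w u v * (f u - sign u v * f v)\<^sup>2)"
      proof (intro sum_mono)
        fix u v
        have "sign u v * g j v = sgn (sign u v * f v) * tent (s j) (s (Suc j)) \<bar>sign u v * f v\<bar>" for j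
          using sign_cases[of u v] by (auto simp: g_def)
        then have "(\<Sum>j<2 * l. (g j u - sign u v * g j v)\<^sup>2) \<le> (f u - sign u v * f v)\<^sup>2"
          using sum_tent_odd[of "f u" "sign u v * f v"] by (simp only: g_def)
        then show "(\<Sum>j<2 * l. w u v * (g j u - sign u v * g j v)\<^sup>2) \<le> w u v * (f u - sign u v * f v)\<^sup>2"
          by (simp add: sum_distrib_left[symmetric] mult_left_mono weight_nonneg)
      qed
      also have "\<dots> = 2 * energy f" by (simp add: energy_def)
      finally show ?thesis by (simp add: sum_distrib_left[symmetric])
    qed
    moreover have "g i u = 0 \<or> g j u = 0" if "i \<noteq> j" for u i j
      using tent_disjoint[OF that, of "\<bar>f u\<bar>"] by (auto simp: g_def)
    ultimately have "lam l * l * C \<le> 2 * energy f"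
      by (intro lam_le_disjoint[OF l _ norm C]) auto
    then show False using gap by simp
  qed
  then show ?thesis using that[of s] Q thresholds_axioms by (simp add: Q_def)
qed

text \<open>The hypothesis \<open>deg\<close> covers \<open>lam l = 0\<close>: the quotient is then
  0 by convention, and only functions of energy 0 can satisfy the claim.\<close>

lemma improved_sweep:
  assumes l: "1 \<le> l" "l \<le> N" and f: "sqnorm f > 0" and deg: "lam l > 0 \<or> energy f = 0"
  obtains A B where "sub_bipartition A B" "A \<union> B \<subseteq> {u. u < N \<and> f u \<noteq> 0}"
    "signed_bipartiteness_ratio degree A B \<le> 28 * real l * (energy f / sqnorm f) / sqrt (lam l)"
proof -
  define T where "T = (\<Sum>u<N. \<bar>f u\<bar>)"
  have T: "0 \<le> T" by (simp add: T_def sum_nonneg)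
  have fT: "\<bar>f u\<bar> \<le> T" if "u < N" for u
    unfolding T_def by (rule member_le_sum) (use that in auto)
  show ?thesis
  proof (cases "energy f = 0")
    case True
    \<comment> \<open>With energy 0 the bound of \<open>sweep_profile\<close> is 0 for any
      \<open>K\<close>, so one interval up to \<open>T\<close> is enough.\<close>
    define s where "s j = (if j = 0 then 0 else T)" for j :: nat
    have "thresholds s" by unfold_locales (use T in \<open>auto simp: s_def mono_def\<close>)
    moreover have "\<bar>f u\<bar> \<le> s 1" if "u < N" for u using fT[OF that] by (simp add: s_def)
    ultimately obtain A B where "sub_bipartition A B" "A \<union> B \<subseteq> {u. u < N \<and> f u \<noteq> 0}"
      "signed_bipartiteness_ratio degree A B
        \<le> real 1 * (energy f + 3 * sqrt (2 * energy f *
            (\<Sum>j<1. \<Sum>u<N. degree u * (tent (s j) (s (Suc j)) \<bar>f u\<bar>)\<^sup>2))) / sqnorm f"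
      using sweep_profile[of s 1 f, OF _ _ _ f order_refl] by auto
    then show ?thesis using that True by simp
  next
    case False
    then have E: "energy f > 0" and lam: "lam l > 0" using deg energy_nonneg[of f] by auto
    \<comment> \<open>This makes \<open>lam l * l * C\<close> equal to \<open>4 * energy f\<close>,
      strictly above the \<open>2 * energy f\<close> demanded by
      \<open>thresholds_exist\<close>.\<close>
    define C where "C = 4 * energy f / (l * lam l)"
    have l0: "real l > 0" using l by simp
    have C: "C > 0" using E lam l0 by (simp add: C_def)
    have "2 * energy f < lam l * l * C" using E lam l0 by (simp add: C_def)
    then obtain s where s: "thresholds s" "s (2 * l) = T"
      "\<And>j. (\<Sum>u<N. degree u * (tent (s j) (s (Suc j)) \<bar>f u\<bar>)\<^sup>2) \<le> C"
      using thresholds_exist[OF l C _ T] by blast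
    define K where "K = 8 * energy f / lam l"
    have "(\<Sum>j<2 * l. \<Sum>u<N. degree u * (tent (s j) (s (Suc j)) \<bar>f u\<bar>)\<^sup>2) \<le> (\<Sum>j<2 * l. C)"
      by (intro sum_mono s(3))
    also have "\<dots> = K" using l0 by (simp add: C_def K_def)
    finally have K: "(\<Sum>j<2 * l. \<Sum>u<N. degree u * (tent (s j) (s (Suc j)) \<bar>f u\<bar>)\<^sup>2) \<le> K" .
    obtain A B where AB: "sub_bipartition A B" "A \<union> B \<subseteq> {u. u < N \<and> f u \<noteq> 0}"
      "signed_bipartiteness_ratio degree A B
        \<le> real (2 * l) * (energy f + 3 * sqrt (2 * energy f * K)) / sqnorm f"
      by (rule sweep_profile[OF s(1) _ _ f K]) (use l s(2) fT in auto)
    have "2 * energy f * K = (4 * energy f / sqrt (lam l))\<^sup>2"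
      using lam by (simp add: K_def power_divide power_mult_distrib power2_eq_square)
    then have sq: "sqrt (2 * energy f * K) = 4 * energy f / sqrt (lam l)"
      using E lam by (simp add: real_sqrt_unique)
    \<comment> \<open>In units of \<open>energy f / sqrt (lam l)\<close>, the energy counts at most
      2 and the cross term is 3 * 4, together 14; the \<open>2 l\<close> intervals turn this into
      \<open>28 l\<close>.\<close>
    have "sqrt (lam l) \<le> sqrt 4" using lam_bounds(2)[OF l] by (intro real_sqrt_le_mono) simp
    then have "sqrt (lam l) \<le> 2" by simp
    then have "energy f * sqrt (lam l) \<le> energy f * 2" using E by (intro mult_left_mono) auto
    then have "energy f \<le> 2 * energy f / sqrt (lam l)" using lam by (simp add: field_simps)
    then have "energy f + 3 * sqrt (2 * energy f * K) \<le> 14 * energy f / sqrt (lam l)"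
      unfolding sq by simp
    then have "real (2 * l) * (energy f + 3 * sqrt (2 * energy f * K)) / sqnorm f
        \<le> real (2 * l) * (14 * energy f / sqrt (lam l)) / sqnorm f"
      using f by (intro divide_right_mono mult_left_mono) auto
    also have "\<dots> = 28 * real l * (energy f / sqnorm f) / sqrt (lam l)" by (simp add: mult_ac)
    finally show ?thesis using that AB by force
  qed
qed

end

section \<open>Averaging, grouping and subdivisions of the line\<close>

text \<open>If each \<open>t\<close> failed one of the bounds, \<open>a t / A + b t / B\<close>
  would always exceed 2, twice the allowed average of each quotient. The case \<open>B = 0\<close>,
  where \<open>b\<close> vanishes identically, is separate; it occurs when all energies are
  0.\<close>

lemma averaging_two:
  fixes a b :: "'a \<Rightarrow> real" and A B :: real
  assumes "finite T" "T \<noteq> {}" "\<And>t. t \<in> T \<Longrightarrow> a t \<ge> 0" "\<And>t. t \<in> T \<Longrightarrow> b t \<ge> 0"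
    and a: "sum a T \<le> card T * A" and b: "sum b T \<le> card T * B" and A: "A > 0"
  shows "\<exists>t\<in>T. a t \<le> 2 * A \<and> b t \<le> 2 * B"
proof (cases "B > 0")
  case True
  show ?thesis
  proof (rule ccontr)
    assume neg: "\<not> ?thesis"
    have "2 < a t / A + b t / B" if "t \<in> T" for t
    proof -
      have ge: "a t / A \<ge> 0" "b t / B \<ge> 0" using assms(3,4)[OF that] A True by auto
      have "a t / A > 2 \<or> b t / B > 2" using neg that A True by (auto simp: field_simps)
      then show ?thesis using ge by linarith
    qed
    then have "(\<Sum>t\<in>T. 2) < (\<Sum>t\<in>T. a t / A + b t / B)"
      using assms(1,2) by (intro sum_strict_mono) auto
    also have "\<dots> = sum a T / A + sum b T / B" by (simp add: sum.distrib sum_divide_distrib)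
    also have "\<dots> \<le> real (card T) + real (card T)"
      using a b A True by (intro add_mono) (auto simp: pos_divide_le_eq)
    finally show False by simp
  qed
next
  case False
  have "card T * B \<le> 0" using False by (simp add: mult_nonneg_nonpos)
  moreover have "sum b T \<ge> 0" using assms(4) by (intro sum_nonneg) auto
  ultimately have sb: "sum b T = 0" and "card T * B = 0" using b by linarith+
  then have B: "B = 0" using assms(1,2) by auto
  have b0: "b t = 0" if "t \<in> T" for t
    using sb that assms(1,4) by (simp add: sum_nonneg_eq_0_iff)
  have "\<exists>t\<in>T. a t \<le> 2 * A"
  proof (rule ccontr)
    assume "\<not> ?thesis"
    then have "(\<Sum>t\<in>T. 2 * A) < sum a T" using assms(1,2) by (intro sum_strict_mono) auto
    moreover have "card T * A \<le> card T * (2 * A)" using A by (intro mult_left_mono) auto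
    ultimately show False using a by simp
  qed
  then show ?thesis using b0 B by force
qed

text \<open>Elements are dropped while weight 1/2 remains. When dropping \<open>a\<close> would
  leave less, either \<open>a\<close> alone is heavy enough or the whole set weighs less than
  \<open>1 / 2 + 1 / 2 \<le> B\<close>.\<close>

lemma subset_weight:
  fixes m :: "'a \<Rightarrow> real" and B :: real
  assumes "finite I" "\<And>c. c \<in> I \<Longrightarrow> m c \<le> B" "1 \<le> B" "1 / 2 \<le> sum m I"
  shows "\<exists>J\<subseteq>I. 1 / 2 \<le> sum m J \<and> sum m J \<le> B"
  using assms
proof (induction I)
  case (insert a I)
  show ?case
  proof (cases "1 / 2 \<le> sum m I")
    case True
    then obtain J where "J \<subseteq> I" "1 / 2 \<le> sum m J" "sum m J \<le> B" using insert by auto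
    then show ?thesis by blast
  next
    case small: False
    show ?thesis
    proof (cases "1 / 2 \<le> m a")
      case True
      then show ?thesis using insert.prems by (intro exI[of _ "{a}"]) auto
    next
      case False
      then have "sum m (insert a I) \<le> B" using small insert by simp
      then show ?thesis using insert.prems by blast
    qed
  qed
qed simp

text \<open>Each extracted group uses up at most \<open>B\<close>; the last of the
  \<open>n + 1\<close> groups takes whatever is left, hence \<open>n * B + 1 / 2\<close>.\<close>

lemma group_weights:
  fixes m :: "'a \<Rightarrow> real" and B :: real and n :: nat
  assumes "finite I" "\<And>c. c \<in> I \<Longrightarrow> m c \<le> B" "1 \<le> B" "n * B + 1 / 2 \<le> sum m I"
  shows "\<exists>S. (\<forall>j\<le>n. S j \<subseteq> I \<and> 1 / 2 \<le> sum m (S j))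
    \<and> (\<forall>i\<le>n. \<forall>j\<le>n. i \<noteq> j \<longrightarrow> S i \<inter> S j = {})"
  using assms
proof (induction n arbitrary: I)
  case 0
  then show ?case by (intro exI[of _ "\<lambda>_. I"]) auto
next
  case (Suc n)
  have "0 \<le> Suc n * B" using Suc.prems(3) by simp
  then have "1 / 2 \<le> sum m I" using Suc.prems(4) by linarith
  from subset_weight[OF Suc.prems(1-3) this]
  obtain J where J: "J \<subseteq> I" "1 / 2 \<le> sum m J" "sum m J \<le> B" by blast
  have "sum m (I - J) = sum m I - sum m J"
    using J(1) Suc.prems(1) by (rule sum_diff[rotated])
  then have ge: "n * B + 1 / 2 \<le> sum m (I - J)" using J(3) Suc.prems(4) by (simp add: algebra_simps)
  have fin: "finite (I - J)" and le: "\<And>c. c \<in> I - J \<Longrightarrow> m c \<le> B" using Suc.prems by auto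
  from Suc.IH[OF fin le Suc.prems(3) ge] obtain S where S: "\<forall>j\<le>n. S j \<subseteq> I - J \<and> 1 / 2 \<le> sum m (S j)"
    "\<forall>i\<le>n. \<forall>j\<le>n. i \<noteq> j \<longrightarrow> S i \<inter> S j = {}"
    by blast
  show ?case
  proof (intro exI[of _ "S(Suc n := J)"] conjI allI impI)
    fix j assume "j \<le> Suc n"
    then show "(S(Suc n := J)) j \<subseteq> I" "1 / 2 \<le> sum m ((S(Suc n := J)) j)"
      using S(1) J by (auto simp: le_Suc_eq)
  next
    fix i j :: nat assume ij: "i \<le> Suc n" "j \<le> Suc n" "i \<noteq> j"
    show "(S(Suc n := J)) i \<inter> (S(Suc n := J)) j = {}"
    proof (cases "i = Suc n \<or> j = Suc n")
      case True
      then show ?thesis using ij S(1) by (auto simp: le_Suc_eq)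
    next
      case False
      then show ?thesis using ij S(2) by auto
    qed
  qed
qed

section \<open>Even subdivisions of the line and their cost averaged over shifts\<close>

text \<open>The line is cut at the integers \<open>n\<close> with \<open>\<bar>n\<bar> \<equiv> t (mod M)\<close>: \<open>bump\<close> is a tent of width one around
  each of these centres, and \<open>lab\<close> numbers the intervals between them. Taking \<open>\<bar>n\<bar>\<close> makes the
  subdivision invariant under negation, as signed edges require.\<close>

definition bump :: "nat \<Rightarrow> nat \<Rightarrow> real \<Rightarrow> real" where
  "bump M t y = (if round \<bar>y\<bar> mod int M = int t then 1 - 2 * \<bar>\<bar>y\<bar> - round \<bar>y\<bar>\<bar> else 0)"

definition lab :: "nat \<Rightarrow> nat \<Rightarrow> real \<Rightarrow> int" where
  "lab M t y = (if y > 0 then 1 else if y < 0 then - 1 else 0) * ((\<lfloor>\<bar>y\<bar>\<rfloor> - int t) div int M + 1)"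

lemma round_dist: "\<bar>y - round y\<bar> \<le> 1 / 2" for y :: real
  using of_int_round_abs_le[of y] by (simp add: abs_minus_commute)

lemma bump_bounds: "0 \<le> bump M t y" "bump M t y \<le> 1"
  using round_dist[of "\<bar>y\<bar>"] by (auto simp: bump_def)

lemma bump_minus [simp]: "bump M t (- y) = bump M t y"
  by (simp add: bump_def)

lemma lab_minus: "lab M t (- y) = - lab M t y"
  by (simp add: lab_def)

lemma bump_le:
  fixes y :: real
  shows "bump M t y \<le> 1 - 2 * (\<bar>y\<bar> - round \<bar>y\<bar>)" "bump M t y \<le> 1 - 2 * (round \<bar>y\<bar> - \<bar>y\<bar>)"
proof -
  define z where "z = \<bar>y\<bar> - round \<bar>y\<bar>"
  have "bump M t y \<le> 1 - 2 * \<bar>z\<bar>"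
    using round_dist[of "\<bar>y\<bar>"] by (auto simp: bump_def z_def)
  then have "bump M t y \<le> 1 - 2 * z" "bump M t y \<le> 1 - 2 * (- z)" by linarith+
  then show "bump M t y \<le> 1 - 2 * (\<bar>y\<bar> - round \<bar>y\<bar>)" "bump M t y \<le> 1 - 2 * (round \<bar>y\<bar> - \<bar>y\<bar>)"
    by (simp_all add: z_def)
qed

text \<open>If \<open>\<bar>a\<bar>\<close> and \<open>\<bar>b\<bar>\<close> round differently, a
  half-integer separates them. Every bump vanishes there, so both values are at most twice the
  distance.\<close>

lemma bump_lipschitz:
  fixes a b :: real
  shows "\<bar>bump M t a - bump M t b\<bar> \<le> 2 * \<bar>a - b\<bar>"
proof -
  have *: "\<bar>bump M t a - bump M t b\<bar> \<le> 2 * (\<bar>b\<bar> - \<bar>a\<bar>)" if ab: "\<bar>a\<bar> \<le> \<bar>b\<bar>" for a b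
  proof (cases "round \<bar>a\<bar> = round \<bar>b\<bar>")
    case True
    define r where "r = real_of_int (round \<bar>b\<bar>)"
    define X Y where "X = \<bar>\<bar>b\<bar> - r\<bar>" and "Y = \<bar>\<bar>a\<bar> - r\<bar>"
    have "\<bar>X - Y\<bar> \<le> \<bar>b\<bar> - \<bar>a\<bar>"
      using abs_triangle_ineq3[of "\<bar>b\<bar> - r" "\<bar>a\<bar> - r"] ab by (simp add: X_def Y_def)
    moreover have "bump M t a - bump M t b = 2 * (X - Y) \<or> bump M t a - bump M t b = 0"
      by (simp add: bump_def True r_def X_def Y_def algebra_simps)
    ultimately show ?thesis using ab by (elim disjE) simp_all
  next
    case False
    have "round \<bar>a\<bar> \<le> round \<bar>b\<bar>" using ab by (rule round_mono)
    then have "round \<bar>a\<bar> + 1 \<le> round \<bar>b\<bar>" using False by simp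
    then have "real_of_int (round \<bar>a\<bar>) + 1 \<le> round \<bar>b\<bar>" by linarith
    moreover have "\<bar>a\<bar> - 1 / 2 \<le> round \<bar>a\<bar>" "round \<bar>b\<bar> \<le> \<bar>b\<bar> + 1 / 2"
      using round_dist[of "\<bar>a\<bar>"] round_dist[of "\<bar>b\<bar>"] unfolding abs_le_iff by linarith+
    moreover have "bump M t a \<le> 1 - 2 * (\<bar>a\<bar> - round \<bar>a\<bar>)" "bump M t b \<le> 1 - 2 * (round \<bar>b\<bar> - \<bar>b\<bar>)"
      using bump_le by blast+
    ultimately have "bump M t a \<le> 2 * (\<bar>b\<bar> - \<bar>a\<bar>)" "bump M t b \<le> 2 * (\<bar>b\<bar> - \<bar>a\<bar>)"
      by (simp_all add: algebra_simps)
    then show ?thesis using bump_bounds(1)[of M t a] bump_bounds(1)[of M t b]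
      by (simp add: abs_le_iff)
  qed
  show ?thesis
  proof (cases "\<bar>a\<bar> \<le> \<bar>b\<bar>")
    case True
    then show ?thesis
      using order_trans[OF *[OF True], of "2 * \<bar>a - b\<bar>"] abs_triangle_ineq2[of b a]
      by (simp add: abs_minus_commute)
  next
    case False
    then have "\<bar>b\<bar> \<le> \<bar>a\<bar>" by simp
    then show ?thesis
      using order_trans[OF *[OF \<open>\<bar>b\<bar> \<le> \<bar>a\<bar>\<close>], of "2 * \<bar>a - b\<bar>"] abs_triangle_ineq2[of a b]
      by (simp add: abs_minus_commute)
  qed
qed

text \<open>Each point belongs to the bump of only one residue, so at most two shifts contribute,
  each at most \<open>4 (a - b)^2\<close>. The bound is independent of \<open>M\<close>, which is
  the gain from averaging.\<close>

lemma sum_bump_diff: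
  fixes a b :: real
  shows "(\<Sum>t<M. (bump M t a - bump M t b)\<^sup>2) \<le> 8 * (a - b)\<^sup>2"
proof -
  define T where "T = {nat (round \<bar>a\<bar> mod int M), nat (round \<bar>b\<bar> mod int M)}"
  have "bump M t y = 0" if "t \<noteq> nat (round \<bar>y\<bar> mod int M)" for t y
    using that by (auto simp: bump_def)
  then have "(\<Sum>t<M. (bump M t a - bump M t b)\<^sup>2) = (\<Sum>t\<in>{..<M} \<inter> T. (bump M t a - bump M t b)\<^sup>2)"
    by (intro sum.mono_neutral_right) (auto simp: T_def)
  also have "\<dots> \<le> (\<Sum>t\<in>{..<M} \<inter> T. 4 * (a - b)\<^sup>2)"
  proof (rule sum_mono)
    fix t
    have "\<bar>bump M t a - bump M t b\<bar>\<^sup>2 \<le> (2 * \<bar>a - b\<bar>)\<^sup>2"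
      by (rule power_mono[OF bump_lipschitz]) simp
    then show "(bump M t a - bump M t b)\<^sup>2 \<le> 4 * (a - b)\<^sup>2" by (simp add: power_mult_distrib)
  qed
  also have "\<dots> = card ({..<M} \<inter> T) * (4 * (a - b)\<^sup>2)" by simp
  also have "\<dots> \<le> 2 * (4 * (a - b)\<^sup>2)"
  proof (rule mult_right_mono)
    have "card ({..<M} \<inter> T) \<le> card T" by (intro card_mono) (auto simp: T_def)
    also have "card T \<le> 2" by (simp add: T_def card_insert_if)
    finally show "real (card ({..<M} \<inter> T)) \<le> 2" by simp
  qed simp
  finally show ?thesis by simp
qed

lemma lab_nonzero:
  assumes "t < M" "lab M t y \<noteq> 0"
  shows "real t \<le> \<bar>y\<bar>"
proof (rule ccontr)
  assume "\<not> ?thesis"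
  then have "\<lfloor>\<bar>y\<bar>\<rfloor> < int t" by (simp add: floor_less_iff)
  moreover have "0 \<le> \<lfloor>\<bar>y\<bar>\<rfloor>" by simp
  ultimately have "\<lfloor>\<bar>y\<bar>\<rfloor> - int t < 0" "int M * (- 1) \<le> \<lfloor>\<bar>y\<bar>\<rfloor> - int t"
    using assms(1) by linarith+
  moreover have M: "int M > 0" using assms(1) by simp
  ultimately have "(\<lfloor>\<bar>y\<bar>\<rfloor> - int t) div int M < 0"
    "(int M * (- 1)) div int M \<le> (\<lfloor>\<bar>y\<bar>\<rfloor> - int t) div int M"
    using pos_imp_zdiv_neg_iff[OF M] zdiv_mono1[OF _ M] by blast+
  moreover have "(int M * (- 1)) div int M = - 1"
    by (rule nonzero_mult_div_cancel_left) (use M in simp)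
  ultimately have "(\<lfloor>\<bar>y\<bar>\<rfloor> - int t) div int M = - 1" by linarith
  then show False using assms(2) by (simp add: lab_def)
qed

text \<open>The cell with label 0 is symmetric about the origin and may have length close to
  \<open>2 M\<close>; all other cells lie on one side and have length at most
  \<open>M\<close>.\<close>

lemma lab_diameter:
  fixes x y :: real
  assumes t: "t < M" and eq: "lab M t x = lab M t y"
  shows "\<bar>x - y\<bar> \<le> 2 * M"
proof -
  define q where "q z = (\<lfloor>\<bar>z\<bar>\<rfloor> - int t) div int M" for z :: real
  have M: "int M > 0" using t by simp
  have q: "int M * q z \<le> \<lfloor>\<bar>z\<bar>\<rfloor> - int t" "\<lfloor>\<bar>z\<bar>\<rfloor> - int t < int M * q z + int M" for z
    using mult_div_mod_eq[of "int M" "\<lfloor>\<bar>z\<bar>\<rfloor> - int t"]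
      pos_mod_bound[OF M, of "\<lfloor>\<bar>z\<bar>\<rfloor> - int t"] pos_mod_sign[OF M, of "\<lfloor>\<bar>z\<bar>\<rfloor> - int t"]
    unfolding q_def by linarith+
  have q_ge: "q z \<ge> - 1" for z
  proof -
    have "0 \<le> \<lfloor>\<bar>z\<bar>\<rfloor>" by simp
    then have "int M * (- 1) < int M * (q z + 1)" using q(2)[of z] t unfolding distrib_left by linarith
    then show ?thesis using M by (simp only: mult_less_cancel_left_pos)
  qed
  have zero: "\<bar>z\<bar> \<le> M" if "lab M t z = 0" for z
  proof (cases "z = 0")
    case False
    then have "q z = - 1" using that by (auto simp: lab_def q_def split: if_splits)
    then have "\<lfloor>\<bar>z\<bar>\<rfloor> < int t" using q(2)[of z] by simp
    then show ?thesis using t by (simp add: floor_less_iff)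
  qed simp
  show ?thesis
  proof (cases "lab M t x = 0")
    case True
    then show ?thesis using zero[of x] zero[of y] eq by simp
  next
    case False
    have "x > 0 \<and> y > 0 \<or> x < 0 \<and> y < 0"
      using False eq q_ge[of x] q_ge[of y] by (auto simp: lab_def q_def[symmetric] split: if_splits)
    then have sg: "\<bar>x - y\<bar> = \<bar>\<bar>x\<bar> - \<bar>y\<bar>\<bar>" and "q x = q y"
      using eq by (auto simp: lab_def q_def[symmetric])
    then have "\<lfloor>\<bar>x\<bar>\<rfloor> < \<lfloor>\<bar>y\<bar>\<rfloor> + int M" "\<lfloor>\<bar>y\<bar>\<rfloor> < \<lfloor>\<bar>x\<bar>\<rfloor> + int M"
      using q[of x] q[of y] by auto
    then have "real_of_int \<lfloor>\<bar>x\<bar>\<rfloor> + 1 \<le> \<lfloor>\<bar>y\<bar>\<rfloor> + M" "real_of_int \<lfloor>\<bar>y\<bar>\<rfloor> + 1 \<le> \<lfloor>\<bar>x\<bar>\<rfloor> + M"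
      by linarith+
    then have "\<bar>\<bar>x\<bar> - \<bar>y\<bar>\<bar> \<le> M"
      using floor_correct[of "\<bar>x\<bar>"] floor_correct[of "\<bar>y\<bar>"] by linarith
    then show ?thesis using sg by simp
  qed
qed

text \<open>Labels change only at centres. For points of the same sign this is a division argument,
  and reflection reduces negative points to positive ones; for points on different sides of 0 a
  centre \<open>t\<close> or \<open>-t\<close> lies between them.\<close>

lemma lab_separation:
  fixes x y :: real
  assumes t: "t < M" and ne: "lab M t x \<noteq> lab M t y"
  shows "\<exists>n::int. \<bar>n\<bar> mod int M = int t \<and> min x y \<le> n \<and> n \<le> max x y"
proof -
  have pos: "\<exists>n::int. \<bar>n\<bar> mod int M = int t \<and> x \<le> n \<and> n \<le> y"
    if x: "0 < x" and xy: "x < y" and ne: "lab M t x \<noteq> lab M t y" for x y :: real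
  proof -
    define q where "q z = (\<lfloor>z\<rfloor> - int t) div int M" for z :: real
    have M: "int M > 0" using t by simp
    have "q x \<noteq> q y" using ne x xy by (simp add: lab_def q_def)
    moreover have "q x \<le> q y" unfolding q_def using M xy
      by (intro zdiv_mono1) (auto intro: floor_mono)
    ultimately have lt: "q x < q y" by simp
    have "0 \<le> \<lfloor>x\<rfloor>" using x by simp
    then have "int M * (- 1) \<le> \<lfloor>x\<rfloor> - int t" using t by linarith
    then have "(int M * (- 1)) div int M \<le> q x" unfolding q_def using M by (rule zdiv_mono1)
    moreover have "(int M * (- 1)) div int M = - 1"
      by (rule nonzero_mult_div_cancel_left) (use M in simp)
    ultimately have "- 1 \<le> q x" by simp
    then have qy: "q y \<ge> 0" using lt by simp
    \<comment> \<open>The left end of the cell of \<open>y\<close>; it lies above \<open>x\<close>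
      because the cell of \<open>x\<close> has a smaller index.\<close>
    define n where "n = int t + int M * q y"
    have "n \<ge> 0" using qy by (simp add: n_def)
    then have "\<bar>n\<bar> mod int M = int t" using t by (simp add: n_def)
    moreover have "n \<le> \<lfloor>y\<rfloor>"
      using mult_div_mod_eq[of "int M" "\<lfloor>y\<rfloor> - int t"] pos_mod_sign[OF M, of "\<lfloor>y\<rfloor> - int t"]
      unfolding n_def q_def by linarith
    then have "n \<le> y" by linarith
    moreover have "\<lfloor>x\<rfloor> < n"
    proof -
      have "\<lfloor>x\<rfloor> - int t < int M * q x + int M"
        using mult_div_mod_eq[of "int M" "\<lfloor>x\<rfloor> - int t"] pos_mod_bound[OF M, of "\<lfloor>x\<rfloor> - int t"]
        unfolding q_def by linarith
      also have "\<dots> = int M * (q x + 1)" by (simp add: algebra_simps)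
      also have "\<dots> \<le> int M * q y" using lt M by (intro mult_left_mono) auto
      finally show ?thesis by (simp add: n_def)
    qed
    then have "x \<le> n" by linarith
    ultimately show ?thesis by blast
  qed
  have main: "\<exists>n::int. \<bar>n\<bar> mod int M = int t \<and> x \<le> n \<and> n \<le> y"
    if xy: "x < y" and ne: "lab M t x \<noteq> lab M t y" for x y :: real
  proof -
    consider "0 < x" | "y < 0" | "x \<le> 0" "0 \<le> y" by linarith
    then show ?thesis
    proof cases
      case 1
      then show ?thesis using pos xy ne by blast
    next
      case 2
      then obtain n where "\<bar>n\<bar> mod int M = int t" "- y \<le> n" "n \<le> - x"
        using pos[of "- y" "- x"] xy ne by (auto simp: lab_minus)
      then show ?thesis by (intro exI[of _ "- n"]) auto
    next
      case 3
      show ?thesis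
      proof (cases "lab M t y = 0")
        case True
        then have "real t \<le> \<bar>x\<bar>" using ne lab_nonzero[OF t, of x] by simp
        then show ?thesis using 3 t by (intro exI[of _ "- int t"]) auto
      next
        case False
        then have "real t \<le> \<bar>y\<bar>" using lab_nonzero[OF t, of y] by simp
        then show ?thesis using 3 t by (intro exI[of _ "int t"]) auto
      qed
    qed
  qed
  have "x \<noteq> y" using ne by auto
  then show ?thesis using main[of x y] main[of y x] ne
    by (cases "x < y") (auto simp: min_def max_def)
qed

lemma bump_near_center:
  fixes n :: int
  assumes "\<bar>n\<bar> mod int M = int t"
  shows "1 - bump M t x \<le> 2 * \<bar>x - of_int n\<bar>"
proof -
  define c where "c = real_of_int n"
  have c: "real_of_int \<bar>n\<bar> = \<bar>c\<bar>" by (simp add: c_def)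
  have d: "\<bar>\<bar>x\<bar> - \<bar>c\<bar>\<bar> \<le> \<bar>x - c\<bar>" by simp
  show ?thesis
  proof (cases "round \<bar>x\<bar> = \<bar>n\<bar>")
    case True
    then have "bump M t x = 1 - 2 * \<bar>\<bar>x\<bar> - \<bar>c\<bar>\<bar>" using assms c by (simp add: bump_def)
    then show ?thesis using d by (simp add: c_def)
  next
    case False
    then have "1 \<le> \<bar>round \<bar>x\<bar> - \<bar>n\<bar>\<bar>" by linarith
    then have "1 \<le> real_of_int \<bar>round \<bar>x\<bar> - \<bar>n\<bar>\<bar>" by linarith
    then have "1 \<le> \<bar>real_of_int (round \<bar>x\<bar>) - \<bar>c\<bar>\<bar>" by (simp add: c_def)
    then have "1 / 2 \<le> \<bar>\<bar>x\<bar> - \<bar>c\<bar>\<bar>" using round_dist[of "\<bar>x\<bar>"] by linarith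
    then have "1 / 2 \<le> \<bar>x - c\<bar>" using d by linarith
    then show ?thesis using bump_bounds(1)[of M t x] by (simp add: c_def)
  qed
qed

text \<open>An upper bound for the squared cutoff at \<open>x\<close> (through one coordinate),
  charged only when \<open>x\<close> and \<open>y\<close> fall into different cells.\<close>

definition crossing :: "nat \<Rightarrow> nat \<Rightarrow> real \<Rightarrow> real \<Rightarrow> real" where
  "crossing M t x y = (if lab M t x \<noteq> lab M t y then (1 - bump M t x)\<^sup>2 else 0)"

lemma crossing_nonneg: "0 \<le> crossing M t x y"
  by (simp add: crossing_def)

text \<open>With \<open>D\<close> the distance, at most \<open>D + 1\<close> shifts place a centre
  between the points, and each costs at most \<open>(min 1 (2 D))^2\<close> because the bump equals
  1 at a centre. The product is quadratic in both regimes, \<open>D \<le> 1\<close> and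
  \<open>D > 1\<close>.\<close>

lemma sum_crossing:
  fixes x y :: real
  shows "(\<Sum>t<M. crossing M t x y) \<le> 8 * (x - y)\<^sup>2"
proof -
  define D :: real where "D = \<bar>x - y\<bar>"
  define T where "T = {t. t < M \<and> lab M t x \<noteq> lab M t y}"
  define Z where "Z = {\<lceil>min x y\<rceil>..\<lfloor>max x y\<rfloor>}"
  have "T \<subseteq> (\<lambda>n. nat (\<bar>n\<bar> mod int M)) ` Z"
  proof
    fix t assume "t \<in> T"
    then obtain n :: int where "\<bar>n\<bar> mod int M = int t" "min x y \<le> n" "n \<le> max x y"
      using lab_separation[of t M x y] by (auto simp: T_def)
    then show "t \<in> (\<lambda>n. nat (\<bar>n\<bar> mod int M)) ` Z"
      by (intro image_eqI[of _ _ n]) (auto simp: Z_def ceiling_le_iff le_floor_iff)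
  qed
  then have "card T \<le> card Z" by (rule surj_card_le[rotated]) (simp add: Z_def)
  also have "real (card Z) \<le> D + 1"
  proof (cases "\<lceil>min x y\<rceil> \<le> \<lfloor>max x y\<rfloor> + 1")
    case True
    then have "real (card Z) = \<lfloor>max x y\<rfloor> + 1 - \<lceil>min x y\<rceil>" by (simp add: Z_def)
    also have "\<dots> \<le> max x y + 1 - min x y" by linarith
    finally show ?thesis by (simp add: D_def max_def min_def split: if_splits)
  qed (simp add: Z_def D_def)
  finally have card: "real (card T) \<le> D + 1" by simp
  have "(1 - bump M t x)\<^sup>2 \<le> (min 1 (2 * D))\<^sup>2" if t: "t \<in> T" for t
  proof (rule power_mono)
    obtain n :: int where "\<bar>n\<bar> mod int M = int t" "min x y \<le> n" "n \<le> max x y"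
      using lab_separation[of t M x y] t by (auto simp: T_def)
    then have "1 - bump M t x \<le> 2 * D"
      using bump_near_center[of n M t x] by (auto simp: D_def min_def max_def abs_if split: if_splits)
    then show "1 - bump M t x \<le> min 1 (2 * D)" using bump_bounds(1)[of M t x] by simp
  qed (use bump_bounds(2)[of M t x] in simp)
  then have "(\<Sum>t\<in>T. (1 - bump M t x)\<^sup>2) \<le> card T * (min 1 (2 * D))\<^sup>2"
    by (rule sum_bounded_above)
  also have "\<dots> \<le> (D + 1) * (min 1 (2 * D))\<^sup>2" using card by (intro mult_right_mono) auto
  also have "\<dots> \<le> 8 * D\<^sup>2"
  proof (cases "D \<le> 1")
    case True
    have "(D + 1) * (min 1 (2 * D))\<^sup>2 \<le> 2 * (2 * D)\<^sup>2"
      using True by (intro mult_mono power_mono) (auto simp: D_def)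
    then show ?thesis by (simp add: power_mult_distrib)
  next
    case False
    then have "D \<le> D\<^sup>2" using mult_left_mono[of 1 D D] by (simp add: power2_eq_square)
    moreover have "min 1 (2 * D) = 1" using False by simp
    ultimately show ?thesis using False by (simp del: min_def)
  qed
  also have "(\<Sum>t\<in>T. (1 - bump M t x)\<^sup>2) = (\<Sum>t<M. crossing M t x y)"
    by (intro sum.mono_neutral_cong_left) (auto simp: T_def crossing_def)
  finally show ?thesis by (simp add: D_def)
qed

section \<open>Localization of the spectral embedding\<close>

lemma L2_set_square: "(L2_set g A)\<^sup>2 = (\<Sum>i\<in>A. (g i)\<^sup>2)"
  by (simp add: L2_set_def sum_nonneg)

lemma L2_set_triangle_diff: "\<bar>L2_set a A - L2_set b A\<bar> \<le> L2_set (\<lambda>i. a i - b i) A"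
proof -
  have "L2_set a A \<le> L2_set (\<lambda>i. a i - b i) A + L2_set b A"
    using L2_set_triangle_ineq[of "\<lambda>i. a i - b i" b A] by simp
  moreover have "L2_set b A \<le> L2_set (\<lambda>i. b i - a i) A + L2_set a A"
    using L2_set_triangle_ineq[of "\<lambda>i. b i - a i" a A] by simp
  moreover have "L2_set (\<lambda>i. b i - a i) A = L2_set (\<lambda>i. a i - b i) A"
    by (simp add: L2_set_def power2_commute)
  ultimately show ?thesis by (simp add: abs_le_iff)
qed

lemma sum_at_most_one:
  fixes c :: real
  assumes "finite A" "\<And>i j. i \<in> A \<Longrightarrow> j \<in> A \<Longrightarrow> P i \<Longrightarrow> P j \<Longrightarrow> i = j" "c \<ge> 0"
  shows "(\<Sum>i\<in>A. if P i then c else 0) \<le> c"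
proof (cases "\<exists>i\<in>A. P i")
  case True
  then obtain i where i: "i \<in> A" "P i" by blast
  have "(\<Sum>j\<in>A. if P j then c else 0) = (\<Sum>j\<in>A. if j = i then c else 0)"
    by (rule sum.cong) (use i assms(2) in auto)
  then show ?thesis using i assms(1) by simp
next
  case False
  then have "(\<Sum>i\<in>A. if P i then c else 0) = 0" by (intro sum.neutral) auto
  then show ?thesis using assms(3) by simp
qed

text \<open>Isotropy is stated as a quadratic form on unit vectors \<open>c\<close>, the form in
  which \<open>cell_mass\<close> tests it with a direction of the embedding.\<close>

locale isotropic_embedding = signed_graph +
  fixes f :: "nat \<Rightarrow> nat \<Rightarrow> real" and k :: nat
  assumes k_pos: "k > 0"
    and isotropic: "(\<Sum>i<k. (c i)\<^sup>2) = 1 \<Longrightarrow> (\<Sum>u<N. degree u * (\<Sum>i<k. c i * f i u)\<^sup>2) = 1"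
    and sqnorm_f: "i < k \<Longrightarrow> sqnorm (f i) = 1"
begin

text \<open>With \<open>M = 8 k\<^sup>2\<close> shifts, \<open>k\<close> coordinates lose on average a fraction \<open>k / M\<close> of the mass \<open>k\<close>, that is
  \<open>1 / 8\<close>. The cells have side at most \<open>2 M \<eta> = 2 / (5 k)\<close>, hence squared diameter at most
  \<open>4 / (25 k) \<le> 1 / (5 k)\<close>.\<close>

definition M :: nat where "M = 8 * k\<^sup>2"

definition \<eta> :: real where "\<eta> = 1 / (5 * k * M)"

definition radius :: "nat \<Rightarrow> real" where
  "radius u = L2_set (\<lambda>i. f i u) {..<k}"

definition dir :: "nat \<Rightarrow> nat \<Rightarrow> real" where
  "dir u i = f i u / radius u"

definition pos :: "nat \<Rightarrow> nat \<Rightarrow> real" where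
  "pos u i = dir u i / \<eta>"

text \<open>Equal to 1 where no coordinate meets a bump, and 0 where some coordinate sits at a
  centre. The Euclidean norm lets the coordinates' squared differences simply add up.\<close>

definition cutoff :: "nat \<Rightarrow> nat \<Rightarrow> real" where
  "cutoff t u = max 0 (1 - L2_set (\<lambda>i. bump M t (pos u i)) {..<k})"

text \<open>Padding by 0 beyond \<open>k\<close> makes equality of functions the same as equality of
  the first \<open>k\<close> labels.\<close>

definition label :: "nat \<Rightarrow> nat \<Rightarrow> nat \<Rightarrow> int" where
  "label t u i = (if i < k then lab M t (pos u i) else 0)"

text \<open>A cell of directions modulo negation, so a vertex and its sign-switched copy have the
  same key.\<close>

definition key :: "nat \<Rightarrow> nat \<Rightarrow> (nat \<Rightarrow> int) set" where
  "key t u = {label t u, \<lambda>i. - label t u i}"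

definition dist2 :: "nat \<Rightarrow> nat \<Rightarrow> real" where
  "dist2 u v = (\<Sum>i<k. (f i u - sign u v * f i v)\<^sup>2)"

lemma M_pos: "M > 0" using k_pos by (simp add: M_def)

lemma \<eta>_pos: "\<eta> > 0" using k_pos M_pos by (simp add: \<eta>_def)

lemma radius_nonneg: "radius u \<ge> 0" by (simp add: radius_def)

lemma radius_square: "(radius u)\<^sup>2 = (\<Sum>i<k. (f i u)\<^sup>2)"
  by (simp add: radius_def L2_set_square)

lemma radius_dir: "i < k \<Longrightarrow> radius u * dir u i = f i u"
  using L2_set_eq_0_iff[of "{..<k}" "\<lambda>i. f i u"] by (auto simp: dir_def radius_def)

lemma sum_dir_square: "radius u \<noteq> 0 \<Longrightarrow> (\<Sum>i<k. (dir u i)\<^sup>2) = 1"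
  by (simp add: dir_def power_divide radius_square[symmetric] flip: sum_divide_distrib)

lemma L2_dir_le_1: "L2_set (dir u) {..<k} \<le> 1"
  by (cases "radius u = 0") (simp_all add: L2_set_def sum_dir_square, simp add: dir_def)

text \<open>By the triangle inequality, replacing \<open>radius v\<close> by \<open>radius u\<close>
  costs at most the distance of the vectors once more: a factor 2, squared to 4.\<close>

lemma dir_diff:
  assumes e: "e = 1 \<or> e = - 1"
  shows "(radius u)\<^sup>2 * (\<Sum>i<k. (dir u i - e * dir v i)\<^sup>2) \<le> 4 * (\<Sum>i<k. (f i u - e * f i v)\<^sup>2)"
proof -
  define \<delta> where "\<delta> = L2_set (\<lambda>i. f i u - e * f i v) {..<k}"
  have abs_e: "\<bar>e\<bar> = 1" using e by auto
  have "L2_set (\<lambda>i. e * f i v) {..<k} = radius v"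
    using e by (auto simp: radius_def L2_set_def)
  then have rr: "\<bar>radius v - radius u\<bar> \<le> \<delta>"
    using L2_set_triangle_diff[of "\<lambda>i. f i u" "{..<k}" "\<lambda>i. e * f i v"]
    by (simp add: radius_def \<delta>_def abs_minus_commute)
  have "radius u * L2_set (\<lambda>i. dir u i - e * dir v i) {..<k}
      = L2_set (\<lambda>i. radius u * (dir u i - e * dir v i)) {..<k}"
    by (rule L2_set_right_distrib) (rule radius_nonneg)
  also have "\<dots> = L2_set (\<lambda>i. (f i u - e * f i v) + (e * (radius v - radius u)) * dir v i) {..<k}"
  proof (rule L2_set_cong[OF refl])
    fix i assume "i \<in> {..<k}"
    then have "radius u * dir u i = f i u" "radius v * dir v i = f i v" by (auto simp: radius_dir)
    then show "radius u * (dir u i - e * dir v i)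
        = (f i u - e * f i v) + (e * (radius v - radius u)) * dir v i"
      by (simp add: algebra_simps)
  qed
  also have "\<dots> \<le> \<delta> + L2_set (\<lambda>i. (e * (radius v - radius u)) * dir v i) {..<k}"
    unfolding \<delta>_def by (rule L2_set_triangle_ineq)
  also have "L2_set (\<lambda>i. (e * (radius v - radius u)) * dir v i) {..<k}
      = \<bar>radius v - radius u\<bar> * L2_set (dir v) {..<k}"
    using abs_e by (simp add: L2_set_right_distrib) (simp add: L2_set_def power_mult_distrib
        power2_abs[of e, symmetric])
  also have "\<dots> \<le> \<delta> * 1"
    using rr L2_dir_le_1 by (intro mult_mono) auto
  finally have "radius u * L2_set (\<lambda>i. dir u i - e * dir v i) {..<k} \<le> 2 * \<delta>" by simp
  then have "(radius u * L2_set (\<lambda>i. dir u i - e * dir v i) {..<k})\<^sup>2 \<le> (2 * \<delta>)\<^sup>2"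
    by (rule power_mono) (simp add: radius_nonneg)
  then show ?thesis by (simp add: power_mult_distrib L2_set_square \<delta>_def)
qed

lemma pos_diff:
  assumes e: "e = 1 \<or> e = - 1"
  shows "(radius u)\<^sup>2 * (\<Sum>i<k. (pos u i - e * pos v i)\<^sup>2) \<le> 4 / \<eta>\<^sup>2 * (\<Sum>i<k. (f i u - e * f i v)\<^sup>2)"
proof -
  have "(\<Sum>i<k. (pos u i - e * pos v i)\<^sup>2) = (\<Sum>i<k. (dir u i - e * dir v i)\<^sup>2) / \<eta>\<^sup>2"
    unfolding sum_divide_distrib
    by (intro sum.cong refl) (simp add: pos_def power_divide[symmetric] diff_divide_distrib)
  then show ?thesis using divide_right_mono[OF dir_diff[OF e, of u v], of "\<eta>\<^sup>2"] by simp
qed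

section \<open>Cutoffs, cells and the cost of an edge\<close>

lemma cutoff_bounds: "0 \<le> cutoff t u" "cutoff t u \<le> 1"
  by (auto simp: cutoff_def)

lemma bump_sign: "e = 1 \<or> e = - 1 \<Longrightarrow> bump M t (e * y) = bump M t y"
  by auto

text \<open>The sign \<open>e\<close> may be inserted on the right because bumps are even; the
  positions are then close exactly when the edge is short in the signed sense.\<close>

lemma cutoff_diff:
  assumes e: "e = 1 \<or> e = - 1"
  shows "(cutoff t u - cutoff t v)\<^sup>2 \<le> (\<Sum>i<k. (bump M t (pos u i) - bump M t (e * pos v i))\<^sup>2)"
proof -
  let ?a = "\<lambda>i. bump M t (pos u i)" and ?b = "\<lambda>i. bump M t (pos v i)"
  have "\<bar>cutoff t u - cutoff t v\<bar> \<le> \<bar>L2_set ?a {..<k} - L2_set ?b {..<k}\<bar>"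
    by (auto simp: cutoff_def max_def)
  also have "\<dots> \<le> L2_set (\<lambda>i. ?a i - ?b i) {..<k}" by (rule L2_set_triangle_diff)
  finally have "\<bar>cutoff t u - cutoff t v\<bar>\<^sup>2 \<le> (L2_set (\<lambda>i. ?a i - ?b i) {..<k})\<^sup>2"
    by (rule power_mono) simp
  then show ?thesis by (simp add: L2_set_square bump_sign[OF e])
qed

lemma cutoff_le: "i < k \<Longrightarrow> cutoff t u \<le> 1 - bump M t (pos u i)"
  using member_le_L2_set[of "{..<k}" i "\<lambda>i. bump M t (pos u i)"] bump_bounds(2)[of M t "pos u i"]
  by (simp add: cutoff_def)

lemma key_neq:
  assumes "key t u \<noteq> key t v" "e = 1 \<or> e = - 1"
  shows "\<exists>i<k. lab M t (pos u i) \<noteq> lab M t (e * pos v i)"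
proof (rule ccontr)
  assume "\<not> ?thesis"
  then have eq: "\<And>i. i < k \<Longrightarrow> lab M t (pos u i) = lab M t (e * pos v i)" by blast
  have "label t u = label t v \<or> label t u = (\<lambda>i. - label t v i)"
    using assms(2) eq by (auto simp: label_def lab_minus fun_eq_iff)
  then have "key t u = key t v" by (auto simp: key_def)
  then show False using assms(1) by simp
qed

lemma key_eq:
  assumes "key t u = key t v"
  obtains e :: real where "e = 1 \<or> e = - 1" "\<And>i. i < k \<Longrightarrow> lab M t (pos u i) = lab M t (e * pos v i)"
proof -
  have "label t u \<in> key t v" using assms by (auto simp: key_def)
  then consider "label t u = label t v" | "label t u = (\<lambda>i. - label t v i)" by (auto simp: key_def)
  then show ?thesis
  proof cases
    case 1
    then have "lab M t (pos u i) = lab M t (1 * pos v i)" if "i < k" for i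
      using that by (metis label_def mult_1)
    then show ?thesis using that[of 1] by blast
  next
    case 2
    have "lab M t (pos u i) = lab M t (- 1 * pos v i)" if "i < k" for i
      using fun_cong[OF 2, of i] that by (simp add: label_def lab_minus)
    then show ?thesis using that[of "- 1"] by blast
  qed
qed

text \<open>Different keys mean that for either sign some coordinate changes its label, and the bump
  of that coordinate controls the cutoff.\<close>

lemma cutoff_crossing:
  assumes "key t u \<noteq> key t v" "e = 1 \<or> e = - 1"
  shows "(cutoff t u)\<^sup>2 \<le> (\<Sum>i<k. crossing M t (pos u i) (e * pos v i))"
proof -
  obtain i where i: "i < k" "lab M t (pos u i) \<noteq> lab M t (e * pos v i)"
    using key_neq[OF assms] by blast
  have "(cutoff t u)\<^sup>2 \<le> (1 - bump M t (pos u i))\<^sup>2"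
    by (rule power_mono[OF cutoff_le[OF i(1)] cutoff_bounds(1)])
  also have "\<dots> = crossing M t (pos u i) (e * pos v i)" using i by (simp add: crossing_def)
  also have "\<dots> \<le> (\<Sum>i<k. crossing M t (pos u i) (e * pos v i))"
    by (rule member_le_sum) (use i crossing_nonneg in auto)
  finally show ?thesis .
qed

text \<open>The first two terms pay for an edge within one group (product rule), the last two for an
  edge between different cells, one for each end.\<close>

definition edge_cost :: "nat \<Rightarrow> nat \<Rightarrow> nat \<Rightarrow> real" where
  "edge_cost t u v = 2 * dist2 u v
    + 2 * ((radius u)\<^sup>2 * (\<Sum>i<k. (bump M t (pos u i) - bump M t (sign u v * pos v i))\<^sup>2))
    + (radius u)\<^sup>2 * (\<Sum>i<k. crossing M t (pos u i) (sign u v * pos v i))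
    + (radius v)\<^sup>2 * (\<Sum>i<k. crossing M t (pos v i) (sign u v * pos u i))"

lemma dist2_nonneg: "dist2 u v \<ge> 0"
  by (simp add: dist2_def sum_nonneg)

lemma dist2_commute: "dist2 u v = dist2 v u"
proof -
  have "(f i u - sign u v * f i v)\<^sup>2 = (f i v - sign u v * f i u)\<^sup>2" for i
    using sign_cases[of u v] by (auto simp: power2_eq_square algebra_simps)
  then show ?thesis by (simp add: dist2_def sign_commute)
qed

text \<open>The constant is 128 = (2 + 1 + 1) * 8 * 4: the three sums enter with coefficients 2, 1,
  1, averaging over shifts gives 8, and \<open>pos_diff\<close> gives
  \<open>4 / \<eta>\<^sup>2\<close>.\<close>

lemma sum_edge_cost: "(\<Sum>t<M. edge_cost t u v) \<le> (2 * M + 128 / \<eta>\<^sup>2) * dist2 u v"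
proof -
  let ?e = "sign u v"
  have swap: "(\<Sum>t<M. c * (\<Sum>i<k. h t i)) \<le> c * (8 * (\<Sum>i<k. b i))"
    if "\<And>i. (\<Sum>t<M. h t i) \<le> 8 * b i" "c \<ge> 0" for c :: real and h :: "nat \<Rightarrow> nat \<Rightarrow> real" and b
  proof -
    have "(\<Sum>t<M. c * (\<Sum>i<k. h t i)) = c * (\<Sum>i<k. \<Sum>t<M. h t i)"
      by (subst sum.swap) (simp add: sum_distrib_left)
    also have "\<dots> \<le> c * (\<Sum>i<k. 8 * b i)" using that by (intro mult_left_mono sum_mono) auto
    finally show ?thesis by (simp add: sum_distrib_left)
  qed
  have 1: "(\<Sum>t<M. (radius u)\<^sup>2 * (\<Sum>i<k. (bump M t (pos u i) - bump M t (?e * pos v i))\<^sup>2))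
      \<le> (radius u)\<^sup>2 * (8 * (\<Sum>i<k. (pos u i - ?e * pos v i)\<^sup>2))"
    by (rule swap[OF sum_bump_diff]) simp
  have 2: "(\<Sum>t<M. (radius u)\<^sup>2 * (\<Sum>i<k. crossing M t (pos u i) (?e * pos v i)))
      \<le> (radius u)\<^sup>2 * (8 * (\<Sum>i<k. (pos u i - ?e * pos v i)\<^sup>2))"
    by (rule swap[OF sum_crossing]) simp
  have 3: "(\<Sum>t<M. (radius v)\<^sup>2 * (\<Sum>i<k. crossing M t (pos v i) (?e * pos u i)))
      \<le> (radius v)\<^sup>2 * (8 * (\<Sum>i<k. (pos v i - ?e * pos u i)\<^sup>2))"
    by (rule swap[OF sum_crossing]) simp
  have 4: "(radius u)\<^sup>2 * (\<Sum>i<k. (pos u i - ?e * pos v i)\<^sup>2) \<le> 4 / \<eta>\<^sup>2 * dist2 u v"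
    unfolding dist2_def by (rule pos_diff[OF sign_cases])
  have 5: "(radius v)\<^sup>2 * (\<Sum>i<k. (pos v i - ?e * pos u i)\<^sup>2) \<le> 4 / \<eta>\<^sup>2 * dist2 u v"
    unfolding dist2_commute[of u v] unfolding dist2_def sign_commute[of u v]
    by (rule pos_diff[OF sign_cases])
  have "(\<Sum>t<M. edge_cost t u v) = 2 * M * dist2 u v
      + 2 * (\<Sum>t<M. (radius u)\<^sup>2 * (\<Sum>i<k. (bump M t (pos u i) - bump M t (?e * pos v i))\<^sup>2))
      + (\<Sum>t<M. (radius u)\<^sup>2 * (\<Sum>i<k. crossing M t (pos u i) (?e * pos v i)))
      + (\<Sum>t<M. (radius v)\<^sup>2 * (\<Sum>i<k. crossing M t (pos v i) (?e * pos u i)))"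
    unfolding edge_cost_def sum.distrib by (simp flip: sum_distrib_left)
  also have "\<dots> \<le> 2 * M * dist2 u v + 32 * (4 / \<eta>\<^sup>2 * dist2 u v)" using 1 2 3 4 5 by linarith
  finally show ?thesis by (simp add: algebra_simps)
qed

definition piece :: "nat \<Rightarrow> (nat \<Rightarrow> int) set set \<Rightarrow> nat \<Rightarrow> nat \<Rightarrow> real" where
  "piece t S i u = (if key t u \<in> S then cutoff t u * f i u else 0)"

text \<open>If both ends lie in the same groups, at most one group contributes and the product rule
  applies. Otherwise no group contains both ends, so each end pays only its own squared cutoff,
  which \<open>cutoff_crossing\<close> bounds. Disjointness keeps the cost free of a factor
  \<open>n\<close>.\<close>

lemma piece_cost:
  fixes n :: nat
  assumes disj: "\<And>i j. i < n \<Longrightarrow> j < n \<Longrightarrow> i \<noteq> j \<Longrightarrow> S i \<inter> S j = {}"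
  shows "(\<Sum>j<n. \<Sum>i<k. (piece t (S j) i u - sign u v * piece t (S j) i v)\<^sup>2) \<le> edge_cost t u v"
proof -
  let ?e = "sign u v"
  define A where "A = 2 * dist2 u v
    + 2 * ((radius u)\<^sup>2 * (\<Sum>i<k. (bump M t (pos u i) - bump M t (?e * pos v i))\<^sup>2))"
  define B where "B = (radius u)\<^sup>2 * (\<Sum>i<k. crossing M t (pos u i) (?e * pos v i))
    + (radius v)\<^sup>2 * (\<Sum>i<k. crossing M t (pos v i) (?e * pos u i))"
  have cost: "edge_cost t u v = A + B" by (simp add: edge_cost_def A_def B_def)
  have A: "A \<ge> 0" unfolding A_def
    by (intro add_nonneg_nonneg mult_nonneg_nonneg sum_nonneg dist2_nonneg) auto
  have B: "B \<ge> 0" unfolding B_def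
    by (intro add_nonneg_nonneg mult_nonneg_nonneg sum_nonneg crossing_nonneg) auto
  have one: "i = j" if "i \<in> {..<n}" "j \<in> {..<n}" "x \<in> S i" "x \<in> S j" for i j x
    using disj[of i j] that by (cases "i = j") auto
  show ?thesis
  proof (cases "\<forall>j<n. key t u \<in> S j \<longleftrightarrow> key t v \<in> S j")
    case True
    have "(\<Sum>i<k. (cutoff t u * f i u - ?e * (cutoff t v * f i v))\<^sup>2) \<le> A"
    proof -
      have "(cutoff t u * f i u - ?e * (cutoff t v * f i v))\<^sup>2
          \<le> 2 * (f i u - ?e * f i v)\<^sup>2 + 2 * ((cutoff t u - cutoff t v)\<^sup>2 * (f i u)\<^sup>2)" for i
      proof -
        have sq: "(a + b)\<^sup>2 \<le> 2 * a\<^sup>2 + 2 * b\<^sup>2" for a b :: real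
          using zero_le_power2[of "a - b"] by (simp add: power2_eq_square algebra_simps)
        \<comment> \<open>The radius at \<open>u\<close> multiplies the cutoff difference, which
          matches the weighting in \<open>pos_diff\<close>.\<close>
        have "cutoff t u * f i u - ?e * (cutoff t v * f i v)
            = cutoff t v * (f i u - ?e * f i v) + (cutoff t u - cutoff t v) * f i u"
          by (simp add: algebra_simps)
        then have "(cutoff t u * f i u - ?e * (cutoff t v * f i v))\<^sup>2
            \<le> 2 * (cutoff t v * (f i u - ?e * f i v))\<^sup>2 + 2 * ((cutoff t u - cutoff t v) * f i u)\<^sup>2"
          using sq by simp
        moreover have "(cutoff t v)\<^sup>2 * (f i u - ?e * f i v)\<^sup>2 \<le> 1 * (f i u - ?e * f i v)\<^sup>2"
          using cutoff_bounds[of t v] by (intro mult_right_mono power_le_one) auto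
        ultimately show ?thesis by (simp add: power_mult_distrib)
      qed
      then have "(\<Sum>i<k. (cutoff t u * f i u - ?e * (cutoff t v * f i v))\<^sup>2)
          \<le> (\<Sum>i<k. 2 * (f i u - ?e * f i v)\<^sup>2 + 2 * ((cutoff t u - cutoff t v)\<^sup>2 * (f i u)\<^sup>2))"
        by (intro sum_mono)
      also have "\<dots> = 2 * dist2 u v + 2 * ((cutoff t u - cutoff t v)\<^sup>2 * (radius u)\<^sup>2)"
        by (simp add: sum.distrib dist2_def radius_square flip: sum_distrib_left)
      also have "\<dots> \<le> A" unfolding A_def
        using mult_right_mono[OF cutoff_diff[OF sign_cases[of u v], of t u v], of "(radius u)\<^sup>2"]
        by (simp add: mult.commute)
      finally show ?thesis .
    qed
    then have "(\<Sum>i<k. (piece t (S j) i u - ?e * piece t (S j) i v)\<^sup>2)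
        \<le> (if key t u \<in> S j then A else 0)" if "j < n" for j
      using True that by (simp add: piece_def)
    then have "(\<Sum>j<n. \<Sum>i<k. (piece t (S j) i u - ?e * piece t (S j) i v)\<^sup>2)
        \<le> (\<Sum>j<n. if key t u \<in> S j then A else 0)" by (intro sum_mono) auto
    also have "\<dots> \<le> A" by (rule sum_at_most_one) (auto intro: one A)
    finally show ?thesis using B cost by simp
  next
    case False
    then have ne: "key t u \<noteq> key t v" by auto
    have excl: "\<not> (key t u \<in> S j \<and> key t v \<in> S j)" if "j < n" for j
    proof
      assume both: "key t u \<in> S j \<and> key t v \<in> S j"
      have "key t u \<in> S i \<longleftrightarrow> i = j" "key t v \<in> S i \<longleftrightarrow> i = j" if "i < n" for i
        using both one[of i j] that \<open>j < n\<close> by auto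
      then show False using False by auto
    qed
    define Bu Bv where "Bu = (cutoff t u)\<^sup>2 * (radius u)\<^sup>2" and "Bv = (cutoff t v)\<^sup>2 * (radius v)\<^sup>2"
    have e2: "(?e * z)\<^sup>2 = z\<^sup>2" for z by (simp add: power_mult_distrib)
    have "(\<Sum>i<k. (piece t (S j) i u - ?e * piece t (S j) i v)\<^sup>2)
        = (if key t u \<in> S j then Bu else 0) + (if key t v \<in> S j then Bv else 0)" if "j < n" for j
      using excl[OF that]
      by (auto simp: piece_def Bu_def Bv_def radius_square e2 power_mult_distrib sum_distrib_left)
    then have "(\<Sum>j<n. \<Sum>i<k. (piece t (S j) i u - ?e * piece t (S j) i v)\<^sup>2)
        = (\<Sum>j<n. if key t u \<in> S j then Bu else 0) + (\<Sum>j<n. if key t v \<in> S j then Bv else 0)"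
      by (simp add: sum.distrib)
    also have "\<dots> \<le> Bu + Bv"
      by (intro add_mono sum_at_most_one) (use one in \<open>auto simp: Bu_def Bv_def\<close>)
    also have "\<dots> \<le> B"
      using mult_left_mono[OF cutoff_crossing[OF ne sign_cases[of u v]], of "(radius u)\<^sup>2"]
        mult_left_mono[OF cutoff_crossing[OF ne[symmetric] sign_cases[of u v]], of "(radius v)\<^sup>2"]
      by (simp add: Bu_def Bv_def B_def mult.commute)
    finally show ?thesis using A cost by simp
  qed
qed

definition total_cost :: "nat \<Rightarrow> real" where
  "total_cost t = (\<Sum>u<N. \<Sum>v<N. w u v * edge_cost t u v) / 2"

lemma edge_cost_nonneg: "edge_cost t u v \<ge> 0"
  unfolding edge_cost_def
  by (intro add_nonneg_nonneg mult_nonneg_nonneg sum_nonneg dist2_nonneg crossing_nonneg) auto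

lemma total_cost_nonneg: "total_cost t \<ge> 0"
  unfolding total_cost_def by (auto intro!: sum_nonneg mult_nonneg_nonneg weight_nonneg edge_cost_nonneg)

lemma sum_energy_f: "(\<Sum>i<k. energy (f i)) = (\<Sum>u<N. \<Sum>v<N. w u v * dist2 u v) / 2"
proof -
  have "(\<Sum>i<k. 2 * energy (f i)) = (\<Sum>i<k. \<Sum>u<N. \<Sum>v<N. w u v * (f i u - sign u v * f i v)\<^sup>2)"
    by (simp add: energy_def)
  also have "\<dots> = (\<Sum>u<N. \<Sum>i<k. \<Sum>v<N. w u v * (f i u - sign u v * f i v)\<^sup>2)" by (rule sum.swap)
  also have "\<dots> = (\<Sum>u<N. \<Sum>v<N. \<Sum>i<k. w u v * (f i u - sign u v * f i v)\<^sup>2)"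
    by (intro sum.cong[OF refl]) (rule sum.swap)
  also have "\<dots> = (\<Sum>u<N. \<Sum>v<N. w u v * dist2 u v)" by (simp add: dist2_def sum_distrib_left)
  finally show ?thesis by (simp add: sum_distrib_left[symmetric])
qed

lemma sum_total_cost: "(\<Sum>t<M. total_cost t) \<le> (2 * M + 128 / \<eta>\<^sup>2) * (\<Sum>i<k. energy (f i))"
proof -
  have "(\<Sum>t<M. 2 * total_cost t) = (\<Sum>t<M. \<Sum>u<N. \<Sum>v<N. w u v * edge_cost t u v)"
    by (simp add: total_cost_def)
  also have "\<dots> = (\<Sum>u<N. \<Sum>t<M. \<Sum>v<N. w u v * edge_cost t u v)" by (rule sum.swap)
  also have "\<dots> = (\<Sum>u<N. \<Sum>v<N. \<Sum>t<M. w u v * edge_cost t u v)"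
    by (intro sum.cong[OF refl]) (rule sum.swap)
  also have "\<dots> \<le> (\<Sum>u<N. \<Sum>v<N. (2 * M + 128 / \<eta>\<^sup>2) * (w u v * dist2 u v))"
  proof (intro sum_mono)
    fix u v
    show "(\<Sum>t<M. w u v * edge_cost t u v) \<le> (2 * M + 128 / \<eta>\<^sup>2) * (w u v * dist2 u v)"
      using mult_left_mono[OF sum_edge_cost[of u v] weight_nonneg[of u v]]
      by (simp add: sum_distrib_left mult_ac)
  qed
  also have "\<dots> = (2 * M + 128 / \<eta>\<^sup>2) * (2 * (\<Sum>i<k. energy (f i)))"
    by (simp add: sum_energy_f flip: sum_distrib_left)
  finally show ?thesis by (simp add: sum_distrib_left[symmetric])
qed

lemma piece_energy:
  fixes n :: nat
  assumes disj: "\<And>i j. i < n \<Longrightarrow> j < n \<Longrightarrow> i \<noteq> j \<Longrightarrow> S i \<inter> S j = {}"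
  shows "(\<Sum>j<n. \<Sum>i<k. energy (piece t (S j) i)) \<le> total_cost t"
proof -
  let ?d = "\<lambda>j i u v. (piece t (S j) i u - sign u v * piece t (S j) i v)\<^sup>2"
  have "(\<Sum>j<n. \<Sum>i<k. 2 * energy (piece t (S j) i))
      = (\<Sum>(j, i)\<in>{..<n} \<times> {..<k}. 2 * energy (piece t (S j) i))"
    by (rule sum.cartesian_product)
  also have "\<dots> = (\<Sum>p\<in>{..<n} \<times> {..<k}. \<Sum>u<N. \<Sum>v<N. w u v * ?d (fst p) (snd p) u v)"
    by (simp add: energy_def case_prod_beta)
  also have "\<dots> = (\<Sum>u<N. \<Sum>p\<in>{..<n} \<times> {..<k}. \<Sum>v<N. w u v * ?d (fst p) (snd p) u v)"
    by (rule sum.swap)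
  also have "\<dots> = (\<Sum>u<N. \<Sum>v<N. \<Sum>p\<in>{..<n} \<times> {..<k}. w u v * ?d (fst p) (snd p) u v)"
    by (intro sum.cong[OF refl]) (rule sum.swap)
  also have "\<dots> = (\<Sum>u<N. \<Sum>v<N. w u v * (\<Sum>j<n. \<Sum>i<k. ?d j i u v))"
  proof (intro sum.cong[OF refl])
    fix u v
    show "(\<Sum>p\<in>{..<n} \<times> {..<k}. w u v * ?d (fst p) (snd p) u v) = w u v * (\<Sum>j<n. \<Sum>i<k. ?d j i u v)"
      by (simp add: sum.cartesian_product case_prod_beta sum_distrib_left)
  qed
  also have "\<dots> \<le> (\<Sum>u<N. \<Sum>v<N. w u v * edge_cost t u v)"
    by (intro sum_mono mult_left_mono piece_cost disj weight_nonneg)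
  also have "\<dots> = 2 * total_cost t" by (simp add: total_cost_def)
  finally show ?thesis by (simp flip: sum_distrib_left)
qed

section \<open>Mass lost to the bumps and mass of a single cell\<close>

lemma sum_radius: "(\<Sum>u<N. degree u * (radius u)\<^sup>2) = k"
proof -
  have "(\<Sum>u<N. degree u * (radius u)\<^sup>2) = (\<Sum>i<k. \<Sum>u<N. degree u * (f i u)\<^sup>2)"
    by (subst sum.swap) (simp add: radius_square sum_distrib_left)
  also have "\<dots> = k" using sqnorm_f by (simp add: sqnorm_def)
  finally show ?thesis .
qed

definition lost :: "nat \<Rightarrow> real" where
  "lost t = (\<Sum>u<N. if cutoff t u = 1 then 0 else degree u * (radius u)\<^sup>2)"

lemma lost_nonneg: "lost t \<ge> 0"
  unfolding lost_def
  by (intro sum_nonneg) (auto intro!: mult_nonneg_nonneg less_imp_le[OF degree_positive])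

text \<open>Each coordinate meets a bump for at most one shift, so a vertex is damaged by at most
  \<open>k\<close> shifts; the total mass is \<open>k\<close>.\<close>

lemma sum_lost: "(\<Sum>t<M. lost t) \<le> real k * real k"
proof -
  have "card {t. t < M \<and> cutoff t u \<noteq> 1} \<le> k" for u
  proof -
    have "{t. t < M \<and> cutoff t u \<noteq> 1} \<subseteq> (\<lambda>i. nat (round \<bar>pos u i\<bar> mod int M)) ` {..<k}"
    proof
      fix t assume t: "t \<in> {t. t < M \<and> cutoff t u \<noteq> 1}"
      then have "L2_set (\<lambda>i. bump M t (pos u i)) {..<k} \<noteq> 0" by (auto simp: cutoff_def)
      then obtain i where "i < k" "bump M t (pos u i) \<noteq> 0"
        using L2_set_eq_0_iff[of "{..<k}" "\<lambda>i. bump M t (pos u i)"] by auto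
      then show "t \<in> (\<lambda>i. nat (round \<bar>pos u i\<bar> mod int M)) ` {..<k}"
        by (intro image_eqI[of _ _ i]) (auto simp: bump_def split: if_splits)
    qed
    then have "card {t. t < M \<and> cutoff t u \<noteq> 1} \<le> card {..<k}" by (rule surj_card_le[rotated]) simp
    then show ?thesis by simp
  qed
  then have c: "(\<Sum>t<M. if cutoff t u = 1 then 0 else a) \<le> k * a" if "a \<ge> 0" for u and a :: real
  proof -
    have "(\<Sum>t<M. if cutoff t u = 1 then 0 else a) = (\<Sum>t\<in>{t. t < M \<and> cutoff t u \<noteq> 1}. a)"
      by (intro sum.mono_neutral_cong_right) auto
    also have "\<dots> = card {t. t < M \<and> cutoff t u \<noteq> 1} * a" by simp
    also have "\<dots> \<le> k * a"
      using that \<open>\<And>u. card {t. t < M \<and> cutoff t u \<noteq> 1} \<le> k\<close> by (intro mult_right_mono) auto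
    finally show ?thesis .
  qed
  have "(\<Sum>t<M. lost t) = (\<Sum>u<N. \<Sum>t<M. if cutoff t u = 1 then 0 else degree u * (radius u)\<^sup>2)"
    unfolding lost_def by (rule sum.swap)
  also have "\<dots> \<le> (\<Sum>u<N. k * (degree u * (radius u)\<^sup>2))"
    by (intro sum_mono c mult_nonneg_nonneg less_imp_le[OF degree_positive]) auto
  also have "\<dots> = real k * real k" by (simp add: sum_radius flip: sum_distrib_left)
  finally show ?thesis .
qed

text \<open>Isotropy is tested with the direction of one vertex \<open>v\<close> of the cell. All
  others are almost parallel or antiparallel to it, so the squared projection captures at least the
  fraction \<open>\<kappa>\<close> of their mass, while the total captured is 1.\<close>

lemma cell_mass:
  assumes t: "t < M"
  shows "(\<Sum>u\<in>{u. u < N \<and> key t u = c}. degree u * (radius u)\<^sup>2) \<le> 1 + 1 / (4 * k)"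
proof (cases "\<exists>v<N. key t v = c \<and> radius v \<noteq> 0")
  case False
  then have "(\<Sum>u\<in>{u. u < N \<and> key t u = c}. degree u * (radius u)\<^sup>2) = 0"
    by (intro sum.neutral) auto
  then show ?thesis by (simp add: add_nonneg_nonneg)
next
  case True
  then obtain v where v: "key t v = c" "radius v \<noteq> 0" by blast
  have k1: "real k \<ge> 1" using k_pos by simp
  define \<kappa> where "\<kappa> = 1 - 1 / (5 * real k)"
  have "degree u * (radius u)\<^sup>2 * \<kappa> \<le> degree u * (\<Sum>i<k. dir v i * f i u)\<^sup>2"
    if u: "u < N" "key t u = c" for u
  proof (cases "radius u = 0")
    case True
    then show ?thesis using degree_positive[OF u(1)] by simp
  next
    case False
    obtain e :: real where e: "e = 1 \<or> e = - 1"
      and lab_eq: "\<And>i. i < k \<Longrightarrow> lab M t (pos u i) = lab M t (e * pos v i)"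
      using key_eq[of t u v] u v by auto
    define D where "D = (\<Sum>i<k. (dir u i - e * dir v i)\<^sup>2)"
    define p where "p = (\<Sum>i<k. dir v i * dir u i)"
    have "D \<le> (\<Sum>i<k. (2 / (5 * real k))\<^sup>2)"
      unfolding D_def
    proof (rule sum_mono)
      fix i assume "i \<in> {..<k}"
      then have "\<bar>pos u i - e * pos v i\<bar> \<le> 2 * M" using lab_diameter[OF t lab_eq] by simp
      moreover have "dir u i - e * dir v i = \<eta> * (pos u i - e * pos v i)"
        using \<eta>_pos by (simp add: pos_def right_diff_distrib)
      ultimately have "\<bar>dir u i - e * dir v i\<bar> \<le> \<eta> * (2 * M)"
        using \<eta>_pos by (simp add: abs_mult)
      also have "\<eta> * (2 * M) = 2 / (5 * real k)" using M_pos k1 by (simp add: \<eta>_def field_simps)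
      finally have "\<bar>dir u i - e * dir v i\<bar>\<^sup>2 \<le> (2 / (5 * real k))\<^sup>2" by (rule power_mono) simp
      then show "(dir u i - e * dir v i)\<^sup>2 \<le> (2 / (5 * real k))\<^sup>2" by simp
    qed
    also have "\<dots> = 4 / (25 * real k)" using k1 by (simp add: power2_eq_square field_simps)
    also have "\<dots> \<le> 1 / (5 * real k)" using k1 by (simp add: field_simps)
    finally have D: "D \<le> 1 / (5 * real k)" .
    have e2: "e\<^sup>2 = 1" using e by auto
    have "D = (\<Sum>i<k. (dir u i)\<^sup>2 + (dir v i)\<^sup>2 - 2 * e * (dir v i * dir u i))"
      unfolding D_def using e2
      by (intro sum.cong refl) (simp add: power2_diff power_mult_distrib mult_ac)
    also have "\<dots> = 2 - 2 * e * p"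
      using False v(2) by (simp add: sum.distrib sum_subtractf sum_dir_square p_def flip: sum_distrib_left)
    finally have "D = 2 - 2 * (e * p)" by (simp add: mult.assoc)
    then have ep: "e * p = 1 - D / 2" by linarith
    have "p\<^sup>2 = (e * p)\<^sup>2" using e2 by (simp add: power_mult_distrib)
    also have "\<dots> = 1 - D + (D / 2)\<^sup>2" unfolding ep by (simp add: power2_eq_square algebra_simps)
    finally have "\<kappa> \<le> p\<^sup>2" using D zero_le_power2[of "D / 2"] unfolding \<kappa>_def by linarith
    moreover have "(\<Sum>i<k. dir v i * f i u) = radius u * p"
      unfolding p_def sum_distrib_left
      by (intro sum.cong refl) (simp add: radius_dir[symmetric])
    ultimately show ?thesis using degree_positive[OF u(1)]
      by (simp add: power_mult_distrib mult_left_mono mult.assoc)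
  qed
  then have "(\<Sum>u\<in>{u. u < N \<and> key t u = c}. degree u * (radius u)\<^sup>2 * \<kappa>)
      \<le> (\<Sum>u\<in>{u. u < N \<and> key t u = c}. degree u * (\<Sum>i<k. dir v i * f i u)\<^sup>2)"
    by (intro sum_mono) auto
  also have "\<dots> \<le> (\<Sum>u<N. degree u * (\<Sum>i<k. dir v i * f i u)\<^sup>2)"
    by (intro sum_mono2) (auto intro!: mult_nonneg_nonneg less_imp_le[OF degree_positive])
  also have "\<dots> = 1" by (rule isotropic) (rule sum_dir_square[OF v(2)])
  finally have le: "(\<Sum>u\<in>{u. u < N \<and> key t u = c}. degree u * (radius u)\<^sup>2) * \<kappa> \<le> 1"
    by (simp add: sum_distrib_right)
  have \<kappa>: "\<kappa> > 0" using k1 by (simp add: \<kappa>_def field_simps)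
  \<comment> \<open>The product is \<open>1 + 1/(20 k) - 1/(20 k^2)\<close>, which is at least 1 for
    \<open>k \<ge> 1\<close>.\<close>
  have "1 \<le> (1 + 1 / (4 * k)) * \<kappa>" using k1 by (simp add: \<kappa>_def field_simps)
  with le have "(\<Sum>u\<in>{u. u < N \<and> key t u = c}. degree u * (radius u)\<^sup>2) * \<kappa> \<le> (1 + 1 / (4 * k)) * \<kappa>"
    by linarith
  then show ?thesis using \<kappa> by (rule mult_right_le_imp_le)
qed

end

section \<open>The higher-order inequality\<close>

context isotropic_embedding
begin

lemma retained_mass:
  "(\<Sum>c\<in>S. \<Sum>u\<in>{u. u < N \<and> cutoff t u = 1 \<and> key t u = c}. degree u * (radius u)\<^sup>2)
    = (\<Sum>u\<in>{u. u < N \<and> cutoff t u = 1 \<and> key t u \<in> S}. degree u * (radius u)\<^sup>2)"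
  if "finite S" for S
proof -
  have "(\<Sum>c\<in>S. \<Sum>u\<in>{u. u < N \<and> cutoff t u = 1 \<and> key t u = c}. degree u * (radius u)\<^sup>2)
    = (\<Sum>c\<in>S. \<Sum>u\<in>{u \<in> {u. u < N \<and> cutoff t u = 1 \<and> key t u \<in> S}. key t u = c}.
        degree u * (radius u)\<^sup>2)"
    by (intro sum.cong refl) auto
  also have "\<dots> = (\<Sum>u\<in>{u. u < N \<and> cutoff t u = 1 \<and> key t u \<in> S}. degree u * (radius u)\<^sup>2)"
    by (rule sum.group) (use that in auto)
  finally show ?thesis .
qed

text \<open>The average loss is at most \<open>k^2 / M = 1/8\<close>, and the average cost factor is
  \<open>2 + 128 / (\<eta>^2 M) = 2 + 25600 k^4\<close>. Asking for both bounds at once doubles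
  each.\<close>

lemma good_shift:
  obtains t where "t < M" "lost t \<le> 1 / 4"
    "total_cost t \<le> 51204 * real k ^ 4 * (\<Sum>i<k. energy (f i))"
proof -
  define \<Lambda> where "\<Lambda> = (\<Sum>i<k. energy (f i))"
  have \<Lambda>: "\<Lambda> \<ge> 0" by (simp add: \<Lambda>_def sum_nonneg energy_nonneg)
  have k1: "real k ^ 4 \<ge> 1" using k_pos by simp
  have k0: "real k > 0" using k_pos by simp
  have M: "real M = 8 * (real k)\<^sup>2" by (simp add: M_def)
  have "1 / \<eta>\<^sup>2 = M * (200 * real k ^ 4)"
    using k0 by (simp add: \<eta>_def M power2_eq_square power4_eq_xxxx)
  then have eta: "128 / \<eta>\<^sup>2 = M * (25600 * real k ^ 4)" by simp
  have "(\<Sum>t<M. total_cost t) \<le> (2 * M + 128 / \<eta>\<^sup>2) * \<Lambda>"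
    unfolding \<Lambda>_def by (rule sum_total_cost)
  also have "\<dots> = M * ((2 + 25600 * real k ^ 4) * \<Lambda>)"
    unfolding eta by (simp add: algebra_simps)
  finally have cost: "sum total_cost {..<M} \<le> card {..<M} * ((2 + 25600 * real k ^ 4) * \<Lambda>)" by simp
  have lost: "sum lost {..<M} \<le> card {..<M} * (1 / 8)"
    using sum_lost by (simp add: M power2_eq_square)
  have "\<exists>t\<in>{..<M}. lost t \<le> 2 * (1 / 8) \<and> total_cost t \<le> 2 * ((2 + 25600 * real k ^ 4) * \<Lambda>)"
    by (rule averaging_two[OF _ _ lost_nonneg total_cost_nonneg lost cost]) (use M_pos in auto)
  then obtain t where t: "t < M" "lost t \<le> 1 / 4"
    "total_cost t \<le> 2 * ((2 + 25600 * real k ^ 4) * \<Lambda>)" by auto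
  have "(2 + 25600 * real k ^ 4) * \<Lambda> \<le> (25602 * real k ^ 4) * \<Lambda>"
    using k1 \<Lambda> by (intro mult_right_mono) auto
  then have "total_cost t \<le> 51204 * real k ^ 4 * \<Lambda>" using t(3) by simp
  then show ?thesis using that t by (simp add: \<Lambda>_def)
qed

text \<open>Only vertices with cutoff 1 are counted, since there a piece agrees with the
  embedding.\<close>

lemma heavy_groups:
  assumes t: "t < M" and lost: "lost t \<le> 1 / 4"
  obtains S where
    "\<And>j. j < k \<Longrightarrow> 1 / 2 \<le> (\<Sum>u\<in>{u. u < N \<and> cutoff t u = 1 \<and> key t u \<in> S j}. degree u * (radius u)\<^sup>2)"
    "\<And>i j. i < k \<Longrightarrow> j < k \<Longrightarrow> i \<noteq> j \<Longrightarrow> S i \<inter> S j = {}"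
proof -
  obtain n where n: "k = Suc n" using k_pos by (cases k) auto
  define I where "I = key t ` {..<N}"
  define m where "m c = (\<Sum>u\<in>{u. u < N \<and> cutoff t u = 1 \<and> key t u = c}. degree u * (radius u)\<^sup>2)" for c
  define B where "B = 1 + 1 / (4 * real k)"
  have fin: "finite I" by (simp add: I_def)
  have mB: "m c \<le> B" for c
  proof -
    have "m c \<le> (\<Sum>u\<in>{u. u < N \<and> key t u = c}. degree u * (radius u)\<^sup>2)"
      unfolding m_def
      by (intro sum_mono2) (auto intro!: mult_nonneg_nonneg less_imp_le[OF degree_positive])
    then show ?thesis using cell_mass[OF t, of c] by (simp add: B_def)
  qed
  have B1: "1 \<le> B" by (simp add: B_def)
  have "sum m I = (\<Sum>u\<in>{u. u < N \<and> cutoff t u = 1 \<and> key t u \<in> I}. degree u * (radius u)\<^sup>2)"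
    unfolding m_def by (rule retained_mass[OF fin])
  also have "\<dots> = (\<Sum>u<N. if cutoff t u = 1 then degree u * (radius u)\<^sup>2 else 0)"
    by (rule sum.mono_neutral_cong_left) (auto simp: I_def)
  also have "\<dots> = (\<Sum>u<N. degree u * (radius u)\<^sup>2
      - (if cutoff t u = 1 then 0 else degree u * (radius u)\<^sup>2))"
    by (intro sum.cong refl) auto
  also have "\<dots> = k - lost t" by (simp add: sum_subtractf sum_radius lost_def)
  finally have total: "sum m I \<ge> k - 1 / 4" using lost by simp
  have "real n * B + 1 / 2 \<le> sum m I"
  proof -
    \<comment> \<open>The budget closes exactly: \<open>k - 1\<close> groups of mass at most
      \<open>1 + 1/(4k)\<close> and a last one of mass 1/2 need at most \<open>k - 1/4\<close>, and
      the loss is at most 1/4.\<close>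
    have "real n / (4 * real k) \<le> 1 / 4" using n by (simp add: field_simps)
    then have "real n * B \<le> real n + 1 / 4" by (simp add: B_def algebra_simps)
    then show ?thesis using total n by simp
  qed
  from group_weights[OF fin mB B1 this]
  obtain S where S: "\<forall>j\<le>n. S j \<subseteq> I \<and> 1 / 2 \<le> sum m (S j)"
    "\<forall>i\<le>n. \<forall>j\<le>n. i \<noteq> j \<longrightarrow> S i \<inter> S j = {}"
    by blast
  show ?thesis
  proof (rule that[of S])
    fix j assume "j < k"
    then have "S j \<subseteq> I" "1 / 2 \<le> sum m (S j)" using S(1) n by auto
    then show "1 / 2 \<le> (\<Sum>u\<in>{u. u < N \<and> cutoff t u = 1 \<and> key t u \<in> S j}. degree u * (radius u)\<^sup>2)"
      using retained_mass[OF finite_subset[OF _ fin], of "S j" t] by (simp add: m_def)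
  qed (use S(2) n in auto)
qed

lemma piece_mass:
  "(\<Sum>u\<in>{u. u < N \<and> cutoff t u = 1 \<and> key t u \<in> S}. degree u * (radius u)\<^sup>2)
    \<le> (\<Sum>i<k. sqnorm (piece t S i))"
proof -
  have "(\<Sum>i<k. sqnorm (piece t S i)) = (\<Sum>u<N. \<Sum>i<k. degree u * (piece t S i u)\<^sup>2)"
    unfolding sqnorm_def by (rule sum.swap)
  also have "\<dots> = (\<Sum>u<N. if key t u \<in> S then degree u * ((cutoff t u)\<^sup>2 * (radius u)\<^sup>2) else 0)"
    by (intro sum.cong refl)
      (auto simp: piece_def radius_square power_mult_distrib sum_distrib_left)
  finally have eq: "(\<Sum>i<k. sqnorm (piece t S i))
    = (\<Sum>u<N. if key t u \<in> S then degree u * ((cutoff t u)\<^sup>2 * (radius u)\<^sup>2) else 0)" .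
  have "(\<Sum>u\<in>{u. u < N \<and> cutoff t u = 1 \<and> key t u \<in> S}. degree u * (radius u)\<^sup>2)
    = (\<Sum>u\<in>{u. u < N \<and> cutoff t u = 1 \<and> key t u \<in> S}.
        if key t u \<in> S then degree u * ((cutoff t u)\<^sup>2 * (radius u)\<^sup>2) else 0)"
    by (intro sum.cong refl) auto
  also have "\<dots> \<le> (\<Sum>u<N. if key t u \<in> S then degree u * ((cutoff t u)\<^sup>2 * (radius u)\<^sup>2) else 0)"
    by (intro sum_mono2) (auto intro!: mult_nonneg_nonneg less_imp_le[OF degree_positive])
  finally show ?thesis unfolding eq .
qed

text \<open>The piece of a group is vector-valued; some coordinate has a Rayleigh quotient at most
  that of the whole vector. The constant doubles because a group is only guaranteed mass
  1/2.\<close>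

lemma localized_functions:
  obtains g where
    "\<And>j. j < k \<Longrightarrow> sqnorm (g j) > 0"
    "\<And>j. j < k \<Longrightarrow> energy (g j) \<le> 102408 * real k ^ 4 * (\<Sum>i<k. energy (f i)) * sqnorm (g j)"
    "\<And>i j u. i < k \<Longrightarrow> j < k \<Longrightarrow> i \<noteq> j \<Longrightarrow> g i u = 0 \<or> g j u = 0"
proof -
  obtain t where t: "t < M" "lost t \<le> 1 / 4"
    and cost: "total_cost t \<le> 51204 * real k ^ 4 * (\<Sum>i<k. energy (f i))" by (rule good_shift)
  obtain S where S:
    "\<And>j. j < k \<Longrightarrow> 1 / 2 \<le> (\<Sum>u\<in>{u. u < N \<and> cutoff t u = 1 \<and> key t u \<in> S j}. degree u * (radius u)\<^sup>2)"
    and disj: "\<And>i j. i < k \<Longrightarrow> j < k \<Longrightarrow> i \<noteq> j \<Longrightarrow> S i \<inter> S j = {}"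
    using heavy_groups[OF t] by blast
  define A where "A = 102408 * real k ^ 4 * (\<Sum>i<k. energy (f i))"
  have A: "A \<ge> 0" by (simp add: A_def sum_nonneg energy_nonneg)
  have "\<exists>i<k. sqnorm (piece t (S j) i) > 0 \<and> energy (piece t (S j) i) \<le> A * sqnorm (piece t (S j) i)"
    if j: "j < k" for j
  proof (rule ccontr)
    assume neg: "\<not> ?thesis"
    have mass: "1 / 2 \<le> (\<Sum>i<k. sqnorm (piece t (S j) i))"
      using S[OF j] piece_mass[of t "S j"] by linarith
    have le: "A * sqnorm (piece t (S j) i) \<le> energy (piece t (S j) i)" if "i < k" for i
    proof (cases "sqnorm (piece t (S j) i) = 0")
      case False
      then have "sqnorm (piece t (S j) i) > 0" using sqnorm_nonneg[of "piece t (S j) i"] by linarith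
      then show ?thesis using neg that by (meson less_imp_le not_le)
    qed (simp add: energy_nonneg)
    have "\<exists>i<k. sqnorm (piece t (S j) i) > 0"
    proof (rule ccontr)
      assume "\<not> ?thesis"
      then have "(\<Sum>i<k. sqnorm (piece t (S j) i)) \<le> 0" by (intro sum_nonpos) auto
      then show False using mass by simp
    qed
    then have lt: "\<exists>i\<in>{..<k}. A * sqnorm (piece t (S j) i) < energy (piece t (S j) i)"
      using neg by (meson lessThan_iff not_le)
    have "(\<Sum>i<k. A * sqnorm (piece t (S j) i)) < (\<Sum>i<k. energy (piece t (S j) i))"
      using le lt by (intro sum_strict_mono_ex1) auto
    also have "\<dots> \<le> (\<Sum>j<k. \<Sum>i<k. energy (piece t (S j) i))"
      using j member_le_sum[of j "{..<k}" "\<lambda>j. \<Sum>i<k. energy (piece t (S j) i)"]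
      by (simp add: sum_nonneg energy_nonneg)
    also have "\<dots> \<le> total_cost t" by (rule piece_energy[OF disj])
    also have "\<dots> \<le> A * (1 / 2)" using cost by (simp add: A_def)
    also have "\<dots> \<le> A * (\<Sum>i<k. sqnorm (piece t (S j) i))" using mass A by (intro mult_left_mono)
    finally show False by (simp add: sum_distrib_left)
  qed
  then obtain c where c: "\<And>j. j < k \<Longrightarrow> sqnorm (piece t (S j) (c j)) > 0"
    "\<And>j. j < k \<Longrightarrow> energy (piece t (S j) (c j)) \<le> A * sqnorm (piece t (S j) (c j))"
    by metis
  show ?thesis
  proof (rule that[of "\<lambda>j. piece t (S j) (c j)"])
    fix i j u assume "i < k" "j < k" "i \<noteq> j"
    then show "piece t (S i) (c i) u = 0 \<or> piece t (S j) (c j) u = 0"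
      using disj[of i j] by (auto simp: piece_def)
  qed (use c in \<open>auto simp: A_def\<close>)
qed

end

section \<open>From localized eigenfunctions to the Cheeger constant\<close>

context signed_graph
begin

lemma localized_eigenfunctions:
  assumes k: "1 \<le> k" "k \<le> N"
  obtains g where
    "\<And>j. j < k \<Longrightarrow> sqnorm (g j) > 0"
    "\<And>j. j < k \<Longrightarrow> energy (g j) \<le> 102408 * real k ^ 6 * lam k * sqnorm (g j)"
    "\<And>i j u. i < k \<Longrightarrow> j < k \<Longrightarrow> i \<noteq> j \<Longrightarrow> g i u = 0 \<or> g j u = 0"
proof -
  obtain \<phi> where \<phi>:
    "\<And>i j. i < N \<Longrightarrow> j < N \<Longrightarrow> (\<Sum>u<N. degree u * \<phi> i u * \<phi> j u) = (if i = j then 1 else 0 :: real)"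
    "\<And>f. sqnorm f = (\<Sum>i<N. (\<Sum>u<N. degree u * f u * \<phi> i u)\<^sup>2)"
    "\<And>f. energy f = (\<Sum>i<N. lam (Suc i) * (\<Sum>u<N. degree u * f u * \<phi> i u)\<^sup>2)"
    by (rule eigenfunctions) (rule that)
  have "isotropic_embedding N E w \<sigma> \<phi> k"
  proof
    show "k > 0" using k by simp
  next
    fix i assume "i < k"
    then show "sqnorm (\<phi> i) = 1"
      using \<phi>(1)[of i i] k by (simp add: sqnorm_def power2_eq_square mult.assoc)
  next
    fix c :: "nat \<Rightarrow> real" assume c: "(\<Sum>i<k. (c i)\<^sup>2) = 1"
    have coord: "(\<Sum>u<N. degree u * (\<Sum>j<k. c j * \<phi> j u) * \<phi> i u) = (if i < k then c i else 0)"
      if i: "i < N" for i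
    proof -
      have "(\<Sum>u<N. degree u * (\<Sum>j<k. c j * \<phi> j u) * \<phi> i u)
          = (\<Sum>u<N. \<Sum>j<k. c j * (degree u * \<phi> j u * \<phi> i u))"
        by (simp add: sum_distrib_left sum_distrib_right mult_ac)
      also have "\<dots> = (\<Sum>j<k. \<Sum>u<N. c j * (degree u * \<phi> j u * \<phi> i u))" by (rule sum.swap)
      also have "\<dots> = (\<Sum>j<k. if j = i then c i else 0)"
        by (intro sum.cong refl) (use i k \<phi>(1) in \<open>auto simp flip: sum_distrib_left\<close>)
      finally show ?thesis by simp
    qed
    have "sqnorm (\<lambda>u. \<Sum>j<k. c j * \<phi> j u) = (\<Sum>i<N. (if i < k then c i else 0)\<^sup>2)"
      unfolding \<phi>(2)[of "\<lambda>u. \<Sum>j<k. c j * \<phi> j u"] by (intro sum.cong refl) (simp add: coord)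
    also have "\<dots> = (\<Sum>i<k. (c i)\<^sup>2)"
      by (rule sum.mono_neutral_cong_right) (use k in auto)
    finally show "(\<Sum>u<N. degree u * (\<Sum>i<k. c i * \<phi> i u)\<^sup>2) = 1" using c by (simp add: sqnorm_def)
  qed
  then interpret isotropic_embedding N E w \<sigma> \<phi> k .
  have lam: "lam k \<ge> 0" using lam_bounds k by simp
  have "(\<Sum>i<k. energy (\<phi> i)) \<le> (\<Sum>i<k. lam k)"
  proof (rule sum_mono)
    fix i assume "i \<in> {..<k}"
    then have i: "i < N" "Suc i \<le> k" using k by auto
    have "energy (\<phi> i) = lam (Suc i)" by (rule energy_eigenfunction[OF i(1) \<phi>(1,3)])
    then show "energy (\<phi> i) \<le> lam k" using lam_mono[of "Suc i" k] i k by simp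
  qed
  then have "real k ^ 4 * (\<Sum>i<k. energy (\<phi> i)) \<le> real k ^ 4 * (k * lam k)"
    by (intro mult_left_mono) auto
  \<comment> \<open>Each of the \<open>k\<close> energies is at most \<open>lam k\<close>, which
    adds one power of \<open>k\<close>; the bound is then relaxed to the sixth power.\<close>
  also have "\<dots> = real k ^ 5 * lam k" by (simp add: power_Suc[symmetric] eval_nat_numeral)
  also have "\<dots> \<le> real k ^ 6 * lam k"
    using lam k by (intro mult_right_mono power_increasing) auto
  finally have le: "102408 * real k ^ 4 * (\<Sum>i<k. energy (\<phi> i)) \<le> 102408 * real k ^ 6 * lam k" by simp
  obtain g where g: "\<And>j. j < k \<Longrightarrow> sqnorm (g j) > 0"
    "\<And>j. j < k \<Longrightarrow> energy (g j) \<le> 102408 * real k ^ 4 * (\<Sum>i<k. energy (\<phi> i)) * sqnorm (g j)"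
    "\<And>i j u. i < k \<Longrightarrow> j < k \<Longrightarrow> i \<noteq> j \<Longrightarrow> g i u = 0 \<or> g j u = 0"
    by (rule localized_functions) (rule that)
  show ?thesis
  proof (rule that[of g])
    fix j assume "j < k"
    then show "energy (g j) \<le> 102408 * real k ^ 6 * lam k * sqnorm (g j)"
      by (intro order_trans[OF g(2) mult_right_mono[OF le]] sqnorm_nonneg)
  qed (use g in auto)
qed

text \<open>Every value in the set defining the minimum is the ratio of some pair of vertex subsets,
  so the set is finite although the families \<open>V\<close> range over infinitely many
  functions.\<close>

lemma cheeger_const_le:
  assumes "k \<ge> 1"
    and sub: "\<And>j. j < k \<Longrightarrow> sub_bipartition (A j) (B j)"
    and disj: "\<And>i j. i < k \<Longrightarrow> j < k \<Longrightarrow> i \<noteq> j \<Longrightarrow> (A i \<union> B i) \<inter> (A j \<union> B j) = {}"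
    and ratio: "\<And>j. j < k \<Longrightarrow> signed_bipartiteness_ratio \<mu> (A j) (B j) \<le> c"
  shows "cheeger_const k \<mu> \<le> c"
proof -
  define feasible where "feasible V \<longleftrightarrow>
      (\<forall>i\<in>{1..k}. sub_bipartition (V (2 * i - 1)) (V (2 * i))) \<and>
      disjoint_family_on (\<lambda>i. V (2 * i - 1) \<union> V (2 * i)) {1..k}" for V :: "nat \<Rightarrow> nat set"
  define val where "val V = Max ((\<lambda>i. signed_bipartiteness_ratio \<mu> (V (2 * i - 1)) (V (2 * i))) ` {1..k})"
    for V :: "nat \<Rightarrow> nat set"
  have h: "cheeger_const k \<mu> = Min {val V | V. feasible V}"
    unfolding cheeger_const_def val_def feasible_def ..
  have "{val V | V. feasible V}
      \<subseteq> (\<lambda>(X, Y). signed_bipartiteness_ratio \<mu> X Y) ` (Pow {..<N} \<times> Pow {..<N})"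
  proof
    fix x assume "x \<in> {val V | V. feasible V}"
    then obtain V where V: "feasible V" "x = val V" by blast
    have "val V \<in> (\<lambda>i. signed_bipartiteness_ratio \<mu> (V (2 * i - 1)) (V (2 * i))) ` {1..k}"
      unfolding val_def by (rule Max_in) (use assms(1) in auto)
    then obtain i where i: "i \<in> {1..k}"
      "x = signed_bipartiteness_ratio \<mu> (V (2 * i - 1)) (V (2 * i))" using V by auto
    then have "sub_bipartition (V (2 * i - 1)) (V (2 * i))" using V by (auto simp: feasible_def)
    then show "x \<in> (\<lambda>(X, Y). signed_bipartiteness_ratio \<mu> X Y) ` (Pow {..<N} \<times> Pow {..<N})"
      using i by (intro image_eqI[of _ _ "(V (2 * i - 1), V (2 * i))"]) (auto simp: sub_bipartition_def)
  qed
  then have fin: "finite {val V | V. feasible V}" by (rule finite_subset) auto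
  \<comment> \<open>Translates families indexed from 0 into the interleaved indexing from 1: entries
    \<open>2 i - 1\<close> and \<open>2 i\<close> are \<open>A (i - 1)\<close> and
    \<open>B (i - 1)\<close>.\<close>
  define V where "V n = (if even n then B (n div 2 - 1) else A (n div 2))" for n :: nat
  have V: "V (2 * i - 1) = A (i - 1)" "V (2 * i) = B (i - 1)" if "i \<in> {1..k}" for i
    using that by (cases i; auto simp: V_def)+
  have "feasible V"
    unfolding feasible_def
  proof (intro conjI ballI)
    fix i assume "i \<in> {1..k}"
    then show "sub_bipartition (V (2 * i - 1)) (V (2 * i))" unfolding V[OF \<open>i \<in> {1..k}\<close>]
      by (intro sub) auto
  next
    show "disjoint_family_on (\<lambda>i. V (2 * i - 1) \<union> V (2 * i)) {1..k}"
      unfolding disjoint_family_on_def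
    proof (intro ballI impI)
      fix i j assume ij: "i \<in> {1..k}" "j \<in> {1..k}" "i \<noteq> j"
      then have "i - 1 < k" "j - 1 < k" "i - 1 \<noteq> j - 1" by auto
      from disj[OF this]
      show "(V (2 * i - 1) \<union> V (2 * i)) \<inter> (V (2 * j - 1) \<union> V (2 * j)) = {}"
        unfolding V[OF ij(1)] V[OF ij(2)] .
    qed
  qed
  then have "cheeger_const k \<mu> \<le> val V" unfolding h by (intro Min_le fin) auto
  also have "val V \<le> c"
    unfolding val_def
  proof (rule Max.boundedI)
    fix x assume "x \<in> (\<lambda>i. signed_bipartiteness_ratio \<mu> (V (2 * i - 1)) (V (2 * i))) ` {1..k}"
    then obtain i where i: "i \<in> {1..k}"
      "x = signed_bipartiteness_ratio \<mu> (V (2 * i - 1)) (V (2 * i))" by blast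
    then show "x \<le> c" unfolding i(2) V[OF i(1)] by (intro ratio) auto
  qed (use assms(1) in auto)
  finally show ?thesis .
qed

text \<open>The constant is 28 * 102408, from \<open>improved_sweep\<close> and
  \<open>localized_eigenfunctions\<close>. Disjoint supports of the functions make the
  sub-bipartitions disjoint.\<close>

lemma improved_cheeger:
  assumes k: "1 \<le> k" "k \<le> l" "l \<le> N"
  shows "cheeger_const k degree \<le> 2867424 * (real l * real k ^ 6 * (lam k / sqrt (lam l)))"
proof -
  obtain g where g: "\<And>j. j < k \<Longrightarrow> sqnorm (g j) > 0"
    "\<And>j. j < k \<Longrightarrow> energy (g j) \<le> 102408 * real k ^ 6 * lam k * sqnorm (g j)"
    "\<And>i j u. i < k \<Longrightarrow> j < k \<Longrightarrow> i \<noteq> j \<Longrightarrow> g i u = 0 \<or> g j u = 0"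
    by (rule localized_eigenfunctions[of k]) (use k in auto)
  have l: "1 \<le> l" "l \<le> N" using k by auto
  have lam0: "0 \<le> lam l" "0 \<le> lam k" "lam k \<le> lam l" using lam_bounds lam_mono k l by auto
  define good where "good j A B \<longleftrightarrow> sub_bipartition A B \<and> A \<union> B \<subseteq> {u. u < N \<and> g j u \<noteq> 0} \<and>
    signed_bipartiteness_ratio degree A B \<le> 2867424 * (real l * real k ^ 6 * (lam k / sqrt (lam l)))"
    for j A B
  have "\<exists>A B. good j A B" if j: "j < k" for j
  proof -
    have deg: "lam l > 0 \<or> energy (g j) = 0"
    proof (cases "lam l = 0")
      case True
      then have "lam k = 0" using lam0 by simp
      then show ?thesis using g(2)[OF j] energy_nonneg[of "g j"] by simp
    qed (use lam0 in simp)
    obtain A B where AB: "sub_bipartition A B" "A \<union> B \<subseteq> {u. u < N \<and> g j u \<noteq> 0}"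
      "signed_bipartiteness_ratio degree A B \<le> 28 * real l * (energy (g j) / sqnorm (g j)) / sqrt (lam l)"
      by (rule improved_sweep[OF l g(1)[OF j] deg]) (rule that)
    have "energy (g j) / sqnorm (g j) \<le> 102408 * real k ^ 6 * lam k"
      using g(1,2)[OF j] by (simp add: pos_divide_le_eq)
    then have "28 * real l * (energy (g j) / sqnorm (g j)) / sqrt (lam l)
        \<le> 28 * real l * (102408 * real k ^ 6 * lam k) / sqrt (lam l)"
      using lam0 by (intro divide_right_mono mult_left_mono) auto
    also have "\<dots> = 2867424 * (real l * real k ^ 6 * (lam k / sqrt (lam l)))" by simp
    finally have "good j A B" unfolding good_def using AB by linarith
    then show ?thesis by blast
  qed
  then obtain A B where "\<And>j. j < k \<Longrightarrow> good j (A j) (B j)" by metis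
  then have AB: "\<And>j. j < k \<Longrightarrow> sub_bipartition (A j) (B j)"
    "\<And>j. j < k \<Longrightarrow> A j \<union> B j \<subseteq> {u. u < N \<and> g j u \<noteq> 0}"
    "\<And>j. j < k \<Longrightarrow> signed_bipartiteness_ratio degree (A j) (B j)
      \<le> 2867424 * (real l * real k ^ 6 * (lam k / sqrt (lam l)))"
    unfolding good_def by blast+
  show ?thesis
  proof (rule cheeger_const_le[OF k(1) AB(1) _ AB(3)])
    fix i j assume ij: "i < k" "j < k" "i \<noteq> j"
    then have "A i \<union> B i \<subseteq> {u. g i u \<noteq> 0}" "A j \<union> B j \<subseteq> {u. g j u \<noteq> 0}" using AB(2) by blast+
    then show "(A i \<union> B i) \<inter> (A j \<union> B j) = {}" using g(3)[OF ij] by blast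
  qed
qed

end

text \<open>When \<open>lam k = 0\<close> the right-hand side is 0 and so is the Cheeger constant,
  so strictness is claimed only for \<open>lam k > 0\<close>. If even \<open>lam l = 0\<close>, the
  quotient is read as 0.\<close>

theorem theorem1p5:
  shows "\<exists>C::real. \<forall>N E w \<sigma> (k::nat) (l::nat).
    signed_graph N E w \<sigma> \<longrightarrow> 1 \<le> k \<longrightarrow> k \<le> l \<longrightarrow> l \<le> N \<longrightarrow>
      (let h = signed_graph.cheeger_const N E w \<sigma> k (signed_graph.degree N w);
           lam = signed_graph.lam N E w \<sigma>;
           bound = C * real l * real k ^ 6 * (lam k / sqrt (lam l))
       in h \<le> bound \<and> (lam k > 0 \<longrightarrow> h < bound))"
proof (intro exI[of _ "2867425"] allI impI)
  fix N E w \<sigma> and k l :: nat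
  assume G: "signed_graph N E w \<sigma>" and k: "1 \<le> k" "k \<le> l" "l \<le> N"
  interpret signed_graph N E w \<sigma> by (rule G)
  define X where "X = real l * real k ^ 6 * (lam k / sqrt (lam l))"
  have h: "cheeger_const k degree \<le> 2867424 * X" unfolding X_def by (rule improved_cheeger[OF k])
  have lam0: "0 \<le> lam l" "0 \<le> lam k" "lam k \<le> lam l"
    using lam_bounds[of l] lam_bounds[of k] lam_mono[OF k] k by auto
  then have X: "X \<ge> 0" by (simp add: X_def)
  \<comment> \<open>Positivity of \<open>X\<close> makes the inequality strict once the constant is
    raised by 1.\<close>
  have X_pos: "X > 0" if "lam k > 0" using that lam0 k by (simp add: X_def)
  have bound: "2867425 * real l * real k ^ 6 * (lam k / sqrt (lam l)) = 2867425 * X"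
    by (simp add: X_def)
  show "let h = cheeger_const k degree; lam = lam;
      bound = 2867425 * real l * real k ^ 6 * (lam k / sqrt (lam l))
    in h \<le> bound \<and> (lam k > 0 \<longrightarrow> h < bound)"
    unfolding Let_def bound
  proof (intro conjI impI)
    show "cheeger_const k degree \<le> 2867425 * X" using h X by linarith
  next
    assume "0 < lam k"
    then show "cheeger_const k degree < 2867425 * X" using h X_pos by linarith
  qed
qed

end
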